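(* Let $d\ge 1$ and $n\ge 3$. Then $$\mathcal{R}(d,n)=\Big\{\lambda=(\lambda^{(0)},\dots,\lambda^{(d-1)})\in\mathcal{P}(d,n)\;\Big|\;\sum_{i=0}^{d-1}\lambda^{(i)}_1\le 2\Big\}.$$ That is, the irreducible representations of $\mathbb{C}(u)\mathrm{YTL}_{d,n}(u)$ are exactly the $\rho^\lambda$ for the $d$-partitions $\lambda$ of $n$ whose Young $d$-diagram has at most two columns in total.
   Context: Let $d,n\ge1$ be integers and $u$ an indeterminate. The Yokonuma–Hecke algebra $\mathrm{Y}_{d,n}(u)$ is the associative $\mathbb{C}[u,u^{-1}]$-algebra generated by $g_1,\dots,g_{n-1},t_1,\dots,t_n$ subject to: $g_ig_j=g_jg_i$ for $|i-j|>1$; $g_ig_{i+1}g_i=g_{i+1}g_ig_{i+1}$ for $1\le i\le n-2$; $t_it_j=t_jt_i$ for all $i,j$; $t_jg_i=g_it_{s_i(j)}$ for all $i,j$, where $s_i$ is the transposition $(i,i+1)$; $t_j^d=1$ for all $j$; and $g_i^2=1+(u-1)e_i+(u-1)e_ig_i$, where $e_i=\frac1d\sum_{s=0}^{d-1}t_i^st_{i+1}^{-s}$. For $n\ge3$, the Yokonuma–Temperley–Lieb algebra $\mathrm{YTL}_{d,n}(u)$ is the quotient of $\mathrm{Y}_{d,n}(u)$ by the two-sided ideal generated by the elements $g_ig_{i+1}g_i+g_ig_{i+1}+g_{i+1}g_i+g_i+g_{i+1}+1$, $1\le i\le n-2$; images of the generators in the quotient are denoted by the same letters. For a $\mathbb{C}[u,u^{-1}]$-algebra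 $B$, write $\mathbb{C}(u)B=\mathbb{C}(u)\otimes_{\mathbb{C}[u,u^{-1}]}B$. A $d$-partition of $n$ is a $d$-tuple $\lambda=(\lambda^{(0)},\dots,\lambda^{(d-1)})$ of partitions whose sizes sum to $n$; $\mathcal{P}(d,n)$ denotes the set of them. For a partition $\mu$, $\mu_1$ denotes its largest part ($\mu_1=0$ if $\mu=\emptyset$). Let $G(d,1,n)=(\mathbb{Z}/d\mathbb{Z})^n\rtimes\mathfrak{S}_n$. Its irreducible complex representations $E^\lambda$, $\lambda\in\mathcal P(d,n)$, are labelled in the standard (Specht) way: with $k_i=|\lambda^{(i)}|$, $E^\lambda$ is induced from $\prod_{i=0}^{d-1}G(d,1,k_i)$ of the outer tensor product whose $i$-th factor is the representation on which each coordinate of $(\mathbb Z/d\mathbb Z)^{k_i}$ acts by the character sending a generator to $\xi^i$ ($\xi$ a fixed primitive $d$-th root of unity) and $\mathfrak{S}_{k_i}$ acts through the Specht module of $\lambda^{(i)}$. The algebra $\mathbb{C}(u)\mathrm{Y}_{d,n}(u)$ is split semisimple with irreducible representations $\rho^\lambda$, $\lambda\in\mathcal P(d,n)$, where $\rho^\lambda$ specializes at $u=1$ to $E^\lambda$. Let $\mathcal{R}(d,n)$ be the set of $\lambda\in\mathcal P(d,n)$ such that $\rho^\lambda(g_1g_2g_1+g_1g_2+g_2g_1+g_1+g_2+1)=0$; equivalently the $\rho^\lambda$ with $\lambda\in\mathcal R(d,n)$ are exactly the representations factoring through (and giving all irreducible representations of) $\mathbb{C}(u)\mathrm{YTL}_{d,n}(u)$.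 *)

theory Defs
  imports Complex_Main
    "HOL-Computational_Algebra.Polynomial"
    "HOL-Computational_Algebra.Fraction_Field"
    "HOL-Combinatorics.Permutations"
    "HOL-Library.FuncSet"
    "Jordan_Normal_Form.Matrix"
begin

definition is_partition :: "nat list \<Rightarrow> bool" where
  "is_partition \<mu> \<longleftrightarrow> (\<forall>i. Suc i < length \<mu> \<longrightarrow> \<mu> ! Suc i \<le> \<mu> ! i) \<and> (\<forall>x\<in>set \<mu>. 0 < x)"

definition first_part :: "nat list \<Rightarrow> nat" where
  "first_part \<mu> = (if \<mu> = [] then 0 else hd \<mu>)"

definition dpartitions :: "nat \<Rightarrow> nat \<Rightarrow> nat list list set" where
  "dpartitions d n = {lam. length lam = d \<and> (\<forall>\<mu>\<in>set lam. is_partition \<mu>)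
                        \<and> sum_list (map sum_list lam) = n}"

text \<open>Boxes (component i, row r, column c) of the Young d-diagram; 0-based.\<close>
definition boxes :: "nat list list \<Rightarrow> (nat \<times> nat \<times> nat) set" where
  "boxes lam = {(i, r, c). i < length lam \<and> r < length (lam ! i) \<and> c < lam ! i ! r}"

text \<open>d-tableaux: bijections from the numbers 1..n to the boxes
  (given as the position of each number).\<close>
definition dtableaux :: "nat \<Rightarrow> nat list list \<Rightarrow> (nat \<Rightarrow> nat \<times> nat \<times> nat) set" where
  "dtableaux n lam = {T. T \<in> {1..n} \<rightarrow>\<^sub>E boxes lam \<and> bij_betw T {1..n} (boxes lam)}"

definition tabloid_of :: "nat \<Rightarrow> (nat \<Rightarrow> nat \<times> nat \<times> nat) \<Rightarrow> (nat \<Rightarrow> nat \<times> nat)" where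
  "tabloid_of n T = (\<lambda>j. if j \<in> {1..n} then (fst (T j), fst (snd (T j))) else undefined)"

definition col_stab :: "nat \<Rightarrow> (nat \<Rightarrow> nat \<times> nat \<times> nat) \<Rightarrow> (nat \<Rightarrow> nat) set" where
  "col_stab n T = {\<pi>. \<pi> permutes {1..n} \<and>
      (\<forall>j\<in>{1..n}. fst (T (\<pi> j)) = fst (T j) \<and> snd (snd (T (\<pi> j))) = snd (snd (T j)))}"

text \<open>Polytabloid e_T, an element of the monomial module C[d-tabloids]
  (vectors are complex functions on tabloids).\<close>
definition polytabloid :: "nat \<Rightarrow> (nat \<Rightarrow> nat \<times> nat \<times> nat) \<Rightarrow> ((nat \<Rightarrow> nat \<times> nat) \<Rightarrow> complex)" where
  "polytabloid n T = (\<lambda>\<tau>. \<Sum>\<pi>\<in>col_stab n T. of_int (sign \<pi>) * (if \<tau> = tabloid_of n (T \<circ> \<pi>) then 1 else 0))"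

definition specht :: "nat \<Rightarrow> nat list list \<Rightarrow> ((nat \<Rightarrow> nat \<times> nat) \<Rightarrow> complex) set" where
  "specht n lam = {(\<lambda>\<tau>. \<Sum>T\<in>dtableaux n lam. c T * polytabloid n T \<tau>) | c. True}"

definition sgen :: "nat \<Rightarrow> nat \<Rightarrow> nat" where
  "sgen i j = (if j = i then Suc i else if j = Suc i then i else j)"

definition xi :: "nat \<Rightarrow> complex" where
  "xi d = cis (2 * pi / real d)"

text \<open>Action of the generators s_i and t_j of G(d,1,n) on the monomial module:
  s_i permutes numbers; t_j acts on a tabloid by xi^k where k is the component containing j.\<close>
definition act_s :: "nat \<Rightarrow> ((nat \<Rightarrow> nat \<times> nat) \<Rightarrow> complex) \<Rightarrow> ((nat \<Rightarrow> nat \<times> nat) \<Rightarrow> complex)" where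
  "act_s i v = (\<lambda>\<tau>. v (\<tau> \<circ> sgen i))"

definition act_t :: "nat \<Rightarrow> nat \<Rightarrow> ((nat \<Rightarrow> nat \<times> nat) \<Rightarrow> complex) \<Rightarrow> ((nat \<Rightarrow> nat \<times> nat) \<Rightarrow> complex)" where
  "act_t d j v = (\<lambda>\<tau>. xi d ^ fst (\<tau> j) * v \<tau>)"

definition iso_to_specht ::
  "nat \<Rightarrow> nat \<Rightarrow> nat list list \<Rightarrow> nat \<Rightarrow> (nat \<Rightarrow> complex mat) \<Rightarrow> (nat \<Rightarrow> complex mat) \<Rightarrow> bool" where
  "iso_to_specht d n lam m S T \<longleftrightarrow>
     (\<exists>f :: complex vec \<Rightarrow> ((nat \<Rightarrow> nat \<times> nat) \<Rightarrow> complex).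
        bij_betw f (carrier_vec m) (specht n lam) \<and>
        (\<forall>v\<in>carrier_vec m. \<forall>w\<in>carrier_vec m. f (v + w) = (\<lambda>\<tau>. f v \<tau> + f w \<tau>)) \<and>
        (\<forall>v\<in>carrier_vec m. \<forall>c. f (c \<cdot>\<^sub>v v) = (\<lambda>\<tau>. c * f v \<tau>)) \<and>
        (\<forall>i\<in>{1..<n}. \<forall>v\<in>carrier_vec m. f (S i *\<^sub>v v) = act_s i (f v)) \<and>
        (\<forall>j\<in>{1..n}. \<forall>v\<in>carrier_vec m. f (T j *\<^sub>v v) = act_t d j (f v)))"

type_synonym Cu = "complex poly fract"

definition uu :: Cu where
  "uu = Fract [:0, 1:] 1"

fun matsum :: "nat \<Rightarrow> (nat \<Rightarrow> 'a :: semiring_1 mat) \<Rightarrow> nat \<Rightarrow> 'a mat" where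
  "matsum m f 0 = 0\<^sub>m m m"
| "matsum m f (Suc k) = matsum m f k + f k"

text \<open>The idempotent e_i = (1/d) sum_s t_i^s t_(i+1)^(-s), with t^(-s) = t^(d-s) since t^d = 1.\<close>
definition e_mat :: "nat \<Rightarrow> nat \<Rightarrow> (nat \<Rightarrow> 'a :: field mat) \<Rightarrow> nat \<Rightarrow> 'a mat" where
  "e_mat d m T i = (1 / of_nat d) \<cdot>\<^sub>m matsum m (\<lambda>s. (T i ^\<^sub>m s) * (T (Suc i) ^\<^sub>m (d - s))) d"

text \<open>(G, T) with G i = rho(g_i), T j = rho(t_j) is an m-dimensional representation of
  Y_{d,n}(u) (over a field containing the parameter u).\<close>
definition is_Y_rep :: "nat \<Rightarrow> nat \<Rightarrow> 'a :: field \<Rightarrow> nat \<Rightarrow> (nat \<Rightarrow> 'a mat) \<Rightarrow> (nat \<Rightarrow> 'a mat) \<Rightarrow> bool" where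
  "is_Y_rep d n u m G T \<longleftrightarrow>
     (\<forall>i\<in>{1..<n}. G i \<in> carrier_mat m m) \<and>
     (\<forall>j\<in>{1..n}. T j \<in> carrier_mat m m) \<and>
     (\<forall>i\<in>{1..<n}. \<forall>j\<in>{1..<n}. (i > j + 1 \<or> j > i + 1) \<longrightarrow> G i * G j = G j * G i) \<and>
     (\<forall>i. 1 \<le> i \<and> i + 2 \<le> n \<longrightarrow> G i * G (Suc i) * G i = G (Suc i) * G i * G (Suc i)) \<and>
     (\<forall>i\<in>{1..n}. \<forall>j\<in>{1..n}. T i * T j = T j * T i) \<and>
     (\<forall>i\<in>{1..<n}. \<forall>j\<in>{1..n}. T j * G i = G i * T (sgen i j)) \<and>
     (\<forall>j\<in>{1..n}. T j ^\<^sub>m d = 1\<^sub>m m) \<and>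
     (\<forall>i\<in>{1..<n}. G i * G i = 1\<^sub>m m + (u - 1) \<cdot>\<^sub>m e_mat d m T i + (u - 1) \<cdot>\<^sub>m (e_mat d m T i * G i))"

definition invariant_subspace :: "nat \<Rightarrow> nat \<Rightarrow> (nat \<Rightarrow> 'a :: field mat) \<Rightarrow> (nat \<Rightarrow> 'a mat) \<Rightarrow> 'a vec set \<Rightarrow> bool" where
  "invariant_subspace n m G T W \<longleftrightarrow>
     W \<subseteq> carrier_vec m \<and> 0\<^sub>v m \<in> W \<and>
     (\<forall>v\<in>W. \<forall>w\<in>W. v + w \<in> W) \<and> (\<forall>v\<in>W. \<forall>c. c \<cdot>\<^sub>v v \<in> W) \<and>
     (\<forall>i\<in>{1..<n}. \<forall>v\<in>W. G i *\<^sub>v v \<in> W) \<and> (\<forall>j\<in>{1..n}. \<forall>v\<in>W. T j *\<^sub>v v \<in> W)"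

definition irreducible_rep :: "nat \<Rightarrow> nat \<Rightarrow> (nat \<Rightarrow> 'a :: field mat) \<Rightarrow> (nat \<Rightarrow> 'a mat) \<Rightarrow> bool" where
  "irreducible_rep n m G T \<longleftrightarrow> 0 < m \<and>
     (\<forall>W. invariant_subspace n m G T W \<longrightarrow> W = {0\<^sub>v m} \<or> W = carrier_vec m)"

definition regular_at_1 :: "Cu \<Rightarrow> bool" where
  "regular_at_1 x \<longleftrightarrow> (\<exists>p q. poly q 1 \<noteq> 0 \<and> x = Fract p q)"

definition eval_at_1 :: "Cu \<Rightarrow> complex" where
  "eval_at_1 x = (THE c. \<exists>p q. poly q 1 \<noteq> 0 \<and> x = Fract p q \<and> c = poly p 1 / poly q 1)"

definition specializes_to ::
  "nat \<Rightarrow> nat \<Rightarrow> nat list list \<Rightarrow> nat \<Rightarrow> (nat \<Rightarrow> Cu mat) \<Rightarrow> (nat \<Rightarrow> Cu mat) \<Rightarrow> bool" where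
  "specializes_to d n lam m G T \<longleftrightarrow>
     (\<forall>i\<in>{1..<n}. \<forall>a<m. \<forall>b<m. regular_at_1 (G i $$ (a, b))) \<and>
     (\<forall>j\<in>{1..n}. \<forall>a<m. \<forall>b<m. regular_at_1 (T j $$ (a, b))) \<and>
     iso_to_specht d n lam m (\<lambda>i. map_mat eval_at_1 (G i)) (\<lambda>j. map_mat eval_at_1 (T j))"

definition rho :: "nat \<Rightarrow> nat \<Rightarrow> nat list list \<Rightarrow> nat \<times> (nat \<Rightarrow> Cu mat) \<times> (nat \<Rightarrow> Cu mat)" where
  "rho d n lam = (SOME (m, G, T). is_Y_rep d n uu m G T \<and> irreducible_rep n m G T
                                  \<and> specializes_to d n lam m G T)"

definition YTL_labels :: "nat \<Rightarrow> nat \<Rightarrow> nat list list set" where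
  "YTL_labels d n = {lam\<in>dpartitions d n.
     (case rho d n lam of (m, G, T) \<Rightarrow>
        G 1 * G 2 * G 1 + G 1 * G 2 + G 2 * G 1 + G 1 + G 2 + 1\<^sub>m m = 0\<^sub>m m m)}"

end

theory Submission
  imports Defs "HOL-Library.Product_Lexorder"
begin

text \<open>
  To construct \<open>\<rho>\<^sup>\<lambda>\<close>, consider functions on row words (assignments of a component and a row
  to each of \<open>1, \<dots>, n\<close>). They carry a tensor space action of the Yokonuma--Hecke algebra that specializes at \<open>u = 1\<close> to the permutation module on tabloids. For
  the column reading tableau, the vectors of the right weight on which the column generators act by
  \<open>-1\<close> form a line spanned by an explicit vector \<open>z\<close> deforming the polytabloid. Averaging the rank
  one operator \<open>v \<mapsto> \<ell>(v) z\<close> over dual bases of the algebra gives an equivariant operator; since the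
  antisymmetric vectors form a line, it is a scalar multiple \<open>c\<close> of an idempotent, and \<open>c \<noteq> 0\<close>
  because at \<open>u = 1\<close> it is a sum of squares. Its image is irreducible and regular at \<open>1\<close>, with the
  Specht module as reduction.

  For any such representation let \<open>E = g\<^sub>1g\<^sub>2g\<^sub>1 + g\<^sub>1g\<^sub>2 + g\<^sub>2g\<^sub>1 + g\<^sub>1 + g\<^sub>2 + 1\<close>. Then
  \<open>g\<^sub>iE = (1 + (u - 1)e\<^sub>i)E\<close>, so a nonzero vector \<open>Ev\<close>, scaled to be regular with nonzero reduction,
  reduces to a vector of the Specht module fixed by \<open>s\<^sub>1\<close> and \<open>s\<^sub>2\<close>. Hence \<open>E = 0\<close> as soon as the
  symmetrizer of \<open>{1, 2, 3}\<close> kills the Specht module, and the converse is clear. With at most two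
  columns two of the three numbers share a column of every tableau, so the symmetrizer vanishes;
  with three columns it does not kill the polytabloid of a tableau having \<open>1, 2, 3\<close> in first rows
  of distinct columns.
\<close>

section \<open>Rational functions regular at 1\<close>

text \<open>\<open>rho\<close> is a Hilbert choice, so nothing is known about it before some triple
  with its defining properties has been exhibited; the construction serves this purpose. The final
  argument must then hold for every such triple, and so it works from the defining relations and the
  reduction at \<open>u = 1\<close>.

  What shapes the construction is that a space spanned by deformed vectors is hard to reduce: at
  \<open>u = 1\<close> relations may appear among the generators, and the reduction of the span may
  exceed the span of the reductions. The equation \<open>cas q v = (\<lambda>t. cc q * v t)\<close>
  avoids this. It specializes by itself, so regular solutions reduce to Specht vectors; conversely a
  constant lift of a Specht vector, passed through \<open>cas\<close> and divided by
  \<open>cc\<close>, is a solution that reduces to the given vector. The division has to make sense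
  at 1, which is why the value of \<open>cc\<close> there is computed. Scaling vectors before
  reduction is possible since the rational functions regular at 1 form a valuation ring.\<close>

definition spec :: "Cu \<Rightarrow> complex \<Rightarrow> bool" where
  "spec x c \<longleftrightarrow> (\<exists>p q. poly q 1 \<noteq> 0 \<and> x = Fract p q \<and> c = poly p 1 / poly q 1)"

definition emb :: "complex \<Rightarrow> Cu" where
  "emb c = Fract [:c:] 1"

lemma specI: "poly q 1 \<noteq> 0 \<Longrightarrow> x = Fract p q \<Longrightarrow> c = poly p 1 / poly q 1 \<Longrightarrow> spec x c"
  unfolding spec_def by blast

lemma spec_unique:
  assumes "spec x a" "spec x b"
  shows "a = b"
proof -
  obtain p q where 1: "poly q 1 \<noteq> 0" "x = Fract p q" "a = poly p 1 / poly q 1"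
    using assms(1) by (auto simp: spec_def)
  obtain p' q' where 2: "poly q' 1 \<noteq> 0" "x = Fract p' q'" "b = poly p' 1 / poly q' 1"
    using assms(2) by (auto simp: spec_def)
  have "q \<noteq> 0" "q' \<noteq> 0" using 1 2 by auto
  then have "p * q' = p' * q" using 1 2 by (simp add: eq_fract)
  then have "poly (p * q') 1 = poly (p' * q) 1" by simp
  then show ?thesis using 1 2 by (simp add: frac_eq_eq)
qed

lemma eval_at_1_eqI: "spec x c \<Longrightarrow> eval_at_1 x = c"
  unfolding eval_at_1_def spec_def[symmetric]
  by (rule the_equality) (blast intro: spec_unique)+

lemma spec_iff: "spec x c \<longleftrightarrow> regular_at_1 x \<and> eval_at_1 x = c"
proof
  assume "spec x c"
  then show "regular_at_1 x \<and> eval_at_1 x = c"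
    using eval_at_1_eqI unfolding regular_at_1_def spec_def by blast
next
  assume a: "regular_at_1 x \<and> eval_at_1 x = c"
  then obtain c' where "spec x c'" unfolding regular_at_1_def spec_def by blast
  with a show "spec x c" using eval_at_1_eqI by blast
qed

lemma spec_add:
  assumes "spec x a" "spec y b" shows "spec (x + y) (a + b)"
proof -
  obtain p q where 1: "poly q 1 \<noteq> 0" "x = Fract p q" "a = poly p 1 / poly q 1"
    using assms(1) by (auto simp: spec_def)
  obtain p' q' where 2: "poly q' 1 \<noteq> 0" "y = Fract p' q'" "b = poly p' 1 / poly q' 1"
    using assms(2) by (auto simp: spec_def)
  have "q \<noteq> 0" "q' \<noteq> 0" using 1 2 by auto
  then have "x + y = Fract (p * q' + p' * q) (q * q')" using 1 2 by simp
  then show ?thesis using 1 2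
    by (intro specI[of "q * q'" _ "p * q' + p' * q"]) (simp_all add: add_frac_eq)
qed

lemma spec_mult:
  assumes "spec x a" "spec y b" shows "spec (x * y) (a * b)"
proof -
  obtain p q where 1: "poly q 1 \<noteq> 0" "x = Fract p q" "a = poly p 1 / poly q 1"
    using assms(1) by (auto simp: spec_def)
  obtain p' q' where 2: "poly q' 1 \<noteq> 0" "y = Fract p' q'" "b = poly p' 1 / poly q' 1"
    using assms(2) by (auto simp: spec_def)
  show ?thesis using 1 2
    by (intro specI[of "q * q'" _ "p * p'"]) simp_all
qed

lemma spec_emb: "spec (emb c) c"
  by (rule specI[of 1 _ "[:c:]"]) (simp_all add: emb_def)

lemma emb_0 [simp]: "emb 0 = 0" and emb_1 [simp]: "emb 1 = 1"
  by (simp_all add: emb_def Zero_fract_def One_fract_def one_pCons)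

lemma emb_mult: "emb (a * b) = emb a * emb b"
  by (simp add: emb_def mult.commute)

lemma emb_power: "emb (a ^ k) = emb a ^ k"
  by (induction k) (simp_all add: emb_mult)

lemma emb_inj: "emb a = emb b \<longleftrightarrow> a = b"
  by (simp add: emb_def eq_fract)

lemma spec_0: "spec 0 0" and spec_1: "spec 1 1"
  using spec_emb[of 0] spec_emb[of 1] by simp_all

lemma spec_uminus: assumes "spec x a" shows "spec (- x) (- a)"
proof -
  have "emb (-1) = -1" by (simp add: emb_def One_fract_def one_pCons)
  then show ?thesis using spec_mult[OF spec_emb[of "-1"] assms] by simp
qed

lemma spec_diff: "spec x a \<Longrightarrow> spec y b \<Longrightarrow> spec (x - y) (a - b)"
  using spec_add[of x a "- y" "- b"] spec_uminus[of y b] by simp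

lemma spec_inverse:
  assumes "spec x a" "a \<noteq> 0" shows "spec (inverse x) (inverse a)"
proof -
  obtain p q where 1: "poly q 1 \<noteq> 0" "x = Fract p q" "a = poly p 1 / poly q 1"
    using assms(1) by (auto simp: spec_def)
  show ?thesis using 1 assms(2)
    by (intro specI[of p _ q]) simp_all
qed

lemma spec_divide: "spec x a \<Longrightarrow> spec y b \<Longrightarrow> b \<noteq> 0 \<Longrightarrow> spec (x / y) (a / b)"
  by (simp add: field_class.field_divide_inverse spec_mult spec_inverse)

lemma spec_power: "spec x a \<Longrightarrow> spec (x ^ k) (a ^ k)"
  by (induction k) (auto intro: spec_mult spec_1)

lemma spec_sum: "(\<And>i. i \<in> I \<Longrightarrow> spec (f i) (g i)) \<Longrightarrow> spec (sum f I) (sum g I)"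
  by (induction I rule: infinite_finite_induct) (auto intro: spec_add spec_0)

lemma spec_of_nat: "spec (of_nat k) (of_nat k)"
  by (induction k) (auto intro: spec_add spec_0 spec_1)

lemma spec_uu: "spec uu 1"
  by (rule specI[of 1 _ "[:0, 1:]"]) (simp_all add: uu_def)

lemma spec_nonzero: "spec x a \<Longrightarrow> a \<noteq> 0 \<Longrightarrow> x \<noteq> 0"
  using spec_unique spec_0 by blast

lemma uu_neq: "uu \<noteq> 0" "uu \<noteq> -1"
proof -
  show "uu \<noteq> 0" using spec_nonzero[OF spec_uu] by simp
  show "uu \<noteq> -1" using spec_unique[OF spec_uu, of "-1"] spec_uminus[OF spec_1] by auto
qed

lemma of_nat_Cu_neq_0: "k \<noteq> 0 \<Longrightarrow> (of_nat k :: Cu) \<noteq> 0"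
  using spec_nonzero[OF spec_of_nat[of k]] by simp

text \<open>If numerator and denominator both vanish at 1, a common factor \<open>u - 1\<close> is
  cancelled, which lowers the degree of the numerator. Otherwise \<open>x\<close> or its inverse is
  visibly regular. This is the valuation ring property.\<close>

lemma regular_or_inverse_regular:
  assumes "x \<noteq> 0"
  shows "(\<exists>c. spec x c) \<or> (\<exists>c. spec (inverse x) c)"
proof -
  obtain p q where x: "x = Fract p q" "q \<noteq> 0" by (cases x)
  have "p \<noteq> 0" using x assms by (auto simp: Zero_fract_def eq_fract)
  from this x show ?thesis
  proof (induction "degree p" arbitrary: p q rule: less_induct)
    case less
    show ?case
    proof (cases "poly q 1 = 0")
      case False
      then have "spec x (poly p 1 / poly q 1)" using less(3) by (intro specI[of q _ p]) simp_all
      then show ?thesis by blast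
    next
      case True
      show ?thesis
      proof (cases "poly p 1 = 0")
        case False
        then have "spec (inverse x) (poly q 1 / poly p 1)" using less(3) by (intro specI[of p _ q]) simp_all
        then show ?thesis by blast
      next
        case p1: True
        obtain p' where p': "p = [:-1,1:] * p'" using p1 unfolding poly_eq_0_iff_dvd by (rule dvdE)
        obtain q' where q': "q = [:-1,1:] * q'" using True unfolding poly_eq_0_iff_dvd by (rule dvdE)
        have "p' \<noteq> 0" "q' \<noteq> 0" using less p' q' by auto
        have "degree p = Suc (degree p')" unfolding p' using \<open>p' \<noteq> 0\<close>
          by (subst degree_mult_eq) auto
        moreover have "x = Fract p' q'" using less(3) mult_fract_cancel[of "[:-1,1::complex:]" p' q'] unfolding p' q'
          by (simp del: mult_pCons_left mult_pCons_right)
        ultimately show ?thesis using less(1)[OF _ \<open>p' \<noteq> 0\<close> _ \<open>q' \<noteq> 0\<close>] by simp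
      qed
    qed
  qed
qed

text \<open>An element of least valuation divides all others. For a new element it suffices to
  compare it with the one found so far.\<close>

lemma finite_dominating_element:
  fixes f :: "'i \<Rightarrow> Cu"
  assumes "finite I" "I \<noteq> {}" "\<forall>i\<in>I. f i \<noteq> 0"
  shows "\<exists>i0\<in>I. \<forall>i\<in>I. \<exists>c. spec (f i / f i0) c"
  using assms
proof (induction I rule: finite_ne_induct)
  case (singleton x)
  then have "spec (f x / f x) 1" using spec_1 by simp
  then show ?case by blast
next
  case (insert j I)
  have "\<forall>i\<in>I. f i \<noteq> 0" using insert.prems by blast
  from insert.IH[OF this] obtain i0 where i0: "i0 \<in> I" "\<forall>i\<in>I. \<exists>c. spec (f i / f i0) c" by blast
  have nz: "f j \<noteq> 0" "f i0 \<noteq> 0" using insert.prems i0 by blast+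
  then have "f j / f i0 \<noteq> 0" by simp
  from regular_or_inverse_regular[OF this] show ?case
  proof
    assume "\<exists>c. spec (f j / f i0) c"
    then show ?thesis using i0 by blast
  next
    assume "\<exists>c. spec (inverse (f j / f i0)) c"
    then obtain c where c: "spec (f i0 / f j) c" by auto
    have "\<exists>c. spec (f i / f j) c" if i: "i \<in> I" for i
    proof -
      obtain b where "spec (f i / f i0) b" using i0 i by blast
      from spec_mult[OF this c] have "spec (f i / f j) (b * c)" using nz by simp
      then show ?thesis by blast
    qed
    moreover have "spec (f j / f j) 1" using nz spec_1 by simp
    ultimately show ?thesis by blast
  qed
qed

text \<open>Makes a nonzero vector reducible at 1 without losing it: after division by a coordinate
  of least valuation all coordinates are regular and one of them is 1.\<close>

lemma primitive_scaling:
  fixes f :: "'i \<Rightarrow> Cu"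
  assumes "finite I" "i1 \<in> I" "f i1 \<noteq> 0"
  shows "\<exists>s i0. i0 \<in> I \<and> s * f i0 = 1 \<and> (\<forall>i\<in>I. \<exists>c. spec (s * f i) c)"
proof -
  let ?J = "{i\<in>I. f i \<noteq> 0}"
  have "finite ?J" "?J \<noteq> {}" "\<forall>i\<in>?J. f i \<noteq> 0" using assms by auto
  from finite_dominating_element[OF this]
  obtain i0 where i0: "i0 \<in> ?J" "\<forall>i\<in>?J. \<exists>c. spec (f i / f i0) c" by blast
  have "\<exists>c. spec (inverse (f i0) * f i) c" if "i \<in> I" for i
  proof (cases "f i = 0")
    case True
    then show ?thesis using spec_0 by auto
  next
    case False
    then obtain c where "spec (f i / f i0) c" using i0(2) \<open>i \<in> I\<close> by blast
    then have "spec (inverse (f i0) * f i) c" by (simp add: field_class.field_divide_inverse mult.commute)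
    then show ?thesis by blast
  qed
  then show "\<exists>s i0. i0 \<in> I \<and> s * f i0 = 1 \<and> (\<forall>i\<in>I. \<exists>c. spec (s * f i) c)"
    using i0(1) left_inverse[of "f i0"] by (intro exI[of _ "inverse (f i0)"] exI[of _ i0]) blast
qed

section \<open>Adjacent transpositions and reduced words\<close>

lemma sgen_eq_transpose: "sgen i = Transposition.transpose i (Suc i)"
  by (auto simp: sgen_def transpose_def fun_eq_iff)

lemma sgen_permutes: "i \<in> {1..<n} \<Longrightarrow> sgen i permutes {1..n}"
  unfolding sgen_eq_transpose by (rule permutes_swap_id) auto

lemma sgen_sgen [simp]: "sgen i (sgen i j) = j"
  by (simp add: sgen_def)

lemma sgen_comp_sgen [simp]: "sgen i \<circ> sgen i = id"
  by (auto simp: fun_eq_iff)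

lemma comp_sgen_sgen [simp]: "f \<circ> sgen i \<circ> sgen i = f"
  by (simp add: comp_assoc)

lemma sgen_simps [simp]: "sgen i i = Suc i" "sgen i (Suc i) = i"
  by (simp_all add: sgen_def)

lemma comp_sgen_eq: "w (Suc i) = w i \<Longrightarrow> w \<circ> sgen i = w"
  by (auto simp: sgen_def fun_eq_iff)

lemma sgen_commute: "Suc i < j \<Longrightarrow> sgen i \<circ> sgen j = sgen j \<circ> sgen i"
  by (auto simp: sgen_def fun_eq_iff)

lemma sgen_braid: "sgen i \<circ> sgen (Suc i) \<circ> sgen i = sgen (Suc i) \<circ> sgen i \<circ> sgen (Suc i)"
  by (auto simp: sgen_def fun_eq_iff)

lemma sgen_mem: "i \<in> {1..<n} \<Longrightarrow> j \<in> {1..n} \<Longrightarrow> sgen i j \<in> {1..n}"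
  by (auto simp: sgen_def)

lemma sign_sgen: "sign (sgen i) = -1"
  unfolding sgen_eq_transpose by (simp add: sign_swap_id)

text \<open>A substitute for Coxeter length as termination measure: early positions weigh more, so
  moving the larger of two neighbouring values to the right lowers the sum, and only two summands
  change.\<close>

definition descent_weight :: "nat \<Rightarrow> (nat \<Rightarrow> nat) \<Rightarrow> nat" where
  "descent_weight n p = (\<Sum>j\<in>{1..n}. (n - j) * p j)"

lemma descent_weight_less:
  assumes "i \<in> {1..<n}" "p (Suc i) < p i"
  shows "descent_weight n (p \<circ> sgen i) < descent_weight n p"
proof -
  have s: "{1..n} = insert i (insert (Suc i) ({1..n} - {i, Suc i}))" using assms by auto
  have split: "descent_weight n f = (n - i) * f i + ((n - Suc i) * f (Suc i)
      + (\<Sum>j\<in>{1..n} - {i, Suc i}. (n - j) * f j))" for f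
    unfolding descent_weight_def by (subst s) simp
  have r: "(\<Sum>j\<in>{1..n} - {i, Suc i}. (n - j) * (p \<circ> sgen i) j) = (\<Sum>j\<in>{1..n} - {i, Suc i}. (n - j) * p j)"
    by (rule sum.cong) (auto simp: sgen_def)
  obtain k where k: "n - i = Suc k" "n - Suc i = k" using assms(1) by (cases "n - i") auto
  show ?thesis unfolding split[of "p \<circ> sgen i"] split[of p] r k using assms(2) by simp
qed

lemma permutes_no_descent:
  assumes p: "p permutes {1..n}" and asc: "\<And>i. i \<in> {1..<n} \<Longrightarrow> p i < p (Suc i)"
  shows "p = id"
proof -
  have ge: "j \<le> p j" if "j \<in> {1..n}" for j
    using that
  proof (induction j)
    case (Suc j)
    show ?case
    proof (cases "j = 0")
      case True
      then show ?thesis using permutes_in_image[OF p, of 1] Suc by auto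
    next
      case False
      then show ?thesis using Suc asc[of j] by auto
    qed
  qed simp
  \<comment> \<open>A permutation preserves the sum of all entries, so the inequalities
    \<open>j \<le> p j\<close> are equalities.\<close>
  have "sum id {1..n} = sum (id \<circ> p) {1..n}" using p by (rule sum.permute)
  then have eq: "(\<Sum>j\<in>{1..n}. j) = (\<Sum>j\<in>{1..n}. p j)" by simp
  have "j = p j" if "j \<in> {1..n}" for j
    by (rule sum_mono_inv[OF eq ge that]) auto
  then have "p j = j" for j using permutes_not_in[OF p] by (cases "j \<in> {1..n}") auto
  then show ?thesis by (simp add: fun_eq_iff)
qed

lemma permutes_descent_cases:
  assumes "p permutes {1..n}"
  obtains "p = id" | i where "i \<in> {1..<n}" "p (Suc i) < p i"
proof (cases "\<exists>i\<in>{1..<n}. p (Suc i) < p i")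
  case True
  then show ?thesis using that by blast
next
  case False
  have "p i < p (Suc i)" if "i \<in> {1..<n}" for i
  proof -
    have "p i \<noteq> p (Suc i)" by (simp add: inj_eq[OF permutes_inj[OF assms]])
    moreover have "\<not> p (Suc i) < p i" using False that by blast
    ultimately show ?thesis by simp
  qed
  then show ?thesis using permutes_no_descent[OF assms] that(1) by blast
qed

lemma permutes_comp_sgen: "p permutes {1..n} \<Longrightarrow> i \<in> {1..<n} \<Longrightarrow> p \<circ> sgen i permutes {1..n}"
  by (rule permutes_compose[OF sgen_permutes])

text \<open>Induction along reduced words: each step multiplies on the right by an adjacent
  transposition at an ascent. Families built by \<open>perm_family\<close> follow the same
  steps.\<close>

lemma permutes_ascent_induct [consumes 1, case_names id step]:
  assumes "p permutes {1..n}"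
    and "P id"
    and "\<And>p i. p permutes {1..n} \<Longrightarrow> i \<in> {1..<n} \<Longrightarrow> p i < p (Suc i) \<Longrightarrow> P p \<Longrightarrow> P (p \<circ> sgen i)"
  shows "P p"
  using assms(1)
proof (induction "descent_weight n p" arbitrary: p rule: less_induct)
  case less
  from less.prems show ?case
  proof (cases rule: permutes_descent_cases)
    case 1
    then show ?thesis using assms(2) by simp
  next
    case (2 i)
    have q: "p \<circ> sgen i permutes {1..n}" by (rule permutes_comp_sgen[OF less.prems 2(1)])
    have "P (p \<circ> sgen i)" by (rule less.hyps[OF descent_weight_less[of i n p, OF 2] q])
    then have "P (p \<circ> sgen i \<circ> sgen i)" using 2 by (intro assms(3)[OF q 2(1)]) simp_all
    then show ?thesis by (simp only: comp_sgen_sgen)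
  qed
qed

text \<open>Matsumoto's theorem: maps satisfying the braid relations, applied along a reduced word of a
  permutation, give a result independent of the word.\<close>
inductive reach :: "nat \<Rightarrow> (nat \<Rightarrow> 'b \<Rightarrow> 'b) \<Rightarrow> 'b \<Rightarrow> (nat \<Rightarrow> nat) \<Rightarrow> 'b \<Rightarrow> bool" for n h x0 where
  reach_id: "reach n h x0 id x0"
| reach_step: "reach n h x0 p x \<Longrightarrow> i \<in> {1..<n} \<Longrightarrow> p i < p (Suc i) \<Longrightarrow> reach n h x0 (p \<circ> sgen i) (h i x)"

definition perm_family :: "nat \<Rightarrow> (nat \<Rightarrow> 'b \<Rightarrow> 'b) \<Rightarrow> 'b \<Rightarrow> (nat \<Rightarrow> nat) \<Rightarrow> 'b" where
  "perm_family n h x0 p = (THE x. reach n h x0 p x)"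

lemma reach_permutes: "reach n h x0 p x \<Longrightarrow> p permutes {1..n}"
  by (induction rule: reach.induct) (blast intro: permutes_id permutes_comp_sgen)+

lemma reach_ex: "p permutes {1..n} \<Longrightarrow> \<exists>x. reach n h x0 p x"
  by (induction rule: permutes_ascent_induct) (blast intro: reach.intros)+

text \<open>Let two reduced words of \<open>p\<close> end in \<open>i\<close> and \<open>j\<close>.
  Both are descents of \<open>p\<close>, so \<open>p\<close> also has reduced words ending in each
  spelling of the longest element of the group generated by the two transpositions. Induction on the
  weight compares each given word with one spelling; the braid or commutation relation compares the
  spellings.\<close>

lemma reach_unique:
  assumes comm: "\<And>i j x. i \<in> {1..<n} \<Longrightarrow> j \<in> {1..<n} \<Longrightarrow> Suc i < j \<Longrightarrow> h i (h j x) = h j (h i x)"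
    and braid: "\<And>i x. i \<in> {1..<n} \<Longrightarrow> Suc i \<in> {1..<n} \<Longrightarrow>
      h i (h (Suc i) (h i x)) = h (Suc i) (h i (h (Suc i) x))"
    and "reach n h x0 p x" "reach n h x0 p y"
  shows "x = y"
  using assms(3,4)
proof (induction "descent_weight n p" arbitrary: p x y rule: less_induct)
  case less
  have perm: "p permutes {1..n}" by (rule reach_permutes[OF less.prems(1)])
  have step: "\<exists>i x'. i \<in> {1..<n} \<and> p (Suc i) < p i \<and> reach n h x0 (p \<circ> sgen i) x' \<and> x = h i x'"
    if r: "reach n h x0 p x" and np: "p \<noteq> id" for x
    using r
  proof cases
    case reach_id
    then show ?thesis using np by simp
  next
    case (reach_step r x' i)
    then have "p (Suc i) < p i" "reach n h x0 (p \<circ> sgen i) x'" by simp_all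
    then show ?thesis using reach_step by blast
  qed
  \<comment> \<open>A last step into the identity would start from the transposition at
    \<open>i\<close>, which has a descent there and not an ascent.\<close>
  have id_case: "x = x0" if r: "reach n h x0 id x" for x
    using r
  proof cases
    case (reach_step q x' i)
    have "q i = Suc i" "q (Suc i) = i"
      using fun_cong[OF reach_step(1), of "Suc i"] fun_cong[OF reach_step(1), of i] by simp_all
    then show ?thesis using reach_step(5) by simp
  qed simp
  show ?case
  proof (cases "p = id")
    case True
    then show ?thesis using id_case less.prems by blast
  next
    case False
    obtain i x' where i: "i \<in> {1..<n}" "p (Suc i) < p i" "reach n h x0 (p \<circ> sgen i) x'" "x = h i x'"
      using step[OF less.prems(1) False] by blast
    obtain j y' where j: "j \<in> {1..<n}" "p (Suc j) < p j" "reach n h x0 (p \<circ> sgen j) y'" "y = h j y'"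
      using step[OF less.prems(2) False] by blast
    have ui: "x' = w" if "reach n h x0 (p \<circ> sgen i) w" for w
      by (rule less.hyps[OF descent_weight_less[OF i(1,2)] i(3) that])
    have uj: "y' = w" if "reach n h x0 (p \<circ> sgen j) w" for w
      by (rule less.hyps[OF descent_weight_less[OF j(1,2)] j(3) that])
    have far: "h a (h b w) = h b (h a w) \<and> reach n h x0 (p \<circ> sgen a) (h b w) \<and> reach n h x0 (p \<circ> sgen b) (h a w)"
      if ab: "Suc a < b" "a \<in> {1..<n}" "b \<in> {1..<n}" "p (Suc a) < p a" "p (Suc b) < p b"
        and w: "reach n h x0 (p \<circ> sgen a \<circ> sgen b) w" for a b w
    proof (intro conjI)
      show "h a (h b w) = h b (h a w)" using comm ab by blast
      have "reach n h x0 (p \<circ> sgen a \<circ> sgen b \<circ> sgen b) (h b w)"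
        using w ab by (intro reach_step) (auto simp: sgen_def)
      then show "reach n h x0 (p \<circ> sgen a) (h b w)" by simp
      have "reach n h x0 (p \<circ> sgen b \<circ> sgen a) w"
        using w sgen_commute[OF ab(1)] by (simp add: comp_assoc)
      then have "reach n h x0 (p \<circ> sgen b \<circ> sgen a \<circ> sgen a) (h a w)"
        using ab by (intro reach_step) (auto simp: sgen_def)
      then show "reach n h x0 (p \<circ> sgen b) (h a w)" by simp
    qed
    have near: "h a (h b (h a w)) = h b (h a (h b w)) \<and> reach n h x0 (p \<circ> sgen a) (h b (h a w))
        \<and> reach n h x0 (p \<circ> sgen b) (h a (h b w))"
      if ab: "b = Suc a" "a \<in> {1..<n}" "b \<in> {1..<n}" "p (Suc a) < p a" "p (Suc b) < p b"
        and w: "reach n h x0 (p \<circ> sgen a \<circ> sgen b \<circ> sgen a) w" for a b w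
    proof (intro conjI)
      show "h a (h b (h a w)) = h b (h a (h b w))" using braid ab by blast
      have "reach n h x0 (p \<circ> sgen a \<circ> sgen b \<circ> sgen a \<circ> sgen a) (h a w)"
        using w ab by (intro reach_step) (auto simp: sgen_def)
      then have "reach n h x0 (p \<circ> sgen a \<circ> sgen b) (h a w)" by simp
      then have "reach n h x0 (p \<circ> sgen a \<circ> sgen b \<circ> sgen b) (h b (h a w))"
        using ab by (intro reach_step) (auto simp: sgen_def)
      then show "reach n h x0 (p \<circ> sgen a) (h b (h a w))" by simp
      have "reach n h x0 (p \<circ> sgen b \<circ> sgen a \<circ> sgen b) w"
        using w sgen_braid[of a] ab(1) by (simp add: comp_assoc)
      then have "reach n h x0 (p \<circ> sgen b \<circ> sgen a \<circ> sgen b \<circ> sgen b) (h b w)"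
        using ab by (intro reach_step) (auto simp: sgen_def)
      then have "reach n h x0 (p \<circ> sgen b \<circ> sgen a) (h b w)" by simp
      then have "reach n h x0 (p \<circ> sgen b \<circ> sgen a \<circ> sgen a) (h a (h b w))"
        using ab by (intro reach_step) (auto simp: sgen_def)
      then show "reach n h x0 (p \<circ> sgen b) (h a (h b w))" by simp
    qed
    consider "i = j" | "Suc i < j" | "Suc j < i" | "j = Suc i" | "i = Suc j" by linarith
    then show ?thesis
    proof cases
      case 1
      then show ?thesis using ui j i by blast
    next
      case 2
      obtain w where "reach n h x0 (p \<circ> sgen i \<circ> sgen j) w"
        using reach_ex[where h=h and ?x0.0=x0, OF permutes_comp_sgen[OF permutes_comp_sgen[OF perm i(1)] j(1)]] by blast
      note w = far[OF 2 i(1) j(1) i(2) j(2) this]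
      show ?thesis using w ui[OF w[THEN conjunct2, THEN conjunct1]] uj[OF w[THEN conjunct2, THEN conjunct2]] i(4) j(4) by simp
    next
      case 3
      obtain w where "reach n h x0 (p \<circ> sgen j \<circ> sgen i) w"
        using reach_ex[where h=h and ?x0.0=x0, OF permutes_comp_sgen[OF permutes_comp_sgen[OF perm j(1)] i(1)]] by blast
      note w = far[OF 3 j(1) i(1) j(2) i(2) this]
      show ?thesis using w ui[OF w[THEN conjunct2, THEN conjunct2]] uj[OF w[THEN conjunct2, THEN conjunct1]] i(4) j(4) by simp
    next
      case 4
      obtain w where "reach n h x0 (p \<circ> sgen i \<circ> sgen j \<circ> sgen i) w"
        using reach_ex[where h=h and ?x0.0=x0, OF permutes_comp_sgen[OF permutes_comp_sgen[OF permutes_comp_sgen[OF perm i(1)] j(1)] i(1)]] by blast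
      note w = near[OF 4 i(1) j(1) i(2) j(2) this]
      show ?thesis using w ui[OF w[THEN conjunct2, THEN conjunct1]] uj[OF w[THEN conjunct2, THEN conjunct2]] i(4) j(4) by simp
    next
      case 5
      obtain w where "reach n h x0 (p \<circ> sgen j \<circ> sgen i \<circ> sgen j) w"
        using reach_ex[where h=h and ?x0.0=x0, OF permutes_comp_sgen[OF permutes_comp_sgen[OF permutes_comp_sgen[OF perm j(1)] i(1)] j(1)]] by blast
      note w = near[OF 5 j(1) i(1) j(2) i(2) this]
      show ?thesis using w ui[OF w[THEN conjunct2, THEN conjunct2]] uj[OF w[THEN conjunct2, THEN conjunct1]] i(4) j(4) by simp
    qed
  qed
qed

lemma perm_family:
  assumes comm: "\<And>i j x. i \<in> {1..<n} \<Longrightarrow> j \<in> {1..<n} \<Longrightarrow> Suc i < j \<Longrightarrow> h i (h j x) = h j (h i x)"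
    and braid: "\<And>i x. i \<in> {1..<n} \<Longrightarrow> Suc i \<in> {1..<n} \<Longrightarrow>
      h i (h (Suc i) (h i x)) = h (Suc i) (h i (h (Suc i) x))"
  shows perm_family_id: "perm_family n h x0 id = x0"
    and perm_family_step: "p permutes {1..n} \<Longrightarrow> i \<in> {1..<n} \<Longrightarrow> p i < p (Suc i) \<Longrightarrow>
      perm_family n h x0 (p \<circ> sgen i) = h i (perm_family n h x0 p)"
proof -
  note u = reach_unique[of n h x0, OF comm braid]
  have eq: "perm_family n h x0 p = x" if "reach n h x0 p x" for p x
    unfolding perm_family_def using u that by (intro the_equality) blast+
  show "perm_family n h x0 id = x0" by (rule eq[OF reach_id])
  show "perm_family n h x0 (p \<circ> sgen i) = h i (perm_family n h x0 p)"
    if p: "p permutes {1..n}" "i \<in> {1..<n}" "p i < p (Suc i)"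
  proof -
    obtain x where x: "reach n h x0 p x" using reach_ex[OF p(1), of h x0] by blast
    show ?thesis using eq[OF x] eq[OF reach_step[OF x p(2,3)]] by simp
  qed
qed

text \<open>\<open>B\<close> restricts the positions and \<open>A\<close> compares the letters, so
  that one counting lemma serves column inversions of words, inversions between equal components and
  ordinary length.\<close>

definition invs :: "nat \<Rightarrow> (nat \<Rightarrow> nat \<Rightarrow> bool) \<Rightarrow> ('l \<Rightarrow> 'l \<Rightarrow> bool) \<Rightarrow> (nat \<Rightarrow> 'l) \<Rightarrow> (nat \<times> nat) set" where
  "invs n B A w = {(j, k). 1 \<le> j \<and> j < k \<and> k \<le> n \<and> B j k \<and> A (w j) (w k)}"

lemma finite_invs: "finite (invs n B A w)"
  by (rule finite_subset[of _ "{1..n} \<times> {1..n}"]) (auto simp: invs_def)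

text \<open>Applying \<open>sgen i\<close> to both positions keeps the order of every pair except
  \<open>(i, Suc i)\<close>. The inversions therefore correspond one to one apart from this pair,
  which cannot be an inversion of \<open>w\<close>.\<close>

lemma card_invs_comp_sgen:
  assumes i: "i \<in> {1..<n}" and B: "\<And>j k. B (sgen i j) (sgen i k) = B j k"
    and A: "\<not> A (w i) (w (Suc i))"
  shows "card (invs n B A (w \<circ> sgen i)) = card (invs n B A w) + (if B i (Suc i) \<and> A (w (Suc i)) (w i) then 1 else 0)"
proof -
  let ?s = "map_prod (sgen i) (sgen i)"
  let ?X = "if B i (Suc i) \<and> A (w (Suc i)) (w i) then {(i, Suc i)} else {}"
  have inj: "inj ?s"
    by (rule inj_on_inverseI[of _ ?s]) auto
  have ord: "sgen i j < sgen i k" if "j < k" "(j, k) \<noteq> (i, Suc i)" for j k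
    using that by (auto simp: sgen_def)
  have ne: "(i, Suc i) \<notin> invs n B A w" using A by (simp add: invs_def)
  have eq: "invs n B A (w \<circ> sgen i) = ?s ` invs n B A w \<union> ?X"
  proof (intro equalityI subsetI)
    fix x assume x: "x \<in> invs n B A (w \<circ> sgen i)"
    obtain j k where jk: "x = (j, k)" by (cases x)
    show "x \<in> ?s ` invs n B A w \<union> ?X"
    proof (cases "(j, k) = (i, Suc i)")
      case True
      then show ?thesis using x jk by (auto simp: invs_def)
    next
      case False
      have *: "j \<in> {1..n}" "k \<in> {1..n}" "j < k" "B j k" "A (w (sgen i j)) (w (sgen i k))"
        using x jk by (simp_all add: invs_def)
      have "(sgen i j, sgen i k) \<in> invs n B A w"
        using ord[OF *(3) False] sgen_mem[OF i *(1)] sgen_mem[OF i *(2)] *(5) B[of j k] *(4)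
        by (simp add: invs_def)
      then have "?s (sgen i j, sgen i k) \<in> ?s ` invs n B A w" by (rule imageI)
      then show ?thesis using jk by simp
    qed
  next
    fix x assume "x \<in> ?s ` invs n B A w \<union> ?X"
    then show "x \<in> invs n B A (w \<circ> sgen i)"
    proof (elim UnE imageE)
      fix y assume y: "x = ?s y" "y \<in> invs n B A w"
      obtain j k where jk: "y = (j, k)" by (cases y)
      have "(j, k) \<noteq> (i, Suc i)" using y jk ne by auto
      have *: "j \<in> {1..n}" "k \<in> {1..n}" "j < k" "B j k" "A (w j) (w k)"
        using y jk by (simp_all add: invs_def)
      show ?thesis
        using ord[OF *(3) \<open>(j, k) \<noteq> (i, Suc i)\<close>] sgen_mem[OF i *(1)] sgen_mem[OF i *(2)] *(5) B[of j k] *(4) y jk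
        by (simp add: invs_def)
    next
      assume "x \<in> ?X"
      then show ?thesis using i by (auto simp: invs_def split: if_splits)
    qed
  qed
  have disj: "?s ` invs n B A w \<inter> ?X = {}"
  proof -
    have "(i, Suc i) \<notin> ?s ` invs n B A w"
    proof
      assume "(i, Suc i) \<in> ?s ` invs n B A w"
      then obtain j k where "(j, k) \<in> invs n B A w" "sgen i j = i" "sgen i k = Suc i" by auto
      then show False by (auto simp: invs_def sgen_def split: if_splits)
    qed
    then show ?thesis by auto
  qed
  have fin: "finite (?s ` invs n B A w)" by (intro finite_imageI finite_invs)
  have "card (?s ` invs n B A w) = card (invs n B A w)"
    by (rule card_image[OF inj_on_subset[OF inj subset_UNIV]])
  moreover have "card (?s ` invs n B A w \<union> ?X) = card (?s ` invs n B A w) + card ?X"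
    by (rule card_Un_disjoint[OF fin _ disj]) simp
  ultimately show ?thesis unfolding eq by simp
qed

section \<open>The tensor space representation\<close>

type_synonym word = "nat \<Rightarrow> nat \<times> nat"

text \<open>Jimbo's action on tensor space, written on coefficient functions; letters of different
  components are merely exchanged.\<close>
definition gop :: "'a::field \<Rightarrow> nat \<Rightarrow> (word \<Rightarrow> 'a) \<Rightarrow> word \<Rightarrow> 'a" where
  "gop q i v = (\<lambda>t. if fst (t i) \<noteq> fst (t (Suc i)) then v (t \<circ> sgen i)
     else if snd (t i) < snd (t (Suc i)) then q * v (t \<circ> sgen i)
     else if snd (t i) = snd (t (Suc i)) then q * v t
     else v (t \<circ> sgen i) + (q - 1) * v t)"

text \<open>Diagonal operators whose entries depend on the components only. Arbitrary
  \<open>M\<close> treats the \<open>t_j\<close>, the \<open>e_i\<close> and the projections onto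
  weights together.\<close>

definition mulw :: "((nat \<Rightarrow> nat) \<Rightarrow> 'a::field) \<Rightarrow> (word \<Rightarrow> 'a) \<Rightarrow> word \<Rightarrow> 'a" where
  "mulw M v = (\<lambda>t. M (fst \<circ> t) * v t)"

text \<open>The operator of \<open>e_i\<close>; its agreement with the average in
  \<open>e_mat\<close> needs components below \<open>d\<close> and is proved inside
  \<open>ex_Y_rep\<close>.\<close>

definition eop :: "nat \<Rightarrow> (word \<Rightarrow> 'a::field) \<Rightarrow> word \<Rightarrow> 'a" where
  "eop i = mulw (\<lambda>w. if w i = w (Suc i) then 1 else 0)"

definition tchar :: "'a::field \<Rightarrow> nat \<Rightarrow> (word \<Rightarrow> 'a) \<Rightarrow> word \<Rightarrow> 'a" where
  "tchar x j = mulw (\<lambda>w. x ^ w j)"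

definition lin_op :: "((word \<Rightarrow> 'a::field) \<Rightarrow> word \<Rightarrow> 'a) \<Rightarrow> bool" where
  "lin_op f \<longleftrightarrow> (\<forall>v w. f (\<lambda>t. v t + w t) = (\<lambda>t. f v t + f w t)) \<and> (\<forall>c v. f (\<lambda>t. c * v t) = (\<lambda>t. c * f v t))"

lemma lin_opI:
  "(\<And>v w t. f (\<lambda>t. v t + w t) t = f v t + f w t) \<Longrightarrow> (\<And>c v t. f (\<lambda>t. c * v t) t = c * f v t) \<Longrightarrow> lin_op f"
  unfolding lin_op_def by (simp add: fun_eq_iff)

lemma lin_op_add: "lin_op f \<Longrightarrow> f (\<lambda>t. v t + w t) = (\<lambda>t. f v t + f w t)"
  and lin_op_scale: "lin_op f \<Longrightarrow> f (\<lambda>t. c * v t) = (\<lambda>t. c * f v t)"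
  unfolding lin_op_def by blast+

lemma lin_op_0: "lin_op f \<Longrightarrow> f (\<lambda>t. 0) = (\<lambda>t. 0)"
  using lin_op_scale[of f 0 "\<lambda>t. 0"] by simp

lemma lin_op_uminus: "lin_op f \<Longrightarrow> f (\<lambda>t. - v t) = (\<lambda>t. - f v t)"
  using lin_op_scale[of f "-1" v] by simp

lemma lin_op_sum: "lin_op f \<Longrightarrow> f (\<lambda>t. \<Sum>i\<in>I. v i t) = (\<lambda>t. \<Sum>i\<in>I. f (v i) t)"
proof (induction I rule: infinite_finite_induct)
  case (insert j I)
  have "f (\<lambda>t. v j t + (\<Sum>i\<in>I. v i t)) = (\<lambda>t. f (v j) t + f (\<lambda>t. \<Sum>i\<in>I. v i t) t)"
    by (rule lin_op_add[OF insert.prems])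
  then show ?case using insert by simp
qed (simp_all add: lin_op_0)

lemma lin_op_comp: "lin_op f \<Longrightarrow> lin_op g \<Longrightarrow> lin_op (\<lambda>v. f (g v))"
  by (rule lin_opI) (simp_all add: lin_op_add lin_op_scale)

lemma lin_op_gop: "lin_op (gop q i)"
  by (rule lin_opI) (simp_all add: gop_def algebra_simps)

lemma lin_op_mulw: "lin_op (mulw M)"
  by (rule lin_opI) (simp_all add: mulw_def algebra_simps)

lemma gop_one: "gop 1 i = act_s i"
proof (intro ext)
  fix v :: "word \<Rightarrow> complex" and t :: word
  have "t \<circ> sgen i = t" if "fst (t i) = fst (t (Suc i))" "snd (t i) = snd (t (Suc i))"
    using that by (intro comp_sgen_eq) (simp add: prod_eq_iff)
  then show "gop 1 i v t = act_s i v t" by (auto simp: gop_def act_s_def)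
qed

lemma tchar_xi: "tchar (xi d) j = act_t d j"
  by (simp add: fun_eq_iff tchar_def mulw_def act_t_def)

lemma mulw_mulw: "mulw M (mulw N v) = mulw (\<lambda>w. M w * N w) v"
  by (simp add: mulw_def fun_eq_iff mult.assoc)

lemma gop_mulw: "gop q i (mulw M v) = mulw (\<lambda>w. M (w \<circ> sgen i)) (gop q i v)"
proof (intro ext)
  fix t :: word
  have "fst \<circ> t \<circ> sgen i = fst \<circ> t" if "fst (t i) = fst (t (Suc i))"
    using that by (intro comp_sgen_eq) simp
  then show "gop q i (mulw M v) t = mulw (\<lambda>w. M (w \<circ> sgen i)) (gop q i v) t"
    by (auto simp: gop_def mulw_def comp_assoc[symmetric] algebra_simps)
qed

lemma gop_eop: "gop q i (eop i v) = eop i (gop q i v)"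
  unfolding eop_def gop_mulw by (rule arg_cong[where f = "\<lambda>M. mulw M (gop q i v)"]) (auto simp: fun_eq_iff)

lemma tchar_gop: "tchar x j (gop q i v) = gop q i (tchar x (sgen i j) v)"
  unfolding tchar_def gop_mulw by simp

lemma gop_quadratic:
  "gop q i (gop q i v) = (\<lambda>t. v t + (q - 1) * eop i v t + (q - 1) * eop i (gop q i v) t)"
proof
  fix t :: word
  consider "fst (t i) \<noteq> fst (t (Suc i))" | "fst (t i) = fst (t (Suc i))" "snd (t i) < snd (t (Suc i))"
    | "fst (t i) = fst (t (Suc i))" "snd (t i) = snd (t (Suc i))"
    | "fst (t i) = fst (t (Suc i))" "snd (t (Suc i)) < snd (t i)"
    by linarith
  then show "gop q i (gop q i v) t = v t + (q - 1) * eop i v t + (q - 1) * eop i (gop q i v) t"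
    by cases (simp_all add: gop_def eop_def mulw_def algebra_simps)
qed

text \<open>The two-letter operator behind \<open>gop\<close>. It turns the braid relation into an
  identity about three letters, free of words and positions.\<close>

definition loc :: "'a::field \<Rightarrow> nat \<times> nat \<Rightarrow> nat \<times> nat \<Rightarrow> (nat \<times> nat \<Rightarrow> nat \<times> nat \<Rightarrow> 'a) \<Rightarrow> 'a" where
  "loc q a b V = (if fst a \<noteq> fst b then V b a else if snd a < snd b then q * V b a
     else if a = b then q * V a b else V b a + (q - 1) * V a b)"

lemma gop_loc:
  "gop q i v t = loc q (t i) (t (Suc i)) (\<lambda>a b. v (t(i := a, Suc i := b)))"
proof -
  have 1: "t(i := t (Suc i), Suc i := t i) = t \<circ> sgen i" by (auto simp: sgen_def)
  have 2: "t(i := t i, Suc i := t (Suc i)) = t" by auto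
  show ?thesis by (simp only: gop_def loc_def 1 2 prod_eq_iff) simp
qed

lemma loc_simps:
  "a \<noteq> c \<Longrightarrow> loc q (a, b) (c, e) V = V (c, e) (a, b)"
  "b < e \<Longrightarrow> loc q (a, b) (a, e) V = q * V (a, e) (a, b)"
  "loc q x x V = q * V x x"
  "e < b \<Longrightarrow> loc q (a, b) (a, e) V = V (a, e) (a, b) + (q - 1) * V (a, b) (a, e)"
  by (simp_all add: loc_def)

lemma loc_braid_same:
  fixes V :: "nat \<times> nat \<Rightarrow> nat \<times> nat \<Rightarrow> nat \<times> nat \<Rightarrow> 'a::field"
  shows "loc q (k, a) (k, b) (\<lambda>a b. loc q b (k, c) (\<lambda>b c. loc q a b (\<lambda>a b. V a b c))) =
    loc q (k, b) (k, c) (\<lambda>b c. loc q (k, a) b (\<lambda>a b. loc q b c (\<lambda>b c. V a b c)))"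
  by (cases a b rule: linorder_cases; cases b c rule: linorder_cases; cases a c rule: linorder_cases;
      simp add: loc_simps; simp add: algebra_simps)

text \<open>Letters of different components are merely swapped, so unless all three components agree
  at most one pair interacts and few cases remain; three letters of one component need the full
  comparison of rows in \<open>loc_braid_same\<close>.\<close>

lemma loc_braid:
  fixes V :: "nat \<times> nat \<Rightarrow> nat \<times> nat \<Rightarrow> nat \<times> nat \<Rightarrow> 'a::field"
  shows "loc q a b (\<lambda>a b. loc q b c (\<lambda>b c. loc q a b (\<lambda>a b. V a b c))) =
    loc q b c (\<lambda>b c. loc q a b (\<lambda>a b. loc q b c (\<lambda>b c. V a b c)))"
proof -
  obtain a1 a2 b1 b2 c1 c2 where [simp]: "a = (a1, a2)" "b = (b1, b2)" "c = (c1, c2)"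
    by (cases a, cases b, cases c) blast
  consider "a1 = b1" "b1 = c1" | "a1 \<noteq> b1" "b1 \<noteq> c1" "a1 \<noteq> c1" | "a1 = b1" "b1 \<noteq> c1" | "a1 = c1" "b1 \<noteq> c1" | "b1 = c1" "a1 \<noteq> b1"
    by blast
  then show ?thesis
  proof cases
    case 1
    then show ?thesis using loc_braid_same by simp
  next
    case 2
    then show ?thesis by (simp add: loc_simps)
  next
    case 3
    consider "a2 < b2" | "a2 = b2" | "b2 < a2" by linarith
    then show ?thesis using 3 by cases (simp_all add: loc_simps)
  next
    case 4
    consider "a2 < c2" | "a2 = c2" | "c2 < a2" by linarith
    then show ?thesis using 4 by cases (simp_all add: loc_simps)
  next
    case 5
    consider "b2 < c2" | "b2 = c2" | "c2 < b2" by linarith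
    then show ?thesis using 5 by cases (simp_all add: loc_simps)
  qed
qed
lemma gop_braid:
  "gop q i (gop q (Suc i) (gop q i v)) = gop q (Suc i) (gop q i (gop q (Suc i) v))"
proof
  fix t :: word
  \<comment> \<open>Nested updates at the three positions are brought into one fixed order, so that
    both sides depend on the three letters only.\<close>
  have tw: "t(i := x, Suc i := y, Suc (Suc i) := z, i := x') = t(i := x', Suc i := y, Suc (Suc i) := z)"
    "t(i := x, Suc i := y, Suc (Suc i) := z, Suc i := y') = t(i := x, Suc i := y', Suc (Suc i) := z)"
    "t(Suc i := y, Suc (Suc i) := z, i := x') = t(i := x', Suc i := y, Suc (Suc i) := z)"
    "t(i := x, Suc i := y, Suc i := y') = t(i := x, Suc i := y')"
    "t(Suc i := y, Suc (Suc i) := z, Suc i := y') = t(Suc i := y', Suc (Suc i) := z)"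
    for x y z x' y'
    by (auto simp: fun_eq_iff)
  have "gop q i (gop q (Suc i) (gop q i v)) t =
    loc q (t i) (t (Suc i)) (\<lambda>a b. loc q b (t (Suc (Suc i))) (\<lambda>b c. loc q a b (\<lambda>a b. v (t(i := a, Suc i := b, Suc (Suc i) := c)))))"
    by (simp add: gop_loc tw)
  also have "\<dots> = loc q (t (Suc i)) (t (Suc (Suc i))) (\<lambda>b c. loc q (t i) b (\<lambda>a b. loc q b c (\<lambda>b c. v (t(i := a, Suc i := b, Suc (Suc i) := c)))))"
    by (rule loc_braid)
  also have "\<dots> = gop q (Suc i) (gop q i (gop q (Suc i) v)) t"
    by (simp add: gop_loc tw)
  finally show "gop q i (gop q (Suc i) (gop q i v)) t = gop q (Suc i) (gop q i (gop q (Suc i) v)) t" .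
qed

lemma loc_commute:
  "loc q a b (\<lambda>a b. loc q c e (\<lambda>c e. V a b c e)) = loc q c e (\<lambda>c e. loc q a b (\<lambda>a b. V a b c e))"
  by (simp add: loc_def algebra_simps)

lemma gop_commute:
  assumes "Suc i < j"
  shows "gop q i (gop q j v) = gop q j (gop q i v)"
proof
  fix t :: word
  have tw: "t(j := c, Suc j := e, i := a, Suc i := b) = t(i := a, Suc i := b, j := c, Suc j := e)" for a b c e
    using assms by (auto simp: fun_eq_iff)
  have "gop q i (gop q j v) t = loc q (t i) (t (Suc i)) (\<lambda>a b. loc q (t j) (t (Suc j)) (\<lambda>c e. v (t(i := a, Suc i := b, j := c, Suc j := e))))"
    using assms by (simp add: gop_loc)
  also have "\<dots> = loc q (t j) (t (Suc j)) (\<lambda>c e. loc q (t i) (t (Suc i)) (\<lambda>a b. v (t(i := a, Suc i := b, j := c, Suc j := e))))"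
    by (rule loc_commute)
  also have "\<dots> = gop q j (gop q i v) t"
    using assms by (simp add: gop_loc tw)
  finally show "gop q i (gop q j v) t = gop q j (gop q i v) t" .
qed

section \<open>Tableaux and polytabloids\<close>

abbreviation pinv :: "('a \<Rightarrow> 'b) \<Rightarrow> 'b \<Rightarrow> 'a" where
  "pinv \<equiv> inv_into UNIV"

lemma boxes_Sigma:
  "boxes lam = (SIGMA i:{..<length lam}. SIGMA r:{..<length (lam ! i)}. {..<lam ! i ! r})"
  by (auto simp: boxes_def)

lemma finite_boxes: "finite (boxes lam)"
  unfolding boxes_Sigma by (intro finite_SigmaI) auto

lemma card_boxes:
  assumes "lam \<in> dpartitions d n"
  shows "card (boxes lam) = n"
proof -
  have "card (boxes lam) = (\<Sum>i<length lam. \<Sum>r<length (lam ! i). lam ! i ! r)"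
    unfolding boxes_Sigma by (subst card_SigmaI, simp, simp, subst card_SigmaI, simp_all)
  also have "\<dots> = sum_list (map sum_list lam)"
    by (simp add: sum_list_sum_nth atLeast0LessThan)
  finally show ?thesis using assms by (simp add: dpartitions_def)
qed

lemma partition_antimono:
  assumes "is_partition \<mu>" "r \<le> s" "s < length \<mu>"
  shows "\<mu> ! s \<le> \<mu> ! r"
  using assms(2,3)
proof (induction s rule: dec_induct)
  case (step s)
  have "\<mu> ! Suc s \<le> \<mu> ! s" using assms(1) step by (simp add: is_partition_def)
  then show ?case using step by simp
qed simp

lemma boxes_up:
  assumes "lam \<in> dpartitions d n" "(i, s, c) \<in> boxes lam" "r \<le> s"
  shows "(i, r, c) \<in> boxes lam"
proof -
  have "is_partition (lam ! i)" using assms by (auto simp: dpartitions_def boxes_def)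
  from partition_antimono[OF this assms(3)] show ?thesis using assms by (auto simp: boxes_def)
qed

lemma finite_dtableaux: "finite (dtableaux n lam)"
  by (rule finite_subset[of _ "{1..n} \<rightarrow>\<^sub>E boxes lam"])
    (auto simp: dtableaux_def intro!: finite_PiE finite_boxes)

lemma dtableauxD:
  assumes "T \<in> dtableaux n lam"
  shows "bij_betw T {1..n} (boxes lam)" "j \<notin> {1..n} \<Longrightarrow> T j = undefined" "j \<in> {1..n} \<Longrightarrow> T j \<in> boxes lam"
    "inj_on T {1..n}"
  using assms by (auto simp: dtableaux_def PiE_def extensional_def bij_betw_def)

lemma dtableaux_comp:
  assumes T: "T \<in> dtableaux n lam" and p: "p permutes {1..n}"
  shows "T \<circ> p \<in> dtableaux n lam"
proof -
  have b: "bij_betw (T \<circ> p) {1..n} (boxes lam)"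
    by (rule bij_betw_trans[OF permutes_imp_bij[OF p] dtableauxD(1)[OF T]])
  have "T \<circ> p \<in> {1..n} \<rightarrow>\<^sub>E boxes lam"
  proof (rule PiE_I)
    show "(T \<circ> p) j \<in> boxes lam" if "j \<in> {1..n}" for j
      using bij_betwE[OF b] that by blast
    show "(T \<circ> p) j = undefined" if "j \<notin> {1..n}" for j
      using that dtableauxD(2)[OF T] permutes_not_in[OF p] by simp
  qed
  with b show ?thesis unfolding dtableaux_def by blast
qed

lemma dtableaux_ex_permutes:
  assumes T: "T \<in> dtableaux n lam" and S: "S \<in> dtableaux n lam"
  shows "\<exists>p. p permutes {1..n} \<and> T = S \<circ> p"
proof -
  define p where "p = (\<lambda>j. if j \<in> {1..n} then the_inv_into {1..n} S (T j) else j)"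
  have "bij_betw (the_inv_into {1..n} S \<circ> T) {1..n} {1..n}"
    by (rule bij_betw_trans[OF dtableauxD(1)[OF T] bij_betw_the_inv_into[OF dtableauxD(1)[OF S]]])
  then have "bij_betw p {1..n} {1..n}"
    by (rule bij_betw_cong[THEN iffD1, rotated]) (simp add: p_def)
  then have p: "p permutes {1..n}" by (rule bij_imp_permutes) (unfold p_def, rule if_not_P)
  have "T j = (S \<circ> p) j" for j
  proof (cases "j \<in> {1..n}")
    case True
    then have "T j \<in> S ` {1..n}"
      using dtableauxD(3)[OF T] dtableauxD(1)[OF S] by (simp add: bij_betw_def)
    then show ?thesis using True f_the_inv_into_f[OF dtableauxD(4)[OF S], of "T j"] by (simp add: p_def)
  next
    case False
    then have "p j = j" unfolding p_def by (rule if_not_P)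
    then show ?thesis using dtableauxD(2)[OF T False] dtableauxD(2)[OF S False] by simp
  qed
  then show ?thesis using p by blast
qed

lemma tabloid_of_comp:
  assumes "p permutes {1..n}"
  shows "tabloid_of n (T \<circ> p) = tabloid_of n T \<circ> p"
  using permutes_in_image[OF assms] by (auto simp: tabloid_of_def fun_eq_iff)

lemma col_stab_iff:
  "\<pi> \<in> col_stab n T \<longleftrightarrow> \<pi> permutes {1..n} \<and> (\<forall>j\<in>{1..n}. fst (T (\<pi> j)) = fst (T j) \<and> snd (snd (T (\<pi> j))) = snd (snd (T j)))"
  by (simp add: col_stab_def)

lemma finite_col_stab: "finite (col_stab n T)"
  by (rule finite_subset[OF _ finite_permutations[of "{1..n}"]]) (auto simp: col_stab_def)

lemma permutation_of_permutes: "p permutes {1..n::nat} \<Longrightarrow> permutation p"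
  unfolding permutation_permutes by blast

lemma col_stab_conj:
  assumes p: "p permutes {1..n}" and a: "\<pi> \<in> col_stab n T"
  shows "pinv p \<circ> \<pi> \<circ> p \<in> col_stab n (T \<circ> p)"
proof -
  have "pinv p \<circ> \<pi> \<circ> p permutes {1..n}"
    using a p permutes_inv[OF p] by (auto simp: col_stab_iff intro!: permutes_compose)
  moreover have "fst ((T \<circ> p) ((pinv p \<circ> \<pi> \<circ> p) j)) = fst ((T \<circ> p) j) \<and>
      snd (snd ((T \<circ> p) ((pinv p \<circ> \<pi> \<circ> p) j))) = snd (snd ((T \<circ> p) j))" if "j \<in> {1..n}" for j
  proof -
    have "p j \<in> {1..n}" using permutes_in_image[OF p] that by blast
    then have "fst (T (\<pi> (p j))) = fst (T (p j)) \<and> snd (snd (T (\<pi> (p j)))) = snd (snd (T (p j)))"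
      using a unfolding col_stab_iff by blast
    then show ?thesis by (simp add: permutes_inverses[OF p])
  qed
  ultimately show ?thesis unfolding col_stab_iff by blast
qed

lemma col_stab_comp:
  assumes p: "p permutes {1..n}"
  shows "bij_betw (\<lambda>\<pi>. p \<circ> \<pi> \<circ> pinv p) (col_stab n (T \<circ> p)) (col_stab n T)"
proof (rule bij_betwI[where g = "\<lambda>\<pi>. pinv p \<circ> \<pi> \<circ> p"])
  have "p \<circ> \<pi> \<circ> pinv p \<in> col_stab n T" if "\<pi> \<in> col_stab n (T \<circ> p)" for \<pi>
    using col_stab_conj[OF permutes_inv[OF p] that]
    by (simp add: permutes_inv_inv[OF p] comp_assoc permutes_inv_o[OF p])
  then show "(\<lambda>\<pi>. p \<circ> \<pi> \<circ> pinv p) \<in> col_stab n (T \<circ> p) \<rightarrow> col_stab n T" by blast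
  show "(\<lambda>\<pi>. pinv p \<circ> \<pi> \<circ> p) \<in> col_stab n T \<rightarrow> col_stab n (T \<circ> p)"
    using col_stab_conj[OF p] by blast
qed (simp_all add: fun_eq_iff permutes_inverses[OF p])

text \<open>The column stabilizers of \<open>T\<close> and \<open>T \<circ> p\<close> are conjugate,
  and conjugation keeps the sign; so renumbering a tableau translates its polytabloid.\<close>

lemma polytabloid_comp:
  assumes p: "p permutes {1..n}"
  shows "polytabloid n (T \<circ> p) t = polytabloid n T (t \<circ> pinv p)"
proof -
  note q = permutes_inv[OF p]
  have pq: "p (pinv p x) = x" "pinv p (p x) = x" for x
    using permutes_inverses[OF p] by auto
  have "polytabloid n T (t \<circ> pinv p) = (\<Sum>\<pi>\<in>col_stab n (T \<circ> p). of_int (sign (p \<circ> \<pi> \<circ> pinv p)) *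
      (if t \<circ> pinv p = tabloid_of n (T \<circ> (p \<circ> \<pi> \<circ> pinv p)) then 1 else 0))"
    unfolding polytabloid_def by (rule sum.reindex_bij_betw[OF col_stab_comp[OF p], symmetric])
  also have "\<dots> = polytabloid n (T \<circ> p) t"
    unfolding polytabloid_def
  proof (rule sum.cong[OF refl])
    fix \<pi> assume "\<pi> \<in> col_stab n (T \<circ> p)"
    then have \<pi>: "\<pi> permutes {1..n}" by (simp add: col_stab_iff)
    have s: "sign (p \<circ> \<pi> \<circ> pinv p) = sign \<pi>"
      using permutation_of_permutes[OF p] permutation_of_permutes[OF q] permutation_of_permutes[OF \<pi>]
      by (simp add: sign_compose permutation_compose sign_inverse mult.commute sign_idempotent)
    have e: "tabloid_of n (T \<circ> (p \<circ> \<pi> \<circ> pinv p)) = tabloid_of n (T \<circ> p \<circ> \<pi>) \<circ> pinv p"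
      using tabloid_of_comp[OF q, of "T \<circ> p \<circ> \<pi>"] by (simp add: comp_assoc)
    have "t \<circ> pinv p = \<sigma> \<circ> pinv p \<longleftrightarrow> t = \<sigma>" for \<sigma> :: "nat \<Rightarrow> nat \<times> nat"
    proof
      assume "t \<circ> pinv p = \<sigma> \<circ> pinv p"
      then have "t (pinv p (p x)) = \<sigma> (pinv p (p x))" for x by (metis comp_apply)
      then show "t = \<sigma>" by (simp add: pq fun_eq_iff)
    qed simp
    then show "of_int (sign (p \<circ> \<pi> \<circ> pinv p)) * (if t \<circ> pinv p = tabloid_of n (T \<circ> (p \<circ> \<pi> \<circ> pinv p)) then 1 else 0)
        = of_int (sign \<pi>) * (if t = tabloid_of n (T \<circ> p \<circ> \<pi>) then 1 else (0::complex))"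
      unfolding s e by simp
  qed
  finally show ?thesis by simp
qed

lemma polytabloid_col_stab:
  assumes r: "\<rho> \<in> col_stab n T"
  shows "polytabloid n T (t \<circ> \<rho>) = of_int (sign \<rho>) * polytabloid n T t"
proof -
  have rp: "\<rho> permutes {1..n}" using r by (simp add: col_stab_iff)
  note q = permutes_inv[OF rp]
  have rq: "\<rho> (pinv \<rho> x) = x" "pinv \<rho> (\<rho> x) = x" for x
    using permutes_inverses[OF rp] by auto
  have fw: "\<pi> \<circ> \<rho> \<in> col_stab n T" if a: "\<pi> \<in> col_stab n T" for \<pi>
  proof -
    have "fst (T (\<pi> (\<rho> j))) = fst (T j) \<and> snd (snd (T (\<pi> (\<rho> j)))) = snd (snd (T j))" if j: "j \<in> {1..n}" for j
    proof -
      have "\<rho> j \<in> {1..n}" using permutes_in_image[OF rp] j by blast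
      then show ?thesis using a r j unfolding col_stab_iff by simp
    qed
    then show ?thesis using a rp by (auto simp: col_stab_iff intro!: permutes_compose)
  qed
  have bw: "\<pi> \<circ> pinv \<rho> \<in> col_stab n T" if a: "\<pi> \<in> col_stab n T" for \<pi>
  proof -
    have "fst (T (\<pi> (pinv \<rho> j))) = fst (T j) \<and> snd (snd (T (\<pi> (pinv \<rho> j)))) = snd (snd (T j))" if j: "j \<in> {1..n}" for j
    proof -
      have k: "pinv \<rho> j \<in> {1..n}" using permutes_in_image[OF q] j by blast
      then have "fst (T (\<rho> (pinv \<rho> j))) = fst (T (pinv \<rho> j)) \<and> snd (snd (T (\<rho> (pinv \<rho> j)))) = snd (snd (T (pinv \<rho> j)))"
        using r unfolding col_stab_iff by blast
      then show ?thesis using a k unfolding col_stab_iff by (simp add: rq)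
    qed
    then show ?thesis using a q by (auto simp: col_stab_iff intro!: permutes_compose)
  qed
  have bij: "bij_betw (\<lambda>\<pi>. \<pi> \<circ> \<rho>) (col_stab n T) (col_stab n T)"
    by (rule bij_betwI[where g = "\<lambda>\<pi>. \<pi> \<circ> pinv \<rho>"]) (use fw bw in \<open>simp_all add: fun_eq_iff rq\<close>)
  have "polytabloid n T (t \<circ> \<rho>) = (\<Sum>\<pi>\<in>col_stab n T. of_int (sign (\<pi> \<circ> \<rho>)) * (if t \<circ> \<rho> = tabloid_of n (T \<circ> (\<pi> \<circ> \<rho>)) then 1 else 0))"
    unfolding polytabloid_def by (rule sum.reindex_bij_betw[OF bij, symmetric])
  also have "\<dots> = (\<Sum>\<pi>\<in>col_stab n T. of_int (sign \<rho>) * (of_int (sign \<pi>) * (if t = tabloid_of n (T \<circ> \<pi>) then 1 else 0)))"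
  proof (rule sum.cong[OF refl])
    fix \<pi> assume "\<pi> \<in> col_stab n T"
    then have \<pi>: "\<pi> permutes {1..n}" by (simp add: col_stab_iff)
    have s: "sign (\<pi> \<circ> \<rho>) = sign \<pi> * sign \<rho>"
      using permutation_of_permutes[OF rp] permutation_of_permutes[OF \<pi>] by (simp add: sign_compose)
    have e: "tabloid_of n (T \<circ> (\<pi> \<circ> \<rho>)) = tabloid_of n (T \<circ> \<pi>) \<circ> \<rho>"
      using tabloid_of_comp[OF rp, of "T \<circ> \<pi>"] by (simp add: comp_assoc)
    have "t \<circ> \<rho> = \<sigma> \<circ> \<rho> \<longleftrightarrow> t = \<sigma>" for \<sigma> :: "nat \<Rightarrow> nat \<times> nat"
    proof
      assume "t \<circ> \<rho> = \<sigma> \<circ> \<rho>"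
      then have "t (\<rho> (pinv \<rho> x)) = \<sigma> (\<rho> (pinv \<rho> x))" for x by (metis comp_apply)
      then show "t = \<sigma>" by (simp add: rq fun_eq_iff)
    qed simp
    then show "of_int (sign (\<pi> \<circ> \<rho>)) * (if t \<circ> \<rho> = tabloid_of n (T \<circ> (\<pi> \<circ> \<rho>)) then 1 else 0)
      = of_int (sign \<rho>) * (of_int (sign \<pi>) * (if t = tabloid_of n (T \<circ> \<pi>) then 1 else (0::complex)))"
      unfolding s e by simp
  qed
  finally show ?thesis unfolding polytabloid_def sum_distrib_left .
qed

text \<open>A column permutation that also keeps all row indices fixes every box, so only the
  identity can contribute. Both the leading coefficient of a polytabloid and the nonvanishing of the
  symmetrizer are read off from this.\<close>

lemma polytabloid_row_equal:
  assumes T: "T \<in> dtableaux n lam" and w: "w permutes {1..n}"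
    and same: "\<And>j. j \<in> {1..n} \<Longrightarrow> fst (snd (T (w j))) = fst (snd (T j))"
  shows "polytabloid n T (tabloid_of n (T \<circ> w)) = (if tabloid_of n (T \<circ> w) = tabloid_of n T then 1 else 0)"
proof -
  have only: "\<pi> = id" if p: "\<pi> \<in> col_stab n T" and e: "tabloid_of n (T \<circ> w) = tabloid_of n (T \<circ> \<pi>)" for \<pi>
  proof -
    have perm: "\<pi> permutes {1..n}" using p by (simp add: col_stab_iff)
    have "\<pi> j = j" for j
    proof (cases "j \<in> {1..n}")
      case True
      have "fst (snd (T (\<pi> j))) = fst (snd (T (w j)))"
        using fun_cong[OF e, of j] True by (simp add: tabloid_of_def)
      then have "T (\<pi> j) = T j" using same[OF True] p True unfolding col_stab_iff by (simp add: prod_eq_iff)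
      moreover have "\<pi> j \<in> {1..n}" using permutes_in_image[OF perm] True by blast
      ultimately show ?thesis using inj_onD[OF dtableauxD(4)[OF T]] True by blast
    next
      case False
      then show ?thesis using permutes_not_in[OF perm] by blast
    qed
    then show ?thesis by (simp add: fun_eq_iff)
  qed
  have idin: "id \<in> col_stab n T" by (simp add: col_stab_iff permutes_id)
  have "polytabloid n T (tabloid_of n (T \<circ> w)) = (\<Sum>\<pi>\<in>{id}. of_int (sign \<pi>) * (if tabloid_of n (T \<circ> w) = tabloid_of n (T \<circ> \<pi>) then 1 else 0))"
    unfolding polytabloid_def
  proof (rule sum.mono_neutral_right[OF finite_col_stab])
    show "{id} \<subseteq> col_stab n T" using idin by simp
    show "\<forall>\<pi>\<in>col_stab n T - {id}. of_int (sign \<pi>) * (if tabloid_of n (T \<circ> w) = tabloid_of n (T \<circ> \<pi>) then 1 else 0) = (0::complex)"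
      using only by auto
  qed
  also have "\<dots> = (if tabloid_of n (T \<circ> w) = tabloid_of n T then 1 else 0)"
    by (simp add: sign_id)
  finally show ?thesis .
qed

lemma ex_column_reading_tableau:
  assumes lam: "lam \<in> dpartitions d n"
  obtains T where "T \<in> dtableaux n lam"
    "\<And>j k. 1 \<le> j \<Longrightarrow> j < k \<Longrightarrow> k \<le> n \<Longrightarrow>
       (fst (T j), snd (snd (T j)), fst (snd (T j))) < (fst (T k), snd (snd (T k)), fst (snd (T k)))"
proof -
  \<comment> \<open>Exchanging row and column makes the lexicographic order on triples read column
    by column, each from the top down.\<close>
  let ?sw = "\<lambda>(i, r, c). (i, c, r)"
  define L where "L = sorted_list_of_set (?sw ` boxes lam)"
  have inj: "inj_on ?sw X" for X :: "(nat \<times> nat \<times> nat) set" by (auto simp: inj_on_def)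
  have fin: "finite (?sw ` boxes lam)" by (intro finite_imageI finite_boxes)
  have len: "length L = n"
    unfolding L_def using card_boxes[OF lam] card_image[OF inj] by simp
  have set: "set L = ?sw ` boxes lam" unfolding L_def using fin by simp
  have srt: "sorted_wrt (<) L" unfolding L_def by simp
  define T where "T = (\<lambda>j. if j \<in> {1..n} then ?sw (L ! (j - 1)) else undefined)"
  have key: "(fst (T j), snd (snd (T j)), fst (snd (T j))) = L ! (j - 1)" if "j \<in> {1..n}" for j
    using that by (cases "L ! (j - 1)") (simp add: T_def)
  have mono: "(fst (T j), snd (snd (T j)), fst (snd (T j))) < (fst (T k), snd (snd (T k)), fst (snd (T k)))"
    if "1 \<le> j" "j < k" "k \<le> n" for j k
    using sorted_wrt_nth_less[OF srt, of "j - 1" "k - 1"] that len key[of j] key[of k] by simp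
  have in_boxes: "T j \<in> boxes lam" if j: "j \<in> {1..n}" for j
  proof -
    have "L ! (j - 1) \<in> set L" using j len by (intro nth_mem) auto
    then obtain b where "b \<in> boxes lam" "L ! (j - 1) = ?sw b" unfolding set by blast
    then show ?thesis using j by (cases b) (simp add: T_def)
  qed
  have injT: "inj_on T {1..n}"
  proof (rule linorder_inj_onI)
    fix j k assume "j < k" "j \<in> {1..n}" "k \<in> {1..n}"
    then show "T j \<noteq> T k" using mono[of j k] by auto
  qed auto
  have "T ` {1..n} = boxes lam"
    by (rule card_subset_eq[OF finite_boxes]) (use in_boxes card_image[OF injT] card_boxes[OF lam] in auto)
  then have b: "bij_betw T {1..n} (boxes lam)" using injT by (simp add: bij_betw_def)
  have "T \<in> {1..n} \<rightarrow>\<^sub>E boxes lam"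
    by (rule PiE_I) (use in_boxes in \<open>auto simp: T_def\<close>)
  then have "T \<in> dtableaux n lam" using b unfolding dtableaux_def by blast
  then show ?thesis using mono by (rule that)
qed

section \<open>The column antisymmetric vector\<close>

text \<open>In column reading order every column occupies consecutive numbers. Its permutations are
  then generated by the \<open>sgen i\<close> with \<open>col i = col (Suc i)\<close>, and only
  adjacent transpositions have counterparts among the generators of the algebra.\<close>

locale coltab =
  fixes d n :: nat and lam :: "nat list list" and T0 :: "nat \<Rightarrow> nat \<times> nat \<times> nat"
  assumes lam: "lam \<in> dpartitions d n" and T0: "T0 \<in> dtableaux n lam"
    and T0_mono: "\<And>j k. 1 \<le> j \<Longrightarrow> j < k \<Longrightarrow> k \<le> n \<Longrightarrow>
       (fst (T0 j), snd (snd (T0 j)), fst (snd (T0 j))) < (fst (T0 k), snd (snd (T0 k)), fst (snd (T0 k)))"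
begin

definition col :: "nat \<Rightarrow> nat \<times> nat" where "col j = (fst (T0 j), snd (snd (T0 j)))"
definition row :: "nat \<Rightarrow> nat" where "row j = fst (snd (T0 j))"
definition TB :: "word set" where "TB = tabloid_of n ` dtableaux n lam"
definition t0 :: word where "t0 = tabloid_of n T0"
text \<open>Weights are compared as total functions. This is harmless, since all words of
  \<open>TB\<close> have the same default value outside \<open>{1..n}\<close>.\<close>

definition \<gamma> :: "nat \<Rightarrow> nat" where "\<gamma> = fst \<circ> t0"
definition col_distinct :: "word \<Rightarrow> bool" where
  "col_distinct t \<longleftrightarrow> (\<forall>j k. 1 \<le> j \<longrightarrow> j < k \<longrightarrow> k \<le> n \<longrightarrow> col j = col k \<longrightarrow> snd (t j) \<noteq> snd (t k))"
definition cinv :: "word \<Rightarrow> nat" where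
  "cinv t = card (invs n (\<lambda>j k. col j = col k) (\<lambda>a b. snd b < snd a) t)"
text \<open>The exponent is forced: at an ascent inside a column, eigenvalue \<open>-1\<close> of
  \<open>gop q i\<close> means \<open>v t = - q * v (t \<circ> sgen i)\<close>, while the swap
  raises \<open>cinv\<close> by one. At \<open>q = 1\<close> only signs remain, and the vector is
  the polytabloid of \<open>T0\<close>.\<close>

definition z :: "'a::field \<Rightarrow> word \<Rightarrow> 'a" where
  "z q t = (if t \<in> TB \<and> fst \<circ> t = \<gamma> \<and> col_distinct t then (- (1 / q)) ^ cinv t else 0)"

lemma T0_eq: "T0 j = (fst (col j), row j, snd (col j))"
  by (simp add: col_def row_def)

lemma col_between:
  assumes "1 \<le> j" "j < m" "m < k" "k \<le> n" "col j = col k"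
  shows "col m = col j"
  using T0_mono[of j m] T0_mono[of m k] assms by (auto simp: col_def prod_eq_iff)

lemma row_mono: "1 \<le> j \<Longrightarrow> j < k \<Longrightarrow> k \<le> n \<Longrightarrow> col j = col k \<Longrightarrow> row j < row k"
  using T0_mono[of j k] by (auto simp: col_def row_def)

text \<open>The box above exists because the shape is a Young diagram, and its number is smaller. A
  number strictly between would lie in the same column, strictly between two adjacent rows.\<close>

lemma row_pred:
  assumes j: "j \<in> {1..n}" and r: "row j = Suc r"
  obtains k where "j = Suc k" "k \<in> {1..n}" "col k = col j" "row k = r"
proof -
  have "(fst (col j), Suc r, snd (col j)) \<in> boxes lam"
    using dtableauxD(3)[OF T0 j] r T0_eq[of j] by simp
  then have "(fst (col j), r, snd (col j)) \<in> boxes lam" by (rule boxes_up[OF lam]) simp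
  then have "(fst (col j), r, snd (col j)) \<in> T0 ` {1..n}"
    using dtableauxD(1)[OF T0] by (simp add: bij_betw_def)
  then obtain k where k: "k \<in> {1..n}" "T0 k = (fst (col j), r, snd (col j))" by (metis imageE)
  have ck: "col k = col j" "row k = r" using k(2) by (simp_all add: col_def row_def)
  have "k < j"
  proof (rule ccontr)
    assume "\<not> k < j"
    moreover have "k \<noteq> j" using ck r by auto
    ultimately have "row j < row k" using j k ck by (intro row_mono) auto
    then show False using ck r by simp
  qed
  have "\<not> Suc k < j"
  proof
    assume a: "Suc k < j"
    have c: "col (Suc k) = col k" using a j k ck by (intro col_between[of k "Suc k" j]) auto
    have "row k < row (Suc k)" using a j k c by (intro row_mono) auto
    moreover have "row (Suc k) < row j" using a j k c ck by (intro row_mono) auto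
    ultimately show False using ck r by simp
  qed
  with \<open>k < j\<close> have "j = Suc k" by simp
  then show ?thesis using that k ck by blast
qed

lemma finite_TB: "finite TB"
  unfolding TB_def by (intro finite_imageI finite_dtableaux)

lemma TB_comp:
  assumes p: "p permutes {1..n}" and "t \<in> TB" shows "t \<circ> p \<in> TB"
proof -
  obtain T where T: "T \<in> dtableaux n lam" "t = tabloid_of n T" using assms(2) by (auto simp: TB_def)
  have "t \<circ> p = tabloid_of n (T \<circ> p)" using tabloid_of_comp[OF p] T by simp
  then show ?thesis unfolding TB_def using dtableaux_comp[OF T(1) p] by blast
qed

lemma TB_comp_iff:
  assumes p: "p permutes {1..n}" shows "t \<circ> p \<in> TB \<longleftrightarrow> t \<in> TB"
proof
  assume "t \<circ> p \<in> TB"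
  from TB_comp[OF permutes_inv[OF p] this] have "t \<circ> (p \<circ> pinv p) \<in> TB" by (simp add: comp_assoc)
  then show "t \<in> TB" by (simp add: permutes_inv_o[OF p])
qed (rule TB_comp[OF p])

lemmas TB_sgen = TB_comp_iff[OF sgen_permutes]

lemma TB_bij:
  assumes p: "p permutes {1..n}" shows "bij_betw (\<lambda>t. t \<circ> p) TB TB"
proof (rule bij_betwI[where g = "\<lambda>t. t \<circ> pinv p"])
  show "t \<circ> p \<circ> pinv p = t" for t :: word by (simp add: comp_assoc permutes_inv_o[OF p])
  show "t \<circ> pinv p \<circ> p = t" for t :: word by (simp add: comp_assoc permutes_inv_o[OF p])
qed (use TB_comp[OF p] TB_comp[OF permutes_inv[OF p]] in auto)

lemma TB_fst_less:
  assumes "t \<in> TB" "j \<in> {1..n}" shows "fst (t j) < d"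
proof -
  obtain T where T: "T \<in> dtableaux n lam" "t = tabloid_of n T" using assms(1) by (auto simp: TB_def)
  have "T j \<in> boxes lam" using dtableauxD(3)[OF T(1) assms(2)] .
  then have "fst (T j) < length lam" by (auto simp: boxes_def)
  then show ?thesis using lam T(2) assms(2) by (simp add: dpartitions_def tabloid_of_def)
qed

lemma TB_outside: "t \<in> TB \<Longrightarrow> j \<notin> {1..n} \<Longrightarrow> t j = undefined"
  by (auto simp: TB_def tabloid_of_def)

lemma TB_row_sum:
  assumes "t \<in> TB" shows "(\<Sum>j\<in>{1..n}. snd (t j)) = (\<Sum>b\<in>boxes lam. fst (snd b))"
proof -
  obtain T where T: "T \<in> dtableaux n lam" "t = tabloid_of n T" using assms by (auto simp: TB_def)
  have "(\<Sum>j\<in>{1..n}. snd (t j)) = (\<Sum>j\<in>{1..n}. fst (snd (T j)))"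
    by (rule sum.cong) (simp_all add: T(2) tabloid_of_def)
  also have "\<dots> = (\<Sum>b\<in>boxes lam. fst (snd b))"
    by (rule sum.reindex_bij_betw[OF dtableauxD(1)[OF T(1)]])
  finally show ?thesis .
qed

lemma t0_TB: "t0 \<in> TB" unfolding t0_def TB_def using T0 by blast

lemma t0_eq: "j \<in> {1..n} \<Longrightarrow> t0 j = (fst (col j), row j)"
  by (simp add: t0_def tabloid_of_def col_def row_def)

lemma \<gamma>_eq: "j \<in> {1..n} \<Longrightarrow> \<gamma> j = fst (col j)"
  by (simp add: \<gamma>_def t0_eq)

lemma \<gamma>_less: "j \<in> {1..n} \<Longrightarrow> \<gamma> j < d"
  using TB_fst_less[OF t0_TB] by (simp add: \<gamma>_def)

lemma same_col_\<gamma>: "i \<in> {1..<n} \<Longrightarrow> col i = col (Suc i) \<Longrightarrow> \<gamma> i = \<gamma> (Suc i)"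
  using \<gamma>_eq[of i] \<gamma>_eq[of "Suc i"] by simp

lemma \<gamma>_sgen: "i \<in> {1..<n} \<Longrightarrow> col i = col (Suc i) \<Longrightarrow> \<gamma> \<circ> sgen i = \<gamma>"
  by (rule comp_sgen_eq) (simp add: same_col_\<gamma>)

lemma weight_sgen:
  fixes t :: word
  assumes "i \<in> {1..<n}" "col i = col (Suc i)"
  shows "fst \<circ> (t \<circ> sgen i) = \<gamma> \<longleftrightarrow> fst \<circ> t = \<gamma>"
proof -
  have 1: "fst \<circ> (t \<circ> sgen i) = \<gamma>" if "fst \<circ> t = \<gamma>" for t :: word
    using that \<gamma>_sgen[OF assms] by (simp add: comp_assoc[symmetric])
  show ?thesis using 1[of t] 1[of "t \<circ> sgen i"] by auto
qed

lemma col_sgen: "col i = col (Suc i) \<Longrightarrow> col (sgen i j) = col j"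
  by (simp add: sgen_def)

lemma col_distinct_sgen:
  assumes i: "i \<in> {1..<n}" "col i = col (Suc i)"
  shows "col_distinct (t \<circ> sgen i) \<longleftrightarrow> col_distinct t"
proof -
  have 1: "col_distinct (t \<circ> sgen i)" if "col_distinct t" for t
    unfolding col_distinct_def
  proof (intro allI impI)
    fix j k assume a: "1 \<le> j" "j < k" "k \<le> n" "col j = col k"
    have m: "sgen i j \<in> {1..n}" "sgen i k \<in> {1..n}" using sgen_mem[OF i(1)] a by auto
    have c: "col (sgen i j) = col (sgen i k)" using a col_sgen[OF i(2)] by simp
    have "sgen i j \<noteq> sgen i k" using a sgen_sgen by (metis less_irrefl)
    then consider "sgen i j < sgen i k" | "sgen i k < sgen i j" by linarith
    then show "snd ((t \<circ> sgen i) j) \<noteq> snd ((t \<circ> sgen i) k)"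
    proof cases
      case 1
      then show ?thesis using that m c unfolding col_distinct_def by simp
    next
      case 2
      then have "snd (t (sgen i k)) \<noteq> snd (t (sgen i j))"
        using that m c unfolding col_distinct_def by simp
      then show ?thesis by simp
    qed
  qed
  show ?thesis using 1[of t] 1[of "t \<circ> sgen i"] by auto
qed

lemma cinv_sgen:
  assumes i: "i \<in> {1..<n}" "col i = col (Suc i)" and lt: "snd (t i) < snd (t (Suc i))"
  shows "cinv (t \<circ> sgen i) = Suc (cinv t)"
  unfolding cinv_def
  by (subst card_invs_comp_sgen[OF i(1)]) (use i lt col_sgen[OF i(2)] in auto)

lemma z_swap:
  assumes i: "i \<in> {1..<n}" "col i = col (Suc i)" and lt: "snd (t i) < snd (t (Suc i))" and q: "q \<noteq> 0"
  shows "z q t = - q * z q (t \<circ> sgen i)"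
  using q by (simp add: z_def TB_sgen[OF i(1)] weight_sgen[OF i] col_distinct_sgen[OF i] cinv_sgen[OF i lt])

lemma z_eq_0: 
  assumes i: "i \<in> {1..<n}" "col i = col (Suc i)" and eq: "snd (t i) = snd (t (Suc i))"
  shows "z q t = 0"
proof -
  have "\<not> col_distinct t"
  proof
    assume "col_distinct t"
    then have "snd (t i) \<noteq> snd (t (Suc i))" unfolding col_distinct_def using i by simp
    then show False using eq by simp
  qed
  then show ?thesis by (simp add: z_def)
qed

lemma z_support: "z q t \<noteq> 0 \<Longrightarrow> t \<in> TB \<and> fst \<circ> t = \<gamma>"
  by (auto simp: z_def split: if_splits)

lemma gop_z:
  assumes i: "i \<in> {1..<n}" "col i = col (Suc i)" and q: "q \<noteq> 0"
  shows "gop q i (z q) = (\<lambda>t. - z q t)"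
proof
  fix t
  show "gop q i (z q) t = - z q t"
  proof (cases "fst (t i) = fst (t (Suc i))")
    case False
    then have "fst \<circ> t \<noteq> \<gamma>" using same_col_\<gamma>[OF i] by (metis comp_apply)
    then have "z q t = 0" "z q (t \<circ> sgen i) = 0" using z_support weight_sgen[OF i] by blast+
    then show ?thesis using False by (simp add: gop_def)
  next
    case True
    consider "snd (t i) < snd (t (Suc i))" | "snd (t i) = snd (t (Suc i))" | "snd (t (Suc i)) < snd (t i)"
      by linarith
    then show ?thesis
    proof cases
      case 1
      then show ?thesis using True z_swap[OF i 1 q] by (simp add: gop_def)
    next
      case 2
      then show ?thesis using True z_eq_0[OF i 2, of q] by (simp add: gop_def)
    next
      case 3
      then have "z q (t \<circ> sgen i) = - q * z q t" using z_swap[OF i _ q, of "t \<circ> sgen i"] by simp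
      then show ?thesis using True 3 by (simp add: gop_def algebra_simps)
    qed
  qed
qed

lemma cinv_t0: "cinv t0 = 0"
proof -
  have "invs n (\<lambda>j k. col j = col k) (\<lambda>a b. snd b < snd a) t0 = {}"
  proof (rule ccontr)
    assume "invs n (\<lambda>j k. col j = col k) (\<lambda>a b. snd b < snd a) t0 \<noteq> {}"
    then obtain j k where "1 \<le> j" "j < k" "k \<le> n" "col j = col k" "snd (t0 k) < snd (t0 j)"
      by (auto simp: invs_def)
    then show False using row_mono[of j k] t0_eq[of j] t0_eq[of k] by simp
  qed
  then show ?thesis by (simp add: cinv_def)
qed

lemma z_t0: "z q t0 = 1"
proof -
  have "col_distinct t0" unfolding col_distinct_def
  proof (intro allI impI)
    fix j k assume a: "1 \<le> j" "j < k" "k \<le> n" "col j = col k"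
    then show "snd (t0 j) \<noteq> snd (t0 k)" using row_mono[OF a] t0_eq[of j] t0_eq[of k] by simp
  qed
  then show ?thesis using t0_TB by (simp add: z_def \<gamma>_def cinv_t0)
qed

text \<open>Strictly increasing columns force row labels at least the row indices of the
  reading tableau; both families have the same sum.\<close>
lemma increasing_eq_t0:
  assumes t: "t \<in> TB" "fst \<circ> t = \<gamma>"
    and inc: "\<And>i. i \<in> {1..<n} \<Longrightarrow> col i = col (Suc i) \<Longrightarrow> snd (t i) < snd (t (Suc i))"
  shows "t = t0"
proof -
  have ge: "r \<le> snd (t j)" if "j \<in> {1..n}" "row j = r" for r j
    using that
  proof (induction r arbitrary: j)
    case (Suc r)
    then obtain k where k: "j = Suc k" "k \<in> {1..n}" "col k = col j" "row k = r"
      using row_pred by blast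
    have "snd (t k) < snd (t j)" using inc[of k] k Suc.prems by simp
    then show ?case using Suc.IH[OF k(2,4)] by simp
  qed simp
  have rows: "snd (t0 j) = row j" if "j \<in> {1..n}" for j using t0_eq[OF that] by simp
  have eq: "(\<Sum>j\<in>{1..n}. snd (t0 j)) = (\<Sum>j\<in>{1..n}. snd (t j))"
    using TB_row_sum[OF t(1)] TB_row_sum[OF t0_TB] by simp
  have "snd (t0 j) = snd (t j)" if "j \<in> {1..n}" for j
    by (rule sum_mono_inv[OF eq _ that]) (use ge rows in auto)
  moreover have "fst (t j) = fst (t0 j)" for j
    using fun_cong[OF t(2), of j] by (simp add: \<gamma>_def)
  ultimately have "t j = t0 j" for j
    using TB_outside[OF t(1), of j] TB_outside[OF t0_TB, of j] by (cases "j \<in> {1..n}") (simp_all add: prod_eq_iff)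
  then show ?thesis by (simp add: fun_eq_iff)
qed

text \<open>Induction on column inversions. At a descent inside a column antisymmetry determines
  \<open>v t\<close> from a word with one inversion less, after division by \<open>q\<close>; at
  equal neighbours it gives \<open>(q + 1) * v t = 0\<close>; a word of the right weight with
  neither is \<open>t0\<close>.\<close>

lemma antisymmetric_zero:
  fixes v :: "word \<Rightarrow> 'a::field"
  assumes q: "q \<noteq> 0" "q \<noteq> -1"
    and supp: "\<And>t. v t \<noteq> 0 \<Longrightarrow> t \<in> TB \<and> fst \<circ> t = \<gamma>"
    and anti: "\<And>i. i \<in> {1..<n} \<Longrightarrow> col i = col (Suc i) \<Longrightarrow> gop q i v = (\<lambda>t. - v t)"
    and v0: "v t0 = 0"
  shows "v t = 0"
proof (induction "cinv t" arbitrary: t rule: less_induct)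
  case less
  show ?case
  proof (rule ccontr)
    assume nz: "v t \<noteq> 0"
    then have t: "t \<in> TB" "fst \<circ> t = \<gamma>" using supp by blast+
    have "snd (t i) < snd (t (Suc i))" if i: "i \<in> {1..<n}" "col i = col (Suc i)" for i
    proof (rule ccontr)
      assume nl: "\<not> snd (t i) < snd (t (Suc i))"
      have f: "fst (t i) = fst (t (Suc i))"
        using fun_cong[OF t(2), of i] fun_cong[OF t(2), of "Suc i"] same_col_\<gamma>[OF i] by simp
      note g = fun_cong[OF anti[OF i], of t]
      show False
      proof (cases "snd (t i) = snd (t (Suc i))")
        case True
        have "(q + 1) * v t = 0" using g f True by (simp add: gop_def algebra_simps)
        then show False using nz q(2) by (simp add: add_eq_0_iff2)
      next
        case False
        then have gt: "snd (t (Suc i)) < snd (t i)" using nl by simp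
        have "cinv t = Suc (cinv (t \<circ> sgen i))" using cinv_sgen[OF i, of "t \<circ> sgen i"] gt by simp
        then have "v (t \<circ> sgen i) = 0" by (intro less) simp
        then have "q * v t = 0" using g f gt by (simp add: gop_def algebra_simps)
        then show False using nz q(1) by simp
      qed
    qed
    then have "t = t0" by (rule increasing_eq_t0[OF t])
    then show False using v0 nz by simp
  qed
qed

lemma antisymmetric_multiple:
  fixes v :: "word \<Rightarrow> 'a::field"
  assumes q: "q \<noteq> 0" "q \<noteq> -1"
    and supp: "\<And>t. v t \<noteq> 0 \<Longrightarrow> t \<in> TB \<and> fst \<circ> t = \<gamma>"
    and anti: "\<And>i. i \<in> {1..<n} \<Longrightarrow> col i = col (Suc i) \<Longrightarrow> gop q i v = (\<lambda>t. - v t)"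
  shows "v = (\<lambda>t. v t0 * z q t)"
proof
  fix t
  let ?w = "\<lambda>t. v t + (- v t0) * z q t"
  have "?w t = 0"
  proof (rule antisymmetric_zero[OF q, of ?w])
    show "\<sigma> \<in> TB \<and> fst \<circ> \<sigma> = \<gamma>" if "?w \<sigma> \<noteq> 0" for \<sigma>
      using that supp[of \<sigma>] z_support[of q \<sigma>] by (cases "v \<sigma> = 0"; cases "z q \<sigma> = 0") simp_all
    show "gop q i ?w = (\<lambda>t. - ?w t)" if "i \<in> {1..<n}" "col i = col (Suc i)" for i
      unfolding lin_op_add[OF lin_op_gop] lin_op_scale[OF lin_op_gop] anti[OF that] gop_z[OF that q(1)]
      by (simp add: fun_eq_iff)
    show "?w t0 = 0" by (simp add: z_t0)
  qed
  then show "v t = v t0 * z q t" by simp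
qed

text \<open>The pairing uses \<open>z 1\<close> for every parameter: transposing
  \<open>gop q i\<close> removes the powers of \<open>q\<close> from its antisymmetric vector, so
  the antisymmetric functional has signs as coefficients. \<open>ell_gop\<close> confirms
  this.\<close>

definition ell :: "(word \<Rightarrow> 'a::field) \<Rightarrow> 'a" where
  "ell v = (\<Sum>t\<in>TB. z 1 t * v t)"

lemma ell_add: "ell (\<lambda>t. v t + w t) = ell v + ell w"
  and ell_scale: "ell (\<lambda>t. c * v t) = c * ell v"
  by (simp_all add: ell_def algebra_simps sum.distrib sum_distrib_left)

lemma ell_sum: "ell (\<lambda>t. \<Sum>i\<in>I. f i t) = (\<Sum>i\<in>I. ell (f i))"
  by (simp add: ell_def sum_distrib_left sum.swap[of _ I])

lemma ell_mulw: "ell (mulw M v) = M \<gamma> * ell v"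
  unfolding ell_def mulw_def sum_distrib_left
proof (rule sum.cong[OF refl])
  fix t
  show "z 1 t * (M (fst \<circ> t) * v t) = M \<gamma> * (z 1 t * v t)"
    using z_support[of "1::'a" t] by (cases "z 1 t = (0::'a)") simp_all
qed

lemma ell_gop:
  fixes v :: "word \<Rightarrow> 'a::field"
  assumes i: "i \<in> {1..<n}" "col i = col (Suc i)"
  shows "ell (gop q i v) = - ell v"
proof -
  \<comment> \<open>\<open>A\<close> and \<open>B\<close> are the off-diagonal and diagonal
    coefficients of \<open>gop q i\<close> within one component. Words with equal neighbours do not
    matter, as \<open>z 1\<close> vanishes there.\<close>
  define A where "A t = (if snd (t i) < snd (t (Suc i)) then q else 1)" for t :: word
  define B where "B t = (if snd (t i) < snd (t (Suc i)) then 0 else q - 1)" for t :: word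
  have same: "fst (t i) = fst (t (Suc i))" if "z 1 t \<noteq> (0::'a)" for t
    using z_support[OF that] same_col_\<gamma>[OF i] by (metis comp_apply)
  have swap: "z 1 (t \<circ> sgen i) = - (z 1 t :: 'a)" for t
  proof -
    consider "snd (t i) < snd (t (Suc i))" | "snd (t i) = snd (t (Suc i))" | "snd (t (Suc i)) < snd (t i)"
      by linarith
    then show ?thesis
    proof cases
      case 1
      show ?thesis using z_swap[OF i 1, of "1::'a"] by simp
    next
      case 2
      then show ?thesis using z_eq_0[OF i, of t "1::'a"] z_eq_0[OF i, of "t \<circ> sgen i" "1::'a"] by simp
    next
      case 3
      then show ?thesis using z_swap[OF i, of "t \<circ> sgen i" "1::'a"] by simp
    qed
  qed
  have "ell (gop q i v) = (\<Sum>t\<in>TB. z 1 t * A t * v (t \<circ> sgen i)) + (\<Sum>t\<in>TB. z 1 t * B t * v t)"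
    unfolding ell_def sum.distrib[symmetric]
  proof (rule sum.cong[OF refl])
    fix t
    show "z 1 t * gop q i v t = z 1 t * A t * v (t \<circ> sgen i) + z 1 t * B t * v t"
    proof (cases "z 1 t = (0::'a)")
      case False
      then have "snd (t i) \<noteq> snd (t (Suc i))" using z_eq_0[OF i] by blast
      then show ?thesis using same[OF False] by (simp add: gop_def A_def B_def algebra_simps)
    qed simp
  qed
  \<comment> \<open>After the substitution \<open>t \<mapsto> t \<circ> sgen i\<close> both sums
    carry \<open>v t\<close>. The coefficients, relative to \<open>z 1 t\<close>, add up to
    \<open>-1 + 0\<close> at an ascent and \<open>-q + (q - 1)\<close> at a descent.\<close>
  also have "(\<Sum>t\<in>TB. z 1 t * A t * v (t \<circ> sgen i)) = (\<Sum>t\<in>TB. z 1 (t \<circ> sgen i) * A (t \<circ> sgen i) * v (t \<circ> sgen i \<circ> sgen i))"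
    by (rule sum.reindex_bij_betw[OF TB_bij[OF sgen_permutes[OF i(1)]], symmetric])
  also have "\<dots> + (\<Sum>t\<in>TB. z 1 t * B t * v t) = (\<Sum>t\<in>TB. - (z 1 t * v t))"
    unfolding sum.distrib[symmetric]
  proof (rule sum.cong[OF refl])
    fix t
    show "z 1 (t \<circ> sgen i) * A (t \<circ> sgen i) * v (t \<circ> sgen i \<circ> sgen i) + z 1 t * B t * v t = - (z 1 t * v t)"
    proof (cases "z 1 t = (0::'a)")
      case False
      then have "snd (t i) \<noteq> snd (t (Suc i))" using z_eq_0[OF i] by blast
      then show ?thesis by (simp add: swap A_def B_def algebra_simps)
    qed (simp add: swap)
  qed
  finally show ?thesis by (simp add: ell_def sum_negf)
qed

text \<open>The polytabloid is antisymmetric under the column generators at parameter 1, so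
  uniqueness makes it a multiple of \<open>z 1\<close>; both have coefficient 1 at
  \<open>t0\<close>.\<close>

lemma polytabloid_T0: "polytabloid n T0 = z 1"
proof -
  have t0: "polytabloid n T0 t0 = 1"
    using polytabloid_row_equal[OF T0 permutes_id] by (simp add: t0_def)
  have "polytabloid n T0 = (\<lambda>t. polytabloid n T0 t0 * z 1 t)"
  proof (rule antisymmetric_multiple)
    show "t \<in> TB \<and> fst \<circ> t = \<gamma>" if "polytabloid n T0 t \<noteq> 0" for t
    proof -
      obtain \<pi> where p: "\<pi> \<in> col_stab n T0" "t = tabloid_of n (T0 \<circ> \<pi>)"
      proof (rule ccontr)
        assume "\<not> thesis"
        then have "polytabloid n T0 t = 0" unfolding polytabloid_def
          using that by (intro sum.neutral) auto
        with \<open>polytabloid n T0 t \<noteq> 0\<close> show False by simp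
      qed
      have perm: "\<pi> permutes {1..n}" using p by (simp add: col_stab_iff)
      have "t \<in> TB" unfolding TB_def p(2) using dtableaux_comp[OF T0 perm] by blast
      moreover have "fst (t j) = \<gamma> j" for j
        using p unfolding \<gamma>_def t0_def tabloid_of_def col_stab_iff by simp
      ultimately show ?thesis by (simp add: fun_eq_iff)
    qed
    show "gop 1 i (polytabloid n T0) = (\<lambda>t. - polytabloid n T0 t)" if i: "i \<in> {1..<n}" "col i = col (Suc i)" for i
    proof -
      have "sgen i \<in> col_stab n T0"
        using sgen_permutes[OF i(1)] col_sgen[OF i(2)] by (simp add: col_stab_iff col_def)
      from polytabloid_col_stab[OF this] show ?thesis
        by (simp add: gop_one act_s_def sign_sgen)
    qed
  qed simp_all
  then show ?thesis unfolding t0 by simp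
qed

end

section \<open>The Casimir operator\<close>

text \<open>Right multiplication by \<open>sgen i\<close> exchanges ascents and descents at
  \<open>i\<close>. On each resulting pair the quadratic relation closes up, for the whole group in
  \<open>gop_cas\<close> and for the column group in \<open>V_irreducible\<close>.\<close>

lemma sum_ascents:
  fixes f :: "(nat \<Rightarrow> nat) \<Rightarrow> 'a::comm_monoid_add"
  assumes fin: "finite X" and cl: "\<And>p. p \<in> X \<Longrightarrow> p \<circ> sgen i \<in> X" and ne: "\<And>p. p \<in> X \<Longrightarrow> p i \<noteq> p (Suc i)"
  shows "sum f X = (\<Sum>p\<in>{p\<in>X. p i < p (Suc i)}. f p + f (p \<circ> sgen i))"
proof -
  let ?A = "{p\<in>X. p i < p (Suc i)}" and ?D = "{p\<in>X. p (Suc i) < p i}"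
  have X: "X = ?A \<union> ?D" using ne by (auto simp: neq_iff)
  have bij: "bij_betw (\<lambda>p. p \<circ> sgen i) ?A ?D"
  proof (rule bij_betwI[where g = "\<lambda>p. p \<circ> sgen i"])
    show "(\<lambda>p. p \<circ> sgen i) \<in> ?A \<rightarrow> ?D" using cl by simp
    show "(\<lambda>p. p \<circ> sgen i) \<in> ?D \<rightarrow> ?A" using cl by simp
  qed simp_all
  have "sum f X = sum f ?A + sum f ?D"
    by (subst X, rule sum.union_disjoint) (use fin in auto)
  also have "sum f ?D = (\<Sum>p\<in>?A. f (p \<circ> sgen i))"
    by (rule sum.reindex_bij_betw[OF bij, symmetric])
  finally show ?thesis by (simp add: sum.distrib)
qed

abbreviation perms :: "nat \<Rightarrow> (nat \<Rightarrow> nat) set" where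
  "perms n \<equiv> {p. p permutes {1..n}}"

lemma finite_perms: "finite (perms n)"
  by (rule finite_permutations) simp

lemma sum_perm_ascents:
  fixes f :: "(nat \<Rightarrow> nat) \<Rightarrow> 'a::comm_monoid_add"
  assumes "i \<in> {1..<n}"
  shows "(\<Sum>p\<in>perms n. f p) = (\<Sum>p\<in>{p \<in> perms n. p i < p (Suc i)}. f p + f (p \<circ> sgen i))"
proof (rule sum_ascents[OF finite_perms])
  show "p \<circ> sgen i \<in> perms n" if "p \<in> perms n" for p
    using permutes_comp_sgen[OF _ assms, of p] that by blast
  show "p i \<noteq> p (Suc i)" if "p \<in> perms n" for p
    using that inj_eq[OF permutes_inj, of p "{1..n}" i "Suc i"] by simp
qed

context coltab
begin

definition theta :: "'a::field \<Rightarrow> (word \<Rightarrow> 'a) \<Rightarrow> word \<Rightarrow> 'a" where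
  "theta q v = (\<lambda>t. ell v * z q t)"

text \<open>For a reduced word \<open>i1, ..., ik\<close> of \<open>p\<close> this is
  \<open>g_ik ... g_i1 theta g_i1 ... g_ik\<close>. The products on the two sides are reversals of
  each other, which is how standard and dual basis elements correspond up to rescaling.\<close>

definition Fop :: "'a::field \<Rightarrow> (nat \<Rightarrow> nat) \<Rightarrow> (word \<Rightarrow> 'a) \<Rightarrow> word \<Rightarrow> 'a" where
  "Fop q = perm_family n (\<lambda>i F v. gop q i (F (gop q i v))) (theta q)"

text \<open>Only crossings of equal components count: where \<open>e_i\<close> acts as 1 the
  quadratic relation is the Hecke relation with parameter \<open>q\<close>, and where it acts as 0
  the generator squares to 1 and needs no rescaling.\<close>

definition pinvs :: "(nat \<Rightarrow> nat) \<Rightarrow> nat" where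
  "pinvs p = card (invs n (\<lambda>_ _. True) (\<lambda>a b. b < a \<and> \<gamma> a = \<gamma> b) p)"

text \<open>Averaging over dual bases of the algebra makes the rank one operator
  \<^const>\<open>theta\<close> equivariant; on the weight space of a permutation the basis dual to
  the standard one is rescaled by a power of the parameter.\<close>
definition cas :: "'a::field \<Rightarrow> (word \<Rightarrow> 'a) \<Rightarrow> word \<Rightarrow> 'a" where
  "cas q v = (\<lambda>t. \<Sum>p\<in>perms n. (1 / q) ^ pinvs p * Fop q p v t)"

definition cc :: "'a::field \<Rightarrow> 'a" where
  "cc q = cas q (z q) t0"

text \<open>The maps \<open>F \<mapsto> g_i F g_i\<close> inherit the relations of the
  \<open>g_i\<close>; this makes \<open>Fop\<close> independent of reduced words.\<close>

lemma conj_gop_commute: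
  "Suc i < j \<Longrightarrow> (\<lambda>v. gop q i (gop q j (F (gop q j (gop q i v))))) = (\<lambda>v. gop q j (gop q i (F (gop q i (gop q j v)))))"
  by (rule ext) (simp add: gop_commute[of i j])

lemma Fop_id: "Fop q id = theta q"
  unfolding Fop_def by (rule perm_family_id, rule conj_gop_commute) (simp_all add: gop_braid)

lemma Fop_step:
  "p permutes {1..n} \<Longrightarrow> i \<in> {1..<n} \<Longrightarrow> p i < p (Suc i) \<Longrightarrow>
    Fop q (p \<circ> sgen i) v = gop q i (Fop q p (gop q i v))"
  unfolding Fop_def by (subst perm_family_step, rule conj_gop_commute) (simp_all only: gop_braid)

lemma pinvs_step:
  "i \<in> {1..<n} \<Longrightarrow> p i < p (Suc i) \<Longrightarrow> pinvs (p \<circ> sgen i) = pinvs p + (if \<gamma> (p i) = \<gamma> (p (Suc i)) then 1 else 0)"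
  unfolding pinvs_def by (subst card_invs_comp_sgen) auto

lemma lin_op_theta: "lin_op (theta q)"
  by (rule lin_opI) (simp_all add: theta_def ell_add ell_scale algebra_simps)

lemma lin_op_Fop: "p permutes {1..n} \<Longrightarrow> lin_op (Fop q p)"
proof (induction rule: permutes_ascent_induct)
  case id
  show ?case unfolding Fop_id by (rule lin_op_theta)
next
  case (step p i)
  have "Fop q (p \<circ> sgen i) = (\<lambda>v. gop q i (Fop q p (gop q i v)))"
    using Fop_step[OF step(1-3)] by (rule ext)
  then have "lin_op (Fop q (p \<circ> sgen i))"
    using lin_op_comp[OF lin_op_gop lin_op_comp[OF step(4) lin_op_gop]] by simp
  then show ?case .
qed

lemma lin_op_cas: "lin_op (cas q)"
  by (rule lin_opI)
    (simp_all add: cas_def lin_op_add[OF lin_op_Fop] lin_op_scale[OF lin_op_Fop] algebra_simps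
      sum.distrib sum_distrib_left)

text \<open>\<open>theta\<close> reads only weight \<open>\<gamma>\<close> and, for
  \<open>mulw_Fop\<close>, returns only that weight; each conjugation by \<open>g_i\<close> moves
  the weight along with \<open>p\<close>. So a diagonal operator acts on either side of
  \<open>Fop q p\<close> by the same scalar.\<close>

lemma Fop_mulw:
  "p permutes {1..n} \<Longrightarrow> Fop q p (mulw M v) = (\<lambda>t. M (\<gamma> \<circ> p) * Fop q p v t)"
proof (induction arbitrary: M v rule: permutes_ascent_induct)
  case id
  have "Fop q id (mulw M v) = (\<lambda>t. M (\<gamma> \<circ> id) * Fop q id v t)"
    by (simp add: Fop_id theta_def ell_mulw mult.assoc)
  then show ?case .
next
  case (step p i)
  have "Fop q (p \<circ> sgen i) (mulw M v) = (\<lambda>t. M (\<gamma> \<circ> (p \<circ> sgen i)) * Fop q (p \<circ> sgen i) v t)"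
    unfolding Fop_step[OF step(1-3)] gop_mulw step(4) lin_op_scale[OF lin_op_gop]
    by (simp add: comp_assoc)
  then show ?case .
qed

lemma mulw_Fop:
  "p permutes {1..n} \<Longrightarrow> mulw M (Fop q p v) = (\<lambda>t. M (\<gamma> \<circ> p) * Fop q p v t)"
proof (induction arbitrary: M v rule: permutes_ascent_induct)
  case id
  show ?case unfolding Fop_id theta_def mulw_def
  proof
    fix t
    show "M (fst \<circ> t) * (ell v * z q t) = M (\<gamma> \<circ> id) * (ell v * z q t)"
      using z_support[of q t] by (cases "z q t = 0") simp_all
  qed
next
  case (step p i)
  have X: "mulw M (gop q i X) = gop q i (mulw (\<lambda>w. M (w \<circ> sgen i)) X)" for X
    unfolding gop_mulw by simp
  have "mulw M (Fop q (p \<circ> sgen i) v) = (\<lambda>t. M (\<gamma> \<circ> (p \<circ> sgen i)) * Fop q (p \<circ> sgen i) v t)"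
    unfolding Fop_step[OF step(1-3)] X step(4) lin_op_scale[OF lin_op_gop] by (simp add: comp_assoc)
  then show ?case .
qed

lemma mulw_cas: "mulw M (cas q v) = cas q (mulw M v)"
proof -
  have "mulw M (cas q v) = (\<lambda>t. \<Sum>p\<in>perms n. (1 / q) ^ pinvs p * mulw M (Fop q p v) t)"
    by (simp add: mulw_def cas_def sum_distrib_left algebra_simps)
  also have "\<dots> = cas q (mulw M v)"
    unfolding cas_def
  proof (intro ext sum.cong[OF refl])
    fix t p assume "p \<in> perms n"
    then have p: "p permutes {1..n}" by blast
    show "(1 / q) ^ pinvs p * mulw M (Fop q p v) t = (1 / q) ^ pinvs p * Fop q p (mulw M v) t"
      unfolding mulw_Fop[OF p] Fop_mulw[OF p] ..
  qed
  finally show ?thesis .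
qed

lemma tchar_cas: "tchar x j (cas q v) = cas q (tchar x j v)"
  unfolding tchar_def by (rule mulw_cas)

lemma gop_cas:
  fixes q :: "'a::field"
  assumes i: "i \<in> {1..<n}" and q: "q \<noteq> 0"
  shows "gop q i (cas q v) = cas q (gop q i v)"
proof
  fix t :: word
  let ?P = "perms n"
  let ?c = "\<lambda>p. (1 / q) ^ pinvs p"
  have "gop q i (cas q v) = (\<lambda>t. \<Sum>p\<in>?P. gop q i (\<lambda>t. ?c p * Fop q p v t) t)"
    unfolding cas_def by (rule lin_op_sum[OF lin_op_gop])
  then have "gop q i (cas q v) t = (\<Sum>p\<in>?P. ?c p * gop q i (Fop q p v) t)"
    by (simp add: lin_op_scale[OF lin_op_gop])
  also have "\<dots> = (\<Sum>p\<in>{p\<in>?P. p i < p (Suc i)}. ?c p * gop q i (Fop q p v) t + ?c (p \<circ> sgen i) * gop q i (Fop q (p \<circ> sgen i) v) t)"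
    by (rule sum_perm_ascents[OF i])
  also have "\<dots> = (\<Sum>p\<in>{p\<in>?P. p i < p (Suc i)}. ?c p * Fop q p (gop q i v) t + ?c (p \<circ> sgen i) * Fop q (p \<circ> sgen i) (gop q i v) t)"
  proof (rule sum.cong[OF refl])
    fix p assume "p \<in> {p\<in>?P. p i < p (Suc i)}"
    then have p: "p permutes {1..n}" and asc: "p i < p (Suc i)" by auto
    let ?w = "Fop q p (gop q i v)"
    \<comment> \<open>The eigenvalue of \<open>e_i\<close> on the weight space of \<open>p\<close>.
      If it is 1, passing to \<open>p \<circ> sgen i\<close> multiplies the coefficient by
      \<open>1 / q\<close>; if it is 0, the coefficient stays. In both cases the quadratic relation
      makes the two contributions of the pair agree.\<close>
    define \<delta> :: 'a where "\<delta> = (if \<gamma> (p i) = \<gamma> (p (Suc i)) then 1 else 0)"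
    have e1: "eop i ?w = (\<lambda>t. \<delta> * ?w t)"
      unfolding eop_def mulw_Fop[OF p] \<delta>_def by simp
    have e2: "eop i (gop q i ?w) = (\<lambda>t. \<delta> * gop q i ?w t)"
      unfolding gop_eop[symmetric] e1 by (rule lin_op_scale[OF lin_op_gop])
    have e3: "Fop q p (eop i u) = (\<lambda>t. \<delta> * Fop q p u t)" for u
      unfolding eop_def Fop_mulw[OF p] \<delta>_def by simp
    have L: "gop q i (gop q i ?w) t = ?w t + (q - 1) * (\<delta> * ?w t) + (q - 1) * (\<delta> * gop q i ?w t)"
      unfolding gop_quadratic e1 e2 ..
    have "Fop q p (gop q i (gop q i v)) = (\<lambda>t. Fop q p v t + (q - 1) * (\<delta> * Fop q p v t) + (q - 1) * (\<delta> * ?w t))"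
      unfolding gop_quadratic lin_op_add[OF lin_op_Fop[OF p]] lin_op_scale[OF lin_op_Fop[OF p]] e3 ..
    then have R: "gop q i (Fop q p (gop q i (gop q i v))) t = gop q i (Fop q p v) t + (q - 1) * (\<delta> * gop q i (Fop q p v) t) + (q - 1) * (\<delta> * gop q i ?w t)"
      by (simp add: lin_op_add[OF lin_op_gop] lin_op_scale[OF lin_op_gop])
    show "?c p * gop q i (Fop q p v) t + ?c (p \<circ> sgen i) * gop q i (Fop q (p \<circ> sgen i) v) t =
        ?c p * ?w t + ?c (p \<circ> sgen i) * Fop q (p \<circ> sgen i) (gop q i v) t"
      unfolding Fop_step[OF p i asc] pinvs_step[of i p, OF i asc] L R \<delta>_def
      using q by (simp add: field_simps)
  qed
  also have "\<dots> = cas q (gop q i v) t"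
    unfolding cas_def by (rule sum_perm_ascents[OF i, symmetric])
  finally show "gop q i (cas q v) t = cas q (gop q i v) t" .
qed

lemma gop_support:
  assumes "i \<in> {1..<n}" "\<And>t. t \<notin> TB \<Longrightarrow> v t = 0" "t \<notin> TB"
  shows "gop q i v t = 0"
  using assms(2)[of t] assms(2)[of "t \<circ> sgen i"] assms(3) TB_sgen[OF assms(1), of t] by (simp add: gop_def)

lemma Fop_support: "p permutes {1..n} \<Longrightarrow> t \<notin> TB \<Longrightarrow> Fop q p v t = 0"
proof (induction arbitrary: v t rule: permutes_ascent_induct)
  case id
  then have "z q t = 0" using z_support by blast
  then show ?case unfolding Fop_id by (simp add: theta_def)
next
  case (step p i)
  show ?case unfolding Fop_step[OF step(1-3)]
    by (rule gop_support[OF step(2) step(4) step(5)])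
qed

lemma cas_support: "t \<notin> TB \<Longrightarrow> cas q v t = 0"
  unfolding cas_def by (intro sum.neutral) (simp add: Fop_support)

text \<open>An equivariant operator keeps weight and antisymmetry, so \<open>z q\<close> goes to a
  multiple of itself, read off at \<open>t0\<close>.\<close>

lemma cas_z:
  fixes q :: "'a::field"
  assumes q: "q \<noteq> 0" "q \<noteq> -1"
  shows "cas q (z q) = (\<lambda>t. cc q * z q t)"
  unfolding cc_def
proof (rule antisymmetric_multiple[OF q])
  fix t assume nz: "cas q (z q) t \<noteq> 0"
  let ?M = "\<lambda>w. if w = \<gamma> then 1 else (0::'a)"
  have "mulw ?M (z q) = z q"
    using z_support[of q] by (auto simp: mulw_def fun_eq_iff)
  then have "mulw ?M (cas q (z q)) t = cas q (z q) t" by (simp add: mulw_cas)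
  then have "fst \<circ> t = \<gamma>" using nz by (auto simp: mulw_def split: if_splits)
  then show "t \<in> TB \<and> fst \<circ> t = \<gamma>" using nz cas_support by blast
next
  fix i assume i: "i \<in> {1..<n}" "col i = col (Suc i)"
  show "gop q i (cas q (z q)) = (\<lambda>t. - cas q (z q) t)"
    unfolding gop_cas[OF i(1) q(1)] gop_z[OF i q(1)] by (rule lin_op_uminus[OF lin_op_cas])
qed

text \<open>Values of \<open>Fop q p\<close> arise from multiples of \<open>z q\<close> by applying
  generators, and \<open>cas q\<close> commutes with these.\<close>

lemma cas_Fop:
  assumes q: "q \<noteq> 0" "q \<noteq> -1"
  shows "p permutes {1..n} \<Longrightarrow> cas q (Fop q p v) = (\<lambda>t. cc q * Fop q p v t)"
proof (induction arbitrary: v rule: permutes_ascent_induct)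
  case id
  show ?case unfolding Fop_id theta_def lin_op_scale[OF lin_op_cas] cas_z[OF q] by (simp add: mult.left_commute)
next
  case (step p i)
  show ?case unfolding Fop_step[OF step(1-3)] gop_cas[OF step(2) q(1), symmetric] step(4)
    by (rule lin_op_scale[OF lin_op_gop])
qed

lemma cas_cas:
  assumes q: "q \<noteq> 0" "q \<noteq> -1"
  shows "cas q (cas q v) = (\<lambda>t. cc q * cas q v t)"
proof -
  let ?P = "perms n"
  have "cas q (cas q v) = (\<lambda>t. \<Sum>p\<in>?P. cas q (\<lambda>t. (1 / q) ^ pinvs p * Fop q p v t) t)"
    unfolding cas_def[of q v] by (rule lin_op_sum[OF lin_op_cas])
  also have "\<dots> = (\<lambda>t. \<Sum>p\<in>?P. cc q * ((1 / q) ^ pinvs p * Fop q p v t))"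
    by (intro ext sum.cong[OF refl]) (simp add: lin_op_scale[OF lin_op_cas] cas_Fop[OF q])
  finally show ?thesis by (simp add: cas_def sum_distrib_left)
qed

section \<open>The Casimir operator at parameter 1 and the Specht module\<close>

lemma Fop_one:
  "p permutes {1..n} \<Longrightarrow> Fop 1 p v = (\<lambda>t. ell (\<lambda>\<sigma>. v (\<sigma> \<circ> p)) * (z 1 (t \<circ> pinv p) :: complex))"
proof (induction arbitrary: v rule: permutes_ascent_induct)
  case id
  have "Fop 1 id v = (\<lambda>t. ell (\<lambda>\<sigma>. v (\<sigma> \<circ> id)) * (z 1 (t \<circ> pinv id) :: complex))"
    by (simp add: Fop_id theta_def inv_id)
  then show ?case .
next
  case (step p i)
  have "pinv (p \<circ> sgen i) = pinv (sgen i) \<circ> pinv p"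
    using permutes_bij[OF step(1)] permutes_bij[OF sgen_permutes[OF step(2)]] by (simp add: o_inv_distrib)
  moreover have "pinv (sgen i) = sgen i" by (rule inv_unique_comp) simp_all
  ultimately have "Fop 1 (p \<circ> sgen i) v = (\<lambda>t. ell (\<lambda>\<sigma>. v (\<sigma> \<circ> (p \<circ> sgen i))) * (z 1 (t \<circ> pinv (p \<circ> sgen i)) :: complex))"
    unfolding Fop_step[OF step(1-3)] step(4) gop_one act_s_def by (simp add: comp_assoc)
  then show ?case .
qed

lemma cas_one: "cas 1 v t = (\<Sum>p\<in>perms n. ell (\<lambda>\<sigma>. v (\<sigma> \<circ> p)) * (z 1 (t \<circ> pinv p) :: complex))"
  unfolding cas_def by (intro sum.cong) (simp_all add: Fop_one)

lemma cas_one_comp: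
  fixes v :: "word \<Rightarrow> complex"
  assumes r: "r permutes {1..n}"
  shows "cas 1 (\<lambda>\<sigma>. v (\<sigma> \<circ> r)) t = cas 1 v (t \<circ> r)"
proof -
  have "cas 1 v (t \<circ> r) = (\<Sum>p\<in>perms n. ell (\<lambda>\<sigma>. v (\<sigma> \<circ> (p \<circ> r))) * z 1 (t \<circ> r \<circ> pinv (p \<circ> r)))"
    unfolding cas_one by (rule sum_permutations_compose_right[OF r])
  also have "\<dots> = cas 1 (\<lambda>\<sigma>. v (\<sigma> \<circ> r)) t"
    unfolding cas_one
  proof (rule sum.cong[OF refl])
    fix p assume "p \<in> perms n"
    then have p: "p permutes {1..n}" by blast
    have "pinv (p \<circ> r) = pinv r \<circ> pinv p"
      using permutes_bij[OF p] permutes_bij[OF r] by (simp add: o_inv_distrib)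
    then have "t \<circ> r \<circ> pinv (p \<circ> r) = t \<circ> (r \<circ> pinv r) \<circ> pinv p" by (simp add: comp_assoc)
    then have "t \<circ> r \<circ> pinv (p \<circ> r) = t \<circ> pinv p" by (simp add: permutes_inv_o[OF r])
    then show "ell (\<lambda>\<sigma>. v (\<sigma> \<circ> (p \<circ> r))) * z 1 (t \<circ> r \<circ> pinv (p \<circ> r)) = ell (\<lambda>\<sigma>. v (\<sigma> \<circ> p \<circ> r)) * z 1 (t \<circ> pinv p)"
      by (simp add: comp_assoc)
  qed
  finally show ?thesis by simp
qed

lemma z_one_real: "z 1 t = complex_of_real (z 1 t)"
  by (simp add: z_def)

text \<open>Pairing \<open>cas 1 (z 1)\<close> with \<open>z 1\<close> gives the sum of all
  \<open>a p * a p\<close>, where \<open>a p\<close> is the inner product of \<open>z 1\<close> with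
  its translate by \<open>p\<close>. These numbers are real, and \<open>a id\<close> is the squared
  length of \<open>z 1\<close>, which is positive as \<open>z 1 t0 = 1\<close>.\<close>

lemma cc_one_neq_0: "cc (1::complex) \<noteq> 0"
proof
  assume c0: "cc (1::complex) = 0"
  let ?P = "perms n"
  define a where "a p = (\<Sum>t\<in>TB. z 1 t * z 1 (t \<circ> p) :: real)" for p
  have a1: "ell (\<lambda>\<sigma>. z 1 (\<sigma> \<circ> p)) = complex_of_real (a p)" for p
    unfolding ell_def a_def of_real_sum of_real_mult z_one_real[symmetric] ..
  have a2: "ell (\<lambda>\<sigma>. z 1 (\<sigma> \<circ> pinv p)) = complex_of_real (a p)" if p: "p permutes {1..n}" for p
  proof -
    have "ell (\<lambda>\<sigma>. z 1 (\<sigma> \<circ> pinv p)) = (\<Sum>t\<in>TB. z 1 (t \<circ> p) * (z 1 (t \<circ> p \<circ> pinv p) :: complex))"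
      unfolding ell_def by (rule sum.reindex_bij_betw[OF TB_bij[OF p], symmetric])
    also have "\<dots> = ell (\<lambda>\<sigma>. z 1 (\<sigma> \<circ> p))"
      unfolding ell_def by (simp add: comp_assoc permutes_inv_o[OF p] mult.commute)
    finally show ?thesis using a1 by simp
  qed
  have "cas 1 (z 1) = (\<lambda>t. 0::complex)" using cas_z[of "1::complex"] c0 by simp
  then have "ell (cas 1 (z 1)) = (0::complex)" by (simp add: ell_def)
  moreover have "ell (cas 1 (z 1)) = (\<Sum>p\<in>?P. ell (\<lambda>t. ell (\<lambda>\<sigma>. z 1 (\<sigma> \<circ> p)) * (z 1 (t \<circ> pinv p) :: complex)))"
    unfolding ell_sum[symmetric] by (rule arg_cong[where f = ell]) (simp add: cas_one fun_eq_iff)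
  moreover have "\<dots> = (\<Sum>p\<in>?P. complex_of_real (a p * a p))"
  proof (rule sum.cong[OF refl])
    fix p assume "p \<in> ?P"
    then have p: "p permutes {1..n}" by blast
    show "ell (\<lambda>t. ell (\<lambda>\<sigma>. z 1 (\<sigma> \<circ> p)) * z 1 (t \<circ> pinv p)) = complex_of_real (a p * a p)"
      by (simp only: ell_scale a2[OF p] a1[of p] of_real_mult)
  qed
  ultimately have "complex_of_real (\<Sum>p\<in>?P. a p * a p) = 0" by simp
  then have s0: "(\<Sum>p\<in>?P. a p * a p) = 0" by (simp only: of_real_eq_0_iff)
  have "id \<in> ?P" by (simp add: permutes_id)
  then have "a id * a id = 0"
    using sum_nonneg_eq_0_iff[OF finite_perms[of n], of "\<lambda>p. a p * a p"] s0 by simp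
  then have "(\<Sum>t\<in>TB. z 1 t * z 1 t :: real) = 0" by (simp add: a_def)
  then have "z 1 t0 * z 1 t0 = (0::real)"
    using sum_nonneg_eq_0_iff[OF finite_TB, of "\<lambda>t. z 1 t * z 1 t :: real"] t0_TB by simp
  then show False by (simp add: z_t0)
qed

lemma polytabloid_T0_comp:
  "p permutes {1..n} \<Longrightarrow> polytabloid n (T0 \<circ> p) = (\<lambda>t. z 1 (t \<circ> pinv p))"
  by (simp add: fun_eq_iff polytabloid_comp polytabloid_T0)

lemma perms_bij_dtableaux: "bij_betw (\<lambda>p. T0 \<circ> p) (perms n) (dtableaux n lam)"
  unfolding bij_betw_def
proof
  show "inj_on (\<lambda>p. T0 \<circ> p) (perms n)"
  proof (rule inj_onI)
    fix p r assume "p \<in> perms n" "r \<in> perms n" and e: "T0 \<circ> p = T0 \<circ> r"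
    then have p: "p permutes {1..n}" and r: "r permutes {1..n}" by auto
    have "p j = r j" for j
    proof (cases "j \<in> {1..n}")
      case True
      then have "p j \<in> {1..n}" "r j \<in> {1..n}" using permutes_in_image[OF p] permutes_in_image[OF r] by blast+
      moreover have "T0 (p j) = T0 (r j)" using fun_cong[OF e, of j] by simp
      ultimately show ?thesis using inj_onD[OF dtableauxD(4)[OF T0]] by blast
    next
      case False
      then show ?thesis using permutes_not_in[OF p] permutes_not_in[OF r] by metis
    qed
    then show "p = r" by (rule ext)
  qed
  show "(\<lambda>p. T0 \<circ> p) ` perms n = dtableaux n lam"
    using dtableaux_comp[OF T0] dtableaux_ex_permutes[OF _ T0] by blast
qed

text \<open>Values of \<open>cas 1\<close> are combinations of translates of \<open>z 1\<close>,
  that is, of polytabloids; as \<open>cc 1\<close> is nonzero, so are its eigenvectors. Conversely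
  \<open>cas 1\<close> commutes with translations, so each polytabloid inherits the eigenvalue of
  \<open>z 1\<close>.\<close>

lemma specht_iff: "v \<in> specht n lam \<longleftrightarrow> cas 1 v = (\<lambda>t. cc 1 * v t)"
proof
  assume "v \<in> specht n lam"
  then obtain c where v: "v = (\<lambda>t. \<Sum>T\<in>dtableaux n lam. c T * polytabloid n T t)"
    by (auto simp: specht_def)
  have T: "cas 1 (polytabloid n T) = (\<lambda>t. cc 1 * polytabloid n T t)" if T: "T \<in> dtableaux n lam" for T
  proof -
    obtain p where p: "p permutes {1..n}" "T = T0 \<circ> p" using dtableaux_ex_permutes[OF T T0] by blast
    show ?thesis unfolding p(2) polytabloid_T0_comp[OF p(1)]
      by (simp add: fun_eq_iff cas_one_comp[OF permutes_inv[OF p(1)]] cas_z)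
  qed
  have "cas 1 v = (\<lambda>t. \<Sum>T\<in>dtableaux n lam. cas 1 (\<lambda>t. c T * polytabloid n T t) t)"
    unfolding v by (rule lin_op_sum[OF lin_op_cas])
  also have "\<dots> = (\<lambda>t. \<Sum>T\<in>dtableaux n lam. cc 1 * (c T * polytabloid n T t))"
    by (intro ext sum.cong[OF refl]) (simp add: lin_op_scale[OF lin_op_cas] T)
  finally show "cas 1 v = (\<lambda>t. cc 1 * v t)" by (simp add: v sum_distrib_left)
next
  assume a: "cas 1 v = (\<lambda>t. cc 1 * v t)"
  let ?P = "perms n"
  \<comment> \<open>The coefficient of the polytabloid of \<open>T\<close> in \<open>cas 1 v\<close>
    divided by \<open>cc 1\<close>; \<open>inv_into\<close> recovers the permutation that renumbers
    \<open>T0\<close> to \<open>T\<close>.\<close>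
  define c where "c T = ell (\<lambda>\<sigma>. v (\<sigma> \<circ> inv_into ?P (\<lambda>p. T0 \<circ> p) T)) / cc 1" for T
  have c: "c (T0 \<circ> p) = ell (\<lambda>\<sigma>. v (\<sigma> \<circ> p)) / cc 1" if "p \<in> ?P" for p
    unfolding c_def using inv_into_f_f[OF bij_betw_imp_inj_on[OF perms_bij_dtableaux] that] by simp
  have "v t = (\<Sum>T\<in>dtableaux n lam. c T * polytabloid n T t)" for t
  proof -
    have "v t = cas 1 v t / cc 1" using a cc_one_neq_0 by simp
    also have "\<dots> = (\<Sum>p\<in>?P. c (T0 \<circ> p) * polytabloid n (T0 \<circ> p) t)"
      unfolding cas_one sum_divide_distrib
      by (rule sum.cong[OF refl]) (simp add: c polytabloid_T0_comp)
    also have "\<dots> = (\<Sum>T\<in>dtableaux n lam. c T * polytabloid n T t)"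
      by (rule sum.reindex_bij_betw[OF perms_bij_dtableaux])
    finally show ?thesis .
  qed
  then show "v \<in> specht n lam" unfolding specht_def by blast
qed

lemma spec_z: "spec q c \<Longrightarrow> c \<noteq> 0 \<Longrightarrow> spec (z q t) (z c t)"
  by (simp add: z_def spec_0 spec_power spec_uminus spec_divide spec_1)

lemma spec_ell: "(\<And>t. spec (v t) (w t)) \<Longrightarrow> spec (ell v) (ell w)"
  unfolding ell_def by (intro spec_sum spec_mult spec_z spec_1) simp_all

lemma spec_gop:
  assumes "\<And>t. spec (v t) (w t)"
  shows "spec (gop uu i v t) (gop 1 i w t)"
proof -
  have "spec (uu * v \<sigma>) (1 * w \<sigma>)" for \<sigma> by (rule spec_mult[OF spec_uu assms])
  moreover have "spec (v \<sigma> + (uu - 1) * v t) (w \<sigma> + (1 - 1) * w t)" for \<sigma>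
    by (intro spec_add spec_mult spec_diff spec_uu spec_1 assms)
  ultimately show ?thesis using assms unfolding gop_def by simp
qed

lemma spec_Fop:
  "p permutes {1..n} \<Longrightarrow> (\<And>t. spec (v t) (w t)) \<Longrightarrow> spec (Fop uu p v t) (Fop 1 p w t)"
proof (induction arbitrary: v w t rule: permutes_ascent_induct)
  case id
  show ?case unfolding Fop_id theta_def using id by (intro spec_mult spec_ell spec_z spec_uu) simp_all
next
  case (step p i)
  show ?case unfolding Fop_step[OF step(1-3)] by (intro spec_gop step(4)) (rule step(5))
qed

lemma spec_cas: "(\<And>t. spec (v t) (w t)) \<Longrightarrow> spec (cas uu v t) (cas 1 w t)"
  unfolding cas_def
  by (intro spec_sum spec_mult spec_power spec_divide spec_1 spec_uu spec_Fop) simp_all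

lemma spec_cc: "spec (cc uu) (cc 1)"
  unfolding cc_def by (intro spec_cas spec_z spec_uu) simp

lemma cc_uu_neq_0: "cc uu \<noteq> 0"
  using spec_nonzero[OF spec_cc cc_one_neq_0] .

end

section \<open>Lifting a basis of the Specht module\<close>

definition subsp :: "('i \<Rightarrow> 'a::field) set \<Rightarrow> bool" where
  "subsp S \<longleftrightarrow> (\<lambda>_. 0) \<in> S \<and> (\<forall>v\<in>S. \<forall>w\<in>S. (\<lambda>t. v t + w t) \<in> S) \<and> (\<forall>c. \<forall>v\<in>S. (\<lambda>t. c * v t) \<in> S)"

lemma subsp_0: "subsp S \<Longrightarrow> (\<lambda>_. 0) \<in> S"
  and subsp_add: "subsp S \<Longrightarrow> v \<in> S \<Longrightarrow> w \<in> S \<Longrightarrow> (\<lambda>t. v t + w t) \<in> S"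
  and subsp_scale: "subsp S \<Longrightarrow> v \<in> S \<Longrightarrow> (\<lambda>t. c * v t) \<in> S"
  unfolding subsp_def by blast+

lemma subsp_diff: "subsp S \<Longrightarrow> v \<in> S \<Longrightarrow> w \<in> S \<Longrightarrow> (\<lambda>t. v t - c * w t) \<in> S"
  using subsp_add[of S v "\<lambda>t. (- c) * w t"] subsp_scale[of S w "- c"] by simp

lemma subsp_sum: "subsp S \<Longrightarrow> (\<And>i. i \<in> I \<Longrightarrow> f i \<in> S) \<Longrightarrow> (\<lambda>t. \<Sum>i\<in>I. c i * f i t) \<in> S"
proof (induction I rule: infinite_finite_induct)
  case (insert j I)
  have "(\<lambda>t. c j * f j t + (\<Sum>i\<in>I. c i * f i t)) \<in> S"
    using insert by (intro subsp_add subsp_scale) simp_all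
  then show ?case using insert by simp
qed (simp_all add: subsp_0)

text \<open>A reduced echelon form whose pivots are points, so that coordinates are values and stay
  compatible with evaluation at 1. At a new point either all vectors vanish, or one with value 1
  there is cleared at the old pivots.\<close>

lemma ex_echelon_basis:
  fixes S :: "('i \<Rightarrow> 'a::field) set"
  assumes "finite B" "subsp S" "\<And>v. v \<in> S \<Longrightarrow> (\<forall>b\<in>B. v b = 0) \<Longrightarrow> v = (\<lambda>_. 0)"
  shows "\<exists>P x. P \<subseteq> B \<and> (\<forall>p\<in>P. x p \<in> S) \<and> (\<forall>p\<in>P. \<forall>p'\<in>P. x p p' = (if p = p' then 1 else 0))
    \<and> (\<forall>v\<in>S. v = (\<lambda>t. \<Sum>p\<in>P. v p * x p t))"
  using assms
proof (induction B arbitrary: S rule: finite_induct)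
  case empty
  then have "\<forall>v\<in>S. v = (\<lambda>_. 0)" by blast
  then show ?case by (intro exI[of _ "{}"]) simp
next
  case (insert b B)
  define S' where "S' = {v \<in> S. v b = 0}"
  have sub: "subsp S'" using insert.prems(1) unfolding S'_def subsp_def by simp
  have "v = (\<lambda>_. 0)" if "v \<in> S'" "\<forall>b\<in>B. v b = 0" for v
    using that insert.prems(2)[of v] unfolding S'_def by simp
  from insert.IH[OF sub this] obtain P x where P: "P \<subseteq> B" and xS: "\<forall>p\<in>P. x p \<in> S'"
    and x\<delta>: "\<forall>p\<in>P. \<forall>p'\<in>P. x p p' = (if p = p' then 1 else 0)"
    and ex: "\<forall>v\<in>S'. v = (\<lambda>t. \<Sum>p\<in>P. v p * x p t)" by blast
  have xS2: "x p \<in> S" "x p b = 0" if "p \<in> P" for p using xS that unfolding S'_def by auto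
  have finP: "finite P" using P insert.hyps(1) by (rule finite_subset)
  have bP: "b \<notin> P" using P insert.hyps(2) by blast
  show ?case
  proof (cases "\<exists>w\<in>S. w b \<noteq> 0")
    case False
    then have "S' = S" unfolding S'_def by blast
    then show ?thesis using P xS x\<delta> ex by blast
  next
    case True
    then obtain w0 where w0: "w0 \<in> S" "w0 b \<noteq> 0" by blast
    define w where "w = (\<lambda>t. inverse (w0 b) * w0 t)"
    have w: "w \<in> S" "w b = 1" using w0 subsp_scale[OF insert.prems(1)] unfolding w_def by simp_all
    define w' where "w' = (\<lambda>t. w t - 1 * (\<Sum>p\<in>P. w p * x p t))"
    have w'S: "w' \<in> S" unfolding w'_def
      using w xS2 insert.prems(1) by (intro subsp_diff subsp_sum) simp_all
    have w'b: "w' b = 1" using w xS2 by (simp add: w'_def)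
    have w'P: "w' p = 0" if "p \<in> P" for p
    proof -
      have "(\<Sum>p'\<in>P. w p' * x p' p) = (\<Sum>p'\<in>P. if p' = p then w p' else 0)"
        using x\<delta> that by (intro sum.cong) simp_all
      then show ?thesis using that finP by (simp add: w'_def)
    qed
    let ?x = "x(b := w')"
    show ?thesis
    proof (intro exI[of _ "insert b P"] exI[of _ ?x] conjI)
      show "insert b P \<subseteq> insert b B" using P by blast
      show "\<forall>p\<in>insert b P. ?x p \<in> S" using w'S xS2 by simp
      show "\<forall>p\<in>insert b P. \<forall>p'\<in>insert b P. ?x p p' = (if p = p' then 1 else 0)"
        using w'b w'P xS2 x\<delta> bP by auto
      show "\<forall>v\<in>S. v = (\<lambda>t. \<Sum>p\<in>insert b P. v p * ?x p t)"
      proof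
        fix v assume v: "v \<in> S"
        let ?v = "\<lambda>t. v t - v b * w' t"
        have "?v \<in> S'" unfolding S'_def using subsp_diff[OF insert.prems(1) v w'S] w'b by simp
        then have "?v = (\<lambda>t. \<Sum>p\<in>P. ?v p * x p t)" using ex by blast
        note e = fun_cong[OF this]
        show "v = (\<lambda>t. \<Sum>p\<in>insert b P. v p * ?x p t)"
        proof
          fix t
          have "v t = v b * w' t + ?v t" by simp
          also have "?v t = (\<Sum>p\<in>P. ?v p * x p t)" by (rule e)
          also have "\<dots> = (\<Sum>p\<in>P. v p * ?x p t)"
            using bP w'P by (intro sum.cong) auto
          finally show "v t = (\<Sum>p\<in>insert b P. v p * ?x p t)"
            using finP bP by simp
        qed
      qed
    qed
  qed
qed

text \<open>Gaussian elimination over the local ring at 1: pivots reducing to 1 are invertible.\<close>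
lemma lift_dual_basis:
  fixes V :: "('i \<Rightarrow> Cu) set" and v :: "'i \<Rightarrow> 'i \<Rightarrow> Cu"
  assumes "finite P" "subsp V" "\<And>p. p \<in> P \<Longrightarrow> v p \<in> V" "\<And>p t. p \<in> P \<Longrightarrow> spec (v p t) (y p t)"
    "\<And>p p'. p \<in> P \<Longrightarrow> p' \<in> P \<Longrightarrow> y p p' = (if p = p' then 1 else 0)"
  shows "\<exists>x. \<forall>p\<in>P. x p \<in> V \<and> (\<forall>t. spec (x p t) (y p t)) \<and> (\<forall>p'\<in>P. x p p' = (if p = p' then 1 else 0))"
  using assms(1,3-)
proof (induction P rule: finite_induct)
  case (insert b P)
  have "\<exists>x. \<forall>p\<in>P. x p \<in> V \<and> (\<forall>t. spec (x p t) (y p t)) \<and> (\<forall>p'\<in>P. x p p' = (if p = p' then 1 else 0))"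
    by (rule insert.IH) (use insert.prems in simp_all)
  then obtain x where xV: "\<And>p. p \<in> P \<Longrightarrow> x p \<in> V" and xs: "\<And>p t. p \<in> P \<Longrightarrow> spec (x p t) (y p t)"
    and x\<delta>: "\<And>p p'. p \<in> P \<Longrightarrow> p' \<in> P \<Longrightarrow> x p p' = (if p = p' then 1 else 0)" by blast
  define w where "w = (\<lambda>t. v b t - 1 * (\<Sum>p\<in>P. v b p * x p t))"
  have wV: "w \<in> V" unfolding w_def
    using insert.prems(1) xV assms(2) by (intro subsp_diff subsp_sum) simp_all
  have ws: "spec (w t) (y b t)" for t
  proof -
    have "spec (w t) (y b t - 1 * (\<Sum>p\<in>P. y b p * y p t))"
      unfolding w_def using insert.prems(2) xs by (intro spec_diff spec_mult spec_sum spec_1) simp_all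
    moreover have "(\<Sum>p\<in>P. y b p * y p t) = 0"
      using insert.prems(3) insert.hyps(2) by (intro sum.neutral) auto
    ultimately show ?thesis by simp
  qed
  have wP: "w p = 0" if "p \<in> P" for p
  proof -
    have "(\<Sum>p'\<in>P. v b p' * x p' p) = (\<Sum>p'\<in>P. if p' = p then v b p' else 0)"
      using x\<delta> that by (intro sum.cong) simp_all
    then show ?thesis using that insert.hyps(1) by (simp add: w_def)
  qed
  have wb: "spec (w b) 1" using ws[of b] insert.prems(3)[of b b] by simp
  have wb0: "w b \<noteq> 0" using spec_nonzero[OF wb] by simp
  define w' where "w' = (\<lambda>t. inverse (w b) * w t)"
  have w'V: "w' \<in> V" unfolding w'_def by (rule subsp_scale[OF assms(2) wV])
  have w's: "spec (w' t) (y b t)" for t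
    using spec_mult[OF spec_inverse[OF wb] ws[of t]] by (simp add: w'_def)
  have w'b: "w' b = 1" using wb0 by (simp add: w'_def)
  have w'P: "w' p = 0" if "p \<in> P" for p using wP[OF that] by (simp add: w'_def)
  define x' where "x' p = (if p = b then w' else (\<lambda>t. x p t - x p b * w' t))" for p
  have "x' p \<in> V \<and> (\<forall>t. spec (x' p t) (y p t)) \<and> (\<forall>p'\<in>insert b P. x' p p' = (if p = p' then 1 else 0))"
    if p: "p \<in> insert b P" for p
  proof (cases "p = b")
    case True
    then show ?thesis using w'V w's w'b w'P insert.hyps(2) by (auto simp: x'_def)
  next
    case False
    then have pP: "p \<in> P" using p by simp
    have "spec (x p t - x p b * w' t) (y p t)" for t
    proof -
      have "spec (x p t - x p b * w' t) (y p t - y p b * y b t)"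
        using xs[OF pP] w's by (intro spec_diff spec_mult)
      then show ?thesis using insert.prems(3)[of p b] False pP by simp
    qed
    moreover have "(\<lambda>t. x p t - x p b * w' t) \<in> V" by (rule subsp_diff[OF assms(2) xV[OF pP] w'V])
    ultimately show ?thesis using False x\<delta>[OF pP] w'b w'P by (simp add: x'_def)
  qed
  then show ?case by blast
qed simp

lemma xi_power: "xi d ^ k = cis (2 * pi * real k / real d)"
  by (simp add: xi_def DeMoivre mult.commute mult.left_commute)

lemma xi_power_inj: "a < d \<Longrightarrow> b < d \<Longrightarrow> xi d ^ a = xi d ^ b \<Longrightarrow> a = b"
  using bij_betw_imp_inj_on[OF bij_betw_roots_unity[of d]] unfolding xi_power by (auto dest: inj_onD)

lemma xi_power_d: "0 < d \<Longrightarrow> xi d ^ d = 1"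
  by (simp add: xi_power)

context coltab
begin

text \<open>The image of \<open>cas uu\<close>, as this operator is idempotent up to the nonzero
  factor \<open>cc uu\<close>; written as an equation because that specializes to the one in
  \<open>specht_iff\<close>.\<close>

definition V :: "(word \<Rightarrow> Cu) set" where
  "V = {v. cas uu v = (\<lambda>t. cc uu * v t)}"

lemma subsp_V: "subsp V"
  unfolding subsp_def V_def
  by (simp add: lin_op_0[OF lin_op_cas] lin_op_add[OF lin_op_cas] lin_op_scale[OF lin_op_cas] fun_eq_iff algebra_simps)

lemma specht_eq: "specht n lam = {v. cas 1 v = (\<lambda>t. cc 1 * v t)}"
  using specht_iff by blast

lemma subsp_specht: "subsp (specht n lam)"
  unfolding subsp_def specht_eq
  by (simp add: lin_op_0[OF lin_op_cas] lin_op_add[OF lin_op_cas] lin_op_scale[OF lin_op_cas] fun_eq_iff algebra_simps)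

lemma V_support: "v \<in> V \<Longrightarrow> t \<notin> TB \<Longrightarrow> v t = 0"
  using cas_support[of t uu v] cc_uu_neq_0 unfolding V_def by simp

lemma specht_support: "v \<in> specht n lam \<Longrightarrow> t \<notin> TB \<Longrightarrow> v t = 0"
  using cas_support[of t 1 v] cc_one_neq_0 unfolding specht_iff by simp

lemma gop_V: "i \<in> {1..<n} \<Longrightarrow> v \<in> V \<Longrightarrow> gop uu i v \<in> V"
  unfolding V_def using gop_cas[of i uu v, symmetric] uu_neq by (simp add: lin_op_scale[OF lin_op_gop])

lemma tchar_V: "v \<in> V \<Longrightarrow> tchar x j v \<in> V"
  unfolding V_def using tchar_cas[of x j uu v, symmetric] lin_op_scale[OF lin_op_mulw] by (simp add: tchar_def)

lemma cas_V: "cas uu v \<in> V"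
  unfolding V_def using cas_cas[of uu v] uu_neq by simp

lemma z_V: "z uu \<in> V"
  unfolding V_def using cas_z[of uu] uu_neq by simp

lemma V_reduction: "v \<in> V \<Longrightarrow> (\<And>t. spec (v t) (w t)) \<Longrightarrow> w \<in> specht n lam"
proof -
  assume v: "v \<in> V" and s: "\<And>t. spec (v t) (w t)"
  have "cas 1 w t = cc 1 * w t" for t
  proof (rule spec_unique)
    show "spec (cas uu v t) (cas 1 w t)" by (rule spec_cas[OF s])
    show "spec (cas uu v t) (cc 1 * w t)" using v spec_mult[OF spec_cc s] unfolding V_def by simp
  qed
  then show "w \<in> specht n lam" unfolding specht_iff by blast
qed

text \<open>One set of pivots serves both modules; so the dimensions agree, and matrices can be
  compared entry by entry.\<close>

lemma ex_compatible_bases: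
  obtains P x y where "finite P" "\<And>p. p \<in> P \<Longrightarrow> x p \<in> V" "\<And>p. p \<in> P \<Longrightarrow> y p \<in> specht n lam"
    "\<And>p t. p \<in> P \<Longrightarrow> spec (x p t) (y p t)"
    "\<And>p p'. p \<in> P \<Longrightarrow> p' \<in> P \<Longrightarrow> x p p' = (if p = p' then 1 else 0)"
    "\<And>p p'. p \<in> P \<Longrightarrow> p' \<in> P \<Longrightarrow> y p p' = (if p = p' then 1 else 0)"
    "\<And>v. v \<in> V \<Longrightarrow> v = (\<lambda>t. \<Sum>p\<in>P. v p * x p t)"
    "\<And>v. v \<in> specht n lam \<Longrightarrow> v = (\<lambda>t. \<Sum>p\<in>P. v p * y p t)"
proof -
  have det: "v = (\<lambda>_. 0)" if "v \<in> specht n lam" "\<forall>b\<in>TB. v b = 0" for v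
    using specht_support[OF that(1)] that(2) by (intro ext) blast
  obtain P y where P: "P \<subseteq> TB" and yS: "\<forall>p\<in>P. y p \<in> specht n lam"
    and y\<delta>: "\<forall>p\<in>P. \<forall>p'\<in>P. y p p' = (if p = p' then 1 else 0)"
    and yex: "\<forall>v\<in>specht n lam. v = (\<lambda>t. \<Sum>p\<in>P. v p * y p t)"
    using ex_echelon_basis[OF finite_TB subsp_specht det] by blast
  have finP: "finite P" using P finite_TB by (rule finite_subset)
  \<comment> \<open>The constant lift of \<open>y p\<close> need not lie in \<open>V\<close>. The
    operator \<open>cas uu\<close> divided by \<open>cc uu\<close> puts it there, and the value at 1
    is still \<open>y p\<close> because \<open>y p\<close> is an eigenvector at parameter 1.\<close>
  define v where "v p = (\<lambda>t. inverse (cc uu) * cas uu (\<lambda>t. emb (y p t)) t)" for p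
  have vV: "v p \<in> V" for p unfolding v_def by (rule subsp_scale[OF subsp_V cas_V])
  have vs: "spec (v p t) (y p t)" if "p \<in> P" for p t
  proof -
    have "spec (v p t) (inverse (cc 1) * cas 1 (y p) t)"
      unfolding v_def by (intro spec_mult spec_inverse spec_cc spec_cas spec_emb cc_one_neq_0)
    moreover have "cas 1 (y p) t = cc 1 * y p t" using yS that unfolding specht_iff by simp
    ultimately show ?thesis using cc_one_neq_0 by (simp add: mult.assoc[symmetric])
  qed
  obtain x where x: "\<forall>p\<in>P. x p \<in> V \<and> (\<forall>t. spec (x p t) (y p t)) \<and> (\<forall>p'\<in>P. x p p' = (if p = p' then 1 else 0))"
    using lift_dual_basis[where v = v and y = y, OF finP subsp_V vV vs] y\<delta> by blast
  \<comment> \<open>This yields spanning: a nonzero \<open>u\<close> vanishing on the pivots, scaled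
    to be primitive, would reduce to a nonzero Specht vector vanishing on the pivots.\<close>
  have inj: "u = (\<lambda>_. 0)" if u: "u \<in> V" "\<forall>p\<in>P. u p = 0" for u
  proof (rule ccontr)
    assume "u \<noteq> (\<lambda>_. 0)"
    then obtain t1 where t1: "u t1 \<noteq> 0" by blast
    then have "t1 \<in> TB" using V_support[OF u(1)] by blast
    from primitive_scaling[of TB t1 u, OF finite_TB this t1]
    obtain s t2 where s: "t2 \<in> TB" "s * u t2 = 1" "\<forall>t\<in>TB. \<exists>c. spec (s * u t) c" by blast
    define w where "w t = eval_at_1 (s * u t)" for t
    have sw: "spec (s * u t) (w t)" for t
    proof (cases "t \<in> TB")
      case True
      then obtain c where "spec (s * u t) c" using s(3) by blast
      then show ?thesis using eval_at_1_eqI unfolding w_def by blast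
    next
      case False
      then have "s * u t = 0" using V_support[OF u(1)] by simp
      then show ?thesis by (simp only: w_def eval_at_1_eqI[OF spec_0] spec_0)
    qed
    have "w \<in> specht n lam" by (rule V_reduction[OF subsp_scale[OF subsp_V u(1)] sw])
    then have "w = (\<lambda>t. \<Sum>p\<in>P. w p * y p t)" using yex by blast
    then have "w t2 = (\<Sum>p\<in>P. w p * y p t2)" by (rule fun_cong)
    moreover have "w p = 0" if "p \<in> P" for p
      using u(2) that eval_at_1_eqI[OF spec_0] by (simp add: w_def)
    ultimately have "w t2 = 0" by simp
    moreover have "w t2 = 1" using s(2) eval_at_1_eqI[OF spec_1] by (simp add: w_def)
    ultimately show False by simp
  qed
  have xex: "u = (\<lambda>t. \<Sum>p\<in>P. u p * x p t)" if u: "u \<in> V" for u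
  proof -
    let ?w = "\<lambda>t. u t - 1 * (\<Sum>p\<in>P. u p * x p t)"
    have "?w = (\<lambda>_. 0)"
    proof (rule inj)
      show "?w \<in> V" using u x subsp_V by (intro subsp_diff subsp_sum) simp_all
      show "\<forall>p\<in>P. ?w p = 0"
      proof
        fix p assume p: "p \<in> P"
        have "(\<Sum>p'\<in>P. u p' * x p' p) = (\<Sum>p'\<in>P. if p' = p then u p' else 0)"
          using x p by (intro sum.cong) simp_all
        then show "?w p = 0" using p finP by simp
      qed
    qed
    note w0 = fun_cong[OF this]
    show ?thesis
    proof
      fix t
      show "u t = (\<Sum>p\<in>P. u p * x p t)" using w0[of t] unfolding mult_1 right_minus_eq .
    qed
  qed
  show ?thesis
  proof (rule that[of P x y])
    show "u = (\<lambda>t. \<Sum>p\<in>P. u p * x p t)" if "u \<in> V" for u by (rule xex[OF that])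
    show "u = (\<lambda>t. \<Sum>p\<in>P. u p * y p t)" if "u \<in> specht n lam" for u by (rule bspec[OF yex that])
  qed (use finP x yS y\<delta> in simp_all)
qed

section \<open>Irreducibility over the field of rational functions\<close>

definition colperms :: "(nat \<Rightarrow> nat) set" where
  "colperms = {p. p permutes {1..n} \<and> (\<forall>j. col (p j) = col j)}"

lemma finite_colperms: "finite colperms"
  unfolding colperms_def by (rule finite_subset[OF _ finite_perms[of n]]) blast

lemma colperms_sgen: "i \<in> {1..<n} \<Longrightarrow> col i = col (Suc i) \<Longrightarrow> p \<in> colperms \<Longrightarrow> p \<circ> sgen i \<in> colperms"
  unfolding colperms_def using permutes_comp_sgen[of p n i] col_sgen[of i] by simp

text \<open>Columns are intervals of numbers preserved by \<open>r\<close>, so values increase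
  across a column boundary. Hence reduced words of column permutations use column generators
  only.\<close>

lemma colperms_descent:
  assumes r: "r \<in> colperms" and i: "i \<in> {1..<n}" and desc: "r (Suc i) < r i"
  shows "col i = col (Suc i)"
proof (rule ccontr)
  assume ne: "col i \<noteq> col (Suc i)"
  have perm: "r permutes {1..n}" and c: "\<And>j. col (r j) = col j" using r unfolding colperms_def by blast+
  have m: "r i \<in> {1..n}" "r (Suc i) \<in> {1..n}"
    using permutes_in_image[OF perm] i by auto
  show False
  proof (cases "r i \<le> i")
    case True
    then have "col i = col (r (Suc i))" using desc m i c by (intro col_between[of "r (Suc i)" i "Suc i"]) auto
    then show False using c ne by simp
  next
    case False
    show False
    proof (cases "r i = Suc i")
      case True
      then show False using c[of i] ne by simp
    next
      case n: False
      then have "col (Suc i) = col i" using False m i c by (intro col_between[of i "Suc i" "r i"]) auto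
      then show False using ne by simp
    qed
  qed
qed

lemma \<gamma>_colperms:
  assumes "p \<in> colperms" shows "\<gamma> \<circ> p = \<gamma>"
proof
  fix j
  have perm: "p permutes {1..n}" and c: "col (p j) = col j" using assms unfolding colperms_def by blast+
  show "(\<gamma> \<circ> p) j = \<gamma> j"
  proof (cases "j \<in> {1..n}")
    case True
    then have "p j \<in> {1..n}" using permutes_in_image[OF perm] by blast
    then show ?thesis using \<gamma>_eq[OF True] \<gamma>_eq[of "p j"] c by simp
  next
    case False
    then show ?thesis using permutes_not_in[OF perm] by simp
  qed
qed

lemma weight_of_TB:
  assumes "t \<in> TB" "\<And>j. j \<in> {1..n} \<Longrightarrow> fst (t j) = \<gamma> j" shows "fst \<circ> t = \<gamma>"
proof
  fix j
  show "(fst \<circ> t) j = \<gamma> j"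
    using assms(2)[of j] TB_outside[OF assms(1), of j] TB_outside[OF t0_TB, of j] unfolding \<gamma>_def
    by (cases "j \<in> {1..n}") simp_all
qed

text \<open>It suffices that \<open>z uu\<close> lies in \<open>U\<close>: then \<open>U\<close>
  contains all values of \<open>Fop uu p\<close>, hence the image of \<open>cas uu\<close>. A vector
  of \<open>U\<close> not killed by \<open>ell\<close> is brought into the line of
  \<open>z uu\<close> by projecting to weight \<open>\<gamma>\<close> and antisymmetrizing over the
  columns; \<open>ell\<close> stays nonzero throughout.\<close>

lemma V_irreducible:
  assumes U: "U \<subseteq> V" "subsp U" and Ug: "\<And>i v. i \<in> {1..<n} \<Longrightarrow> v \<in> U \<Longrightarrow> gop uu i v \<in> U"
    and Ut: "\<And>j v. j \<in> {1..n} \<Longrightarrow> v \<in> U \<Longrightarrow> tchar (emb (xi d)) j v \<in> U"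
    and nz: "v0 \<in> U" "v0 \<noteq> (\<lambda>_. 0)"
  shows "V \<subseteq> U"
proof -
  let ?x = "emb (xi d)"
  \<comment> \<open>If \<open>ell\<close> vanished on the stable space \<open>U\<close>, so would
    every \<open>Fop uu p\<close> and then \<open>cas uu\<close>, which acts on \<open>U\<close> by
    the nonzero scalar \<open>cc uu\<close>.\<close>
  have "\<exists>y\<in>U. ell y \<noteq> 0"
  proof (rule ccontr)
    assume "\<not> (\<exists>y\<in>U. ell y \<noteq> 0)"
    then have l0: "ell y = 0" if "y \<in> U" for y using that by blast
    have F0: "Fop uu p v = (\<lambda>_. 0)" if "p permutes {1..n}" "v \<in> U" for p v
      using that
    proof (induction arbitrary: v rule: permutes_ascent_induct)
      case id
      show ?case unfolding Fop_id theta_def using l0[OF id] by simp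
    next
      case (step p i)
      show ?case unfolding Fop_step[OF step(1-3)] step(4)[OF Ug[OF step(2) step(5)]]
        by (rule lin_op_0[OF lin_op_gop])
    qed
    have "cas uu v0 = (\<lambda>_. 0)" unfolding cas_def using F0[OF _ nz(1)] by simp
    moreover have "v0 \<in> V" using nz(1) U(1) by blast
    ultimately have "(\<lambda>t. cc uu * v0 t) = (\<lambda>_. 0)" unfolding V_def by simp
    then have "cc uu * v0 t = 0" for t by (rule fun_cong)
    then have "v0 = (\<lambda>_. 0)" using cc_uu_neq_0 by (intro ext) simp
    then show False using nz(2) by simp
  qed
  then obtain y where y: "y \<in> U" "ell y \<noteq> 0" by blast
  have proj: "mulw (\<lambda>w. \<Prod>(j, k)\<in>A. ?x ^ w j - ?x ^ k) y \<in> U" if "finite A" "A \<subseteq> {1..n} \<times> UNIV" for A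
    using that
  proof (induction A rule: finite_induct)
    case empty
    then show ?case using y by (simp add: mulw_def)
  next
    case (insert a A)
    obtain j k where a: "a = (j, k)" by (cases a)
    let ?u = "mulw (\<lambda>w. \<Prod>(j, k)\<in>A. ?x ^ w j - ?x ^ k) y"
    have u: "?u \<in> U" using insert by simp
    have "mulw (\<lambda>w. \<Prod>(j, k)\<in>insert a A. ?x ^ w j - ?x ^ k) y = (\<lambda>t. tchar ?x j ?u t - ?x ^ k * ?u t)"
      using insert.hyps a by (simp add: tchar_def mulw_def fun_eq_iff algebra_simps)
    also have "\<dots> \<in> U" using Ut[OF _ u, of j] u insert.prems a by (intro subsp_diff[OF U(2)]) simp_all
    finally show ?case .
  qed
  \<comment> \<open>Lagrange interpolation in the \<open>t_j\<close>: one factor for each position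
    and each wrong component below \<open>d\<close>. On words of \<open>TB\<close> the product
    vanishes unless the weight is \<open>\<gamma>\<close>.\<close>
  define A where "A = {(j, k). j \<in> {1..n} \<and> k < d \<and> k \<noteq> \<gamma> j}"
  define M where "M w = (\<Prod>(j, k)\<in>A. ?x ^ w j - ?x ^ k)" for w :: "nat \<Rightarrow> nat"
  define y' where "y' = mulw M y"
  have finA: "finite A" by (rule finite_subset[of _ "{1..n} \<times> {..<d}"]) (auto simp: A_def)
  have y'U: "y' \<in> U" unfolding y'_def M_def using finA by (rule proj) (auto simp: A_def)
  have xinj: "?x ^ a = ?x ^ b \<longleftrightarrow> a = b" if "a < d" "b < d" for a b
    unfolding emb_power[symmetric] emb_inj using xi_power_inj[OF that] by blast
  have "M \<gamma> \<noteq> 0"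
  proof -
    have nz: "?x ^ \<gamma> j - ?x ^ k \<noteq> 0" if "(j, k) \<in> A" for j k
    proof -
      have "j \<in> {1..n}" "k < d" "k \<noteq> \<gamma> j" using that by (simp_all add: A_def)
      then show ?thesis using xinj[of "\<gamma> j" k] \<gamma>_less[of j] by simp
    qed
    have "(case a of (j, k) \<Rightarrow> ?x ^ \<gamma> j - ?x ^ k) \<noteq> 0" if "a \<in> A" for a
      using nz[of "fst a" "snd a"] that by (simp add: case_prod_beta)
    then show ?thesis unfolding M_def using prod_zero_iff[OF finA] by blast
  qed
  then have ly': "ell y' \<noteq> 0" using y(2) by (simp add: y'_def ell_mulw)
  have y'w: "t \<in> TB \<and> fst \<circ> t = \<gamma>" if "y' t \<noteq> 0" for t
  proof -
    have t: "t \<in> TB" using V_support y'U U(1) that by blast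
    have M0: "M (fst \<circ> t) \<noteq> 0" using that by (simp add: y'_def mulw_def)
    have fac: "?x ^ fst (t j) - ?x ^ k \<noteq> 0" if jk: "(j, k) \<in> A" for j k
    proof
      assume "?x ^ fst (t j) - ?x ^ k = 0"
      then have "(case (j, k) of (j, k) \<Rightarrow> ?x ^ (fst \<circ> t) j - ?x ^ k) = 0" by simp
      then have "M (fst \<circ> t) = 0" unfolding M_def by (intro prod_zero[OF finA] bexI[OF _ jk])
      then show False using M0 by simp
    qed
    have "fst (t j) = \<gamma> j" if j: "j \<in> {1..n}" for j
    proof (rule ccontr)
      assume "fst (t j) \<noteq> \<gamma> j"
      then have "(j, fst (t j)) \<in> A" using j TB_fst_less[OF t j] by (simp add: A_def)
      from fac[OF this] show False by simp
    qed
    then show ?thesis using weight_of_TB[OF t] t by blast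
  qed
  define G where "G = perm_family n (gop uu) y'"
  have G_id: "G id = y'" unfolding G_def
    by (rule perm_family_id, erule gop_commute, rule gop_braid)
  have G_step: "G (p \<circ> sgen i) = gop uu i (G p)" if "p permutes {1..n}" "i \<in> {1..<n}" "p i < p (Suc i)" for p i
    unfolding G_def by (rule perm_family_step[OF _ _ that], erule gop_commute, rule gop_braid)
  have GU: "p permutes {1..n} \<Longrightarrow> G p \<in> U" for p
  proof (induction rule: permutes_ascent_induct)
    case id
    show ?case unfolding G_id by (rule y'U)
  next
    case (step p i)
    show ?case unfolding G_step[OF step(1-3)] by (rule Ug[OF step(2) step(4)])
  qed
  have Gw: "p permutes {1..n} \<Longrightarrow> mulw N (G p) = (\<lambda>t. N (\<gamma> \<circ> p) * G p t)" for p N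
  proof (induction arbitrary: N rule: permutes_ascent_induct)
    case id
    have "mulw N y' = (\<lambda>t. N (\<gamma> \<circ> id) * y' t)"
    proof
      fix t
      show "mulw N y' t = N (\<gamma> \<circ> id) * y' t" using y'w[of t] by (cases "y' t = 0") (simp_all add: mulw_def)
    qed
    then show ?case unfolding G_id .
  next
    case (step p i)
    have X: "mulw N (gop uu i X) = gop uu i (mulw (\<lambda>w. N (w \<circ> sgen i)) X)" for X
      unfolding gop_mulw by simp
    have "mulw N (G (p \<circ> sgen i)) = (\<lambda>t. N (\<gamma> \<circ> (p \<circ> sgen i)) * G (p \<circ> sgen i) t)"
      unfolding G_step[OF step(1-3)] X step(4) lin_op_scale[OF lin_op_gop] by (simp add: comp_assoc)
    then show ?case .
  qed
  define k where "k p = card (invs n (\<lambda>_ _. True) (\<lambda>a b. b < a) p)" for p :: "nat \<Rightarrow> nat"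
  have k_step: "k (p \<circ> sgen i) = Suc (k p)" if "i \<in> {1..<n}" "p i < p (Suc i)" for p i
    unfolding k_def using that by (subst card_invs_comp_sgen) auto
  \<comment> \<open>The Hecke antisymmetrizer of the column group applied to \<open>y'\<close>; the
    factor \<open>- (1 / uu)\<close> per inversion is what turns the quadratic relation into
    eigenvalue \<open>-1\<close>.\<close>
  define f where "f t = (\<Sum>p\<in>colperms. (- (1 / uu)) ^ k p * G p t)" for t
  have fU: "f \<in> U"
  proof -
    have "(\<lambda>t. \<Sum>p\<in>colperms. (- (1 / uu)) ^ k p * G p t) \<in> U"
      using GU by (intro subsp_sum[OF U(2)]) (simp add: colperms_def)
    then show ?thesis unfolding f_def .
  qed
  have fw: "t \<in> TB \<and> fst \<circ> t = \<gamma>" if "f t \<noteq> 0" for t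
  proof -
    let ?N = "\<lambda>w. if w = \<gamma> then 1 else (0::Cu)"
    have "?N (fst \<circ> t) * f t = (\<Sum>p\<in>colperms. (- (1 / uu)) ^ k p * mulw ?N (G p) t)"
      by (simp add: f_def mulw_def)
    also have "\<dots> = f t" unfolding f_def
    proof (rule sum.cong[OF refl])
      fix p assume p: "p \<in> colperms"
      then have "mulw ?N (G p) t = G p t" using Gw[of p ?N] \<gamma>_colperms[OF p] by (simp add: colperms_def)
      then show "(- (1 / uu)) ^ k p * mulw ?N (G p) t = (- (1 / uu)) ^ k p * G p t" by simp
    qed
    finally have "fst \<circ> t = \<gamma>" using that by (simp split: if_splits)
    moreover have "t \<in> TB" using V_support fU U(1) that by blast
    ultimately show ?thesis by blast
  qed
  have fa: "gop uu i f = (\<lambda>t. - f t)" if i: "i \<in> {1..<n}" "col i = col (Suc i)" for i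
  proof
    fix t
    let ?c = "\<lambda>p. (- (1 / uu)) ^ k p"
    let ?A = "{p\<in>colperms. p i < p (Suc i)}"
    have split: "sum h colperms = (\<Sum>p\<in>?A. h p + h (p \<circ> sgen i))" for h :: "(nat \<Rightarrow> nat) \<Rightarrow> Cu"
    proof (rule sum_ascents[OF finite_colperms])
      show "p \<circ> sgen i \<in> colperms" if "p \<in> colperms" for p using colperms_sgen[OF i that] .
      show "p i \<noteq> p (Suc i)" if "p \<in> colperms" for p
        using that inj_eq[OF permutes_inj, of p "{1..n}" i "Suc i"] by (simp add: colperms_def)
    qed
    have "gop uu i (\<lambda>t. \<Sum>p\<in>colperms. ?c p * G p t) = (\<lambda>t. \<Sum>p\<in>colperms. gop uu i (\<lambda>t. ?c p * G p t) t)"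
      by (rule lin_op_sum[OF lin_op_gop])
    then have "gop uu i f t = (\<Sum>p\<in>colperms. ?c p * gop uu i (G p) t)"
      unfolding f_def by (simp add: lin_op_scale[OF lin_op_gop])
    also have "\<dots> = (\<Sum>p\<in>?A. ?c p * gop uu i (G p) t + ?c (p \<circ> sgen i) * gop uu i (G (p \<circ> sgen i)) t)"
      by (rule split)
    also have "\<dots> = (\<Sum>p\<in>?A. - (?c p * G p t + ?c (p \<circ> sgen i) * G (p \<circ> sgen i) t))"
    proof (rule sum.cong[OF refl])
      fix p assume "p \<in> ?A"
      then have p: "p \<in> colperms" and asc: "p i < p (Suc i)" by auto
      have perm: "p permutes {1..n}" using p by (simp add: colperms_def)
      have e1: "eop i (G p) = G p"
        unfolding eop_def Gw[OF perm] \<gamma>_colperms[OF p] using same_col_\<gamma>[OF i] by simp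
      have e2: "eop i (gop uu i (G p)) = gop uu i (G p)"
        unfolding gop_eop[symmetric] e1 ..
      have gg: "gop uu i (gop uu i (G p)) t = G p t + (uu - 1) * G p t + (uu - 1) * gop uu i (G p) t"
        unfolding gop_quadratic e1 e2 ..
      show "?c p * gop uu i (G p) t + ?c (p \<circ> sgen i) * gop uu i (G (p \<circ> sgen i)) t = - (?c p * G p t + ?c (p \<circ> sgen i) * G (p \<circ> sgen i) t)"
        unfolding G_step[OF perm i(1) asc] k_step[of i p, OF i(1) asc] gg power_Suc
        using uu_neq(1) by (simp add: field_simps)
    qed
    also have "\<dots> = - f t" unfolding sum_negf f_def split[of "\<lambda>p. ?c p * G p t"] ..
    finally show "gop uu i f t = - f t" .
  qed
  \<comment> \<open>The induction runs through all permutations, hence the implication; removing a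
    descent keeps a column permutation in the column group, and each column generator negates
    \<open>ell\<close>.\<close>
  have lG: "p permutes {1..n} \<Longrightarrow> p \<in> colperms \<longrightarrow> ell (G p) = (-1) ^ k p * ell y'" for p
  proof (induction rule: permutes_ascent_induct)
    case id
    have "invs n (\<lambda>_ _. True) (\<lambda>a b. b < a) id = {}" by (auto simp: invs_def)
    then have "k id = 0" by (simp add: k_def)
    then have "ell (G id) = (-1) ^ k id * ell y'" by (simp add: G_id)
    then show ?case by blast
  next
    case (step p i)
    have "ell (G (p \<circ> sgen i)) = (-1) ^ k (p \<circ> sgen i) * ell y'" if r: "p \<circ> sgen i \<in> colperms"
    proof -
      have c: "col i = col (Suc i)" by (rule colperms_descent[OF r step(2)]) (use step(3) in simp)
      have "p \<circ> sgen i \<circ> sgen i \<in> colperms" by (rule colperms_sgen[OF step(2) c r])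
      then have "ell (G p) = (-1) ^ k p * ell y'" using step(4) by simp
      then show ?thesis unfolding G_step[OF step(1-3)] ell_gop[OF step(2) c] k_step[of i p, OF step(2,3)] by simp
    qed
    then show ?case by blast
  qed
  have "ell f \<noteq> 0"
  proof -
    have "ell f = (\<Sum>p\<in>colperms. (- (1 / uu)) ^ k p * ell (G p))"
      unfolding f_def by (simp add: ell_sum ell_scale)
    also have "\<dots> = (\<Sum>p\<in>colperms. (1 / uu) ^ k p * ell y')"
    proof (rule sum.cong[OF refl])
      fix p assume p: "p \<in> colperms"
      then have "ell (G p) = (-1) ^ k p * ell y'" using lG by (simp add: colperms_def)
      then show "(- (1 / uu)) ^ k p * ell (G p) = (1 / uu) ^ k p * ell y'"
        by (simp add: mult.assoc[symmetric] power_mult_distrib[symmetric])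
    qed
    finally have e: "ell f = (\<Sum>p\<in>colperms. (1 / uu) ^ k p) * ell y'" by (simp add: sum_distrib_right)
    \<comment> \<open>The signs have cancelled and left the Poincare polynomial of the column group
      at \<open>1 / uu\<close>. Its value at 1 is the order of the group, so it is nonzero.\<close>
    have "spec (\<Sum>p\<in>colperms. (1 / uu) ^ k p) (\<Sum>p\<in>colperms. (1 / 1) ^ k p)"
      by (intro spec_sum spec_power spec_divide spec_1 spec_uu) simp
    moreover have "id \<in> colperms" by (simp add: colperms_def permutes_id)
    ultimately have "spec (\<Sum>p\<in>colperms. (1 / uu) ^ k p) (of_nat (card colperms))" "card colperms \<noteq> 0"
      using finite_colperms by (simp, auto)
    then have "(\<Sum>p\<in>colperms. (1 / uu) ^ k p) \<noteq> 0"
      by (intro spec_nonzero[of _ "of_nat (card colperms)"]) simp_all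
    then show ?thesis using e ly' by simp
  qed
  have f: "f = (\<lambda>t. f t0 * z uu t)"
    by (rule antisymmetric_multiple[OF uu_neq fw fa])
  have f0: "f t0 \<noteq> 0"
  proof
    assume "f t0 = 0"
    then have "f = (\<lambda>t. 0)" using f by simp
    then show False using \<open>ell f \<noteq> 0\<close> by (simp add: ell_def)
  qed
  have "(\<lambda>t. inverse (f t0) * f t) \<in> U" by (rule subsp_scale[OF U(2) fU])
  moreover have "(\<lambda>t. inverse (f t0) * f t) = z uu"
  proof
    fix t
    have "f t = f t0 * z uu t" by (rule fun_cong[OF f])
    then show "inverse (f t0) * f t = z uu t" using f0 by simp
  qed
  ultimately have zU: "z uu \<in> U" by simp
  have FU: "p permutes {1..n} \<Longrightarrow> Fop uu p v \<in> U" for p v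
  proof (induction arbitrary: v rule: permutes_ascent_induct)
    case id
    show ?case unfolding Fop_id theta_def by (rule subsp_scale[OF U(2) zU])
  next
    case (step p i)
    show ?case unfolding Fop_step[OF step(1-3)] by (rule Ug[OF step(2) step(4)])
  qed
  show "V \<subseteq> U"
  proof
    fix v assume v: "v \<in> V"
    have "cas uu v \<in> U" unfolding cas_def using FU by (intro subsp_sum[OF U(2)]) simp
    then have "(\<lambda>t. inverse (cc uu) * cas uu v t) \<in> U" by (rule subsp_scale[OF U(2)])
    moreover have "(\<lambda>t. inverse (cc uu) * cas uu v t) = v"
      using v cc_uu_neq_0 unfolding V_def by (simp add: mult.assoc[symmetric])
    ultimately show "v \<in> U" by simp
  qed
qed

end

section \<open>Matrices of the representation\<close>

lemma mat_eq_by_vec: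
  fixes A B :: "'a::field mat"
  assumes A: "A \<in> carrier_mat m m" and B: "B \<in> carrier_mat m m"
    and eq: "\<And>v. v \<in> carrier_vec m \<Longrightarrow> A *\<^sub>v v = B *\<^sub>v v"
  shows "A = B"
proof (rule eq_matI)
  fix a b assume ab: "a < dim_row B" "b < dim_col B"
  have entry: "(C *\<^sub>v unit_vec m b) $ a = C $$ (a, b)" if C: "C \<in> carrier_mat m m" for C :: "'a mat"
    using C ab B by (simp add: mult_mat_vec_def)
  show "A $$ (a, b) = B $$ (a, b)"
    using entry[OF A] entry[OF B] eq[of "unit_vec m b"] by simp
qed (use A B in auto)

text \<open>Coordinates are values at the words \<open>e a\<close>, so matrix entries are values of
  images of basis vectors; regularity and reduction then need no change of basis.\<close>

locale fbasis =
  fixes V :: "(word \<Rightarrow> 'a::field) set" and m :: nat and b :: "nat \<Rightarrow> word \<Rightarrow> 'a" and e :: "nat \<Rightarrow> word"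
  assumes sub: "subsp V" and b_V: "\<And>a. a < m \<Longrightarrow> b a \<in> V"
    and b_e: "\<And>a a'. a < m \<Longrightarrow> a' < m \<Longrightarrow> b a (e a') = (if a = a' then 1 else 0)"
    and expand: "\<And>v. v \<in> V \<Longrightarrow> v = (\<lambda>t. \<Sum>a<m. v (e a) * b a t)"
begin

definition iota :: "'a vec \<Rightarrow> word \<Rightarrow> 'a" where
  "iota v = (\<lambda>t. \<Sum>a<m. v $ a * b a t)"

definition mat_of :: "((word \<Rightarrow> 'a) \<Rightarrow> word \<Rightarrow> 'a) \<Rightarrow> 'a mat" where
  "mat_of F = mat m m (\<lambda>(i, j). F (b j) (e i))"

text \<open>Transfers operator identities to matrices; by \<open>represents_unique\<close> they need
  to hold only on \<open>V\<close>. This matters for \<open>e_i\<close>, whose two descriptions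
  agree on \<open>V\<close> but not on all functions.\<close>

definition represents :: "'a mat \<Rightarrow> ((word \<Rightarrow> 'a) \<Rightarrow> word \<Rightarrow> 'a) \<Rightarrow> bool" where
  "represents A F \<longleftrightarrow> A \<in> carrier_mat m m \<and> (\<forall>v\<in>carrier_vec m. iota (A *\<^sub>v v) = F (iota v))"

lemma representsD: "represents A F \<Longrightarrow> A \<in> carrier_mat m m"
  "represents A F \<Longrightarrow> v \<in> carrier_vec m \<Longrightarrow> iota (A *\<^sub>v v) = F (iota v)"
  by (simp_all add: represents_def)

lemma iota_V: "iota v \<in> V"
  unfolding iota_def by (intro subsp_sum[OF sub] b_V) simp

lemma iota_e: "a < m \<Longrightarrow> iota v (e a) = v $ a"
proof -
  assume a: "a < m"
  have "iota v (e a) = (\<Sum>a'<m. if a' = a then v $ a' else 0)"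
    unfolding iota_def using b_e a by (intro sum.cong) simp_all
  then show ?thesis using a by simp
qed

lemma iota_inj: "v \<in> carrier_vec m \<Longrightarrow> w \<in> carrier_vec m \<Longrightarrow> iota v = iota w \<Longrightarrow> v = w"
  by (rule eq_vecI) (use iota_e in \<open>metis carrier_vecD\<close>, simp)

lemma V_eqI: "v \<in> V \<Longrightarrow> w \<in> V \<Longrightarrow> (\<And>a. a < m \<Longrightarrow> v (e a) = w (e a)) \<Longrightarrow> v = w"
proof -
  assume a: "v \<in> V" "w \<in> V" "\<And>a. a < m \<Longrightarrow> v (e a) = w (e a)"
  have "(\<lambda>t. \<Sum>a<m. v (e a) * b a t) = (\<lambda>t. \<Sum>a<m. w (e a) * b a t)"
    using a(3) by (intro ext sum.cong) simp_all
  with expand[OF a(1)] expand[OF a(2)] show "v = w" by simp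
qed

lemma iota_surj: "u \<in> V \<Longrightarrow> iota (vec m (\<lambda>a. u (e a))) = u"
  by (rule V_eqI[OF iota_V]) (simp_all add: iota_e)

lemma iota_bij: "bij_betw iota (carrier_vec m) V"
  unfolding bij_betw_def
proof
  show "inj_on iota (carrier_vec m)" using iota_inj by (intro inj_onI)
  show "iota ` carrier_vec m = V"
  proof (intro equalityI subsetI)
    fix u assume "u \<in> V"
    then have "u = iota (vec m (\<lambda>a. u (e a)))" by (rule iota_surj[symmetric])
    then show "u \<in> iota ` carrier_vec m" by (rule image_eqI) simp
  qed (use iota_V in blast)
qed

lemma iota_add: "v \<in> carrier_vec m \<Longrightarrow> w \<in> carrier_vec m \<Longrightarrow> iota (v + w) = (\<lambda>t. iota v t + iota w t)"
  by (simp add: iota_def fun_eq_iff algebra_simps sum.distrib)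

lemma iota_scale: "v \<in> carrier_vec m \<Longrightarrow> iota (c \<cdot>\<^sub>v v) = (\<lambda>t. c * iota v t)"
  by (simp add: iota_def fun_eq_iff sum_distrib_left mult.assoc)

lemma iota_zero: "iota (0\<^sub>v m) = (\<lambda>_. 0)"
  by (simp add: iota_def)

lemma represents_mat_of:
  assumes F: "lin_op F" and FV: "\<And>v. v \<in> V \<Longrightarrow> F v \<in> V"
  shows "represents (mat_of F) F"
  unfolding represents_def
proof (intro conjI ballI)
  show "mat_of F \<in> carrier_mat m m" by (simp add: mat_of_def)
  fix v :: "'a vec" assume v: "v \<in> carrier_vec m"
  show "iota (mat_of F *\<^sub>v v) = F (iota v)"
  proof (rule V_eqI[OF iota_V FV[OF iota_V]])
    fix a assume a: "a < m"
    have "F (iota v) = (\<lambda>t. \<Sum>j<m. F (\<lambda>t. v $ j * b j t) t)"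
      unfolding iota_def by (rule lin_op_sum[OF F])
    then have "F (iota v) (e a) = (\<Sum>j<m. v $ j * F (b j) (e a))" by (simp add: lin_op_scale[OF F])
    moreover have "(mat_of F *\<^sub>v v) $ a = (\<Sum>j<m. v $ j * F (b j) (e a))"
      using v a by (simp add: mat_of_def scalar_prod_def atLeast0LessThan mult.commute)
    ultimately show "iota (mat_of F *\<^sub>v v) (e a) = F (iota v) (e a)" using iota_e[OF a] by simp
  qed
qed

lemma represents_mult:
  assumes "represents A F" "represents B G"
  shows "represents (A * B) (\<lambda>v. F (G v))"
proof -
  note A = representsD[OF assms(1)] and B = representsD[OF assms(2)]
  have "iota (A * B *\<^sub>v v) = F (G (iota v))" if v: "v \<in> carrier_vec m" for v
    using assoc_mult_mat_vec[OF A(1) B(1) v] A(2)[of "B *\<^sub>v v"] B(2)[OF v] mult_mat_vec_carrier[OF B(1) v] by simp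
  then show ?thesis using A(1) B(1) by (simp add: represents_def)
qed

lemma represents_add:
  assumes "represents A F" "represents B G"
  shows "represents (A + B) (\<lambda>v t. F v t + G v t)"
proof -
  note A = representsD[OF assms(1)] and B = representsD[OF assms(2)]
  have "iota ((A + B) *\<^sub>v v) = (\<lambda>t. F (iota v) t + G (iota v) t)" if v: "v \<in> carrier_vec m" for v
    using add_mult_distrib_mat_vec[OF A(1) B(1) v] A(2)[OF v] B(2)[OF v]
      iota_add[OF mult_mat_vec_carrier[OF A(1) v] mult_mat_vec_carrier[OF B(1) v]] by simp
  then show ?thesis using A(1) B(1) by (simp add: represents_def)
qed

lemma represents_smult:
  assumes "represents A F"
  shows "represents (c \<cdot>\<^sub>m A) (\<lambda>v t. c * F v t)"
proof -
  note A = representsD[OF assms(1)]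
  have "iota ((c \<cdot>\<^sub>m A) *\<^sub>v v) = (\<lambda>t. c * F (iota v) t)" if v: "v \<in> carrier_vec m" for v
  proof -
    have "(c \<cdot>\<^sub>m A) *\<^sub>v v = c \<cdot>\<^sub>v (A *\<^sub>v v)"
      using A(1) v by (intro eq_vecI) (simp_all add: scalar_prod_def sum_distrib_left mult.assoc)
    then show ?thesis using iota_scale[OF mult_mat_vec_carrier[OF A(1) v]] A(2)[OF v] by simp
  qed
  then show ?thesis using A(1) by (simp add: represents_def)
qed

lemma represents_one: "represents (1\<^sub>m m) (\<lambda>v. v)"
  by (simp add: represents_def)

lemma represents_zero: "represents (0\<^sub>m m m) (\<lambda>v t. 0)"
proof -
  have "0\<^sub>m m m *\<^sub>v v = 0\<^sub>v m" if "v \<in> carrier_vec m" for v :: "'a vec"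
    using that by (intro eq_vecI) (simp_all add: scalar_prod_def)
  then show ?thesis by (simp add: represents_def iota_zero)
qed

lemma represents_pow: "represents A F \<Longrightarrow> represents (A ^\<^sub>m k) (F ^^ k)"
proof (induction k)
  case 0
  then have "A ^\<^sub>m 0 = 1\<^sub>m m" using representsD(1)[OF 0] by simp
  then show ?case using represents_one by (simp add: id_def)
next
  case (Suc k)
  have "represents (A ^\<^sub>m k * A) (\<lambda>v. (F ^^ k) (F v))" using represents_mult Suc by blast
  then show ?case by (simp add: funpow_swap1 comp_def)
qed

lemma represents_matsum:
  "(\<And>k. k < N \<Longrightarrow> represents (f k) (F k)) \<Longrightarrow> represents (matsum m f N) (\<lambda>v t. \<Sum>k<N. F k v t)"
proof (induction N)
  case 0
  show ?case using represents_zero by simp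
next
  case (Suc N)
  have "represents (matsum m f N + f N) (\<lambda>v t. (\<Sum>k<N. F k v t) + F N v t)"
    using Suc by (intro represents_add) simp_all
  then show ?case by simp
qed

lemma represents_unique:
  assumes "represents A F" "represents B G" "\<And>v. v \<in> V \<Longrightarrow> F v = G v"
  shows "A = B"
proof (rule mat_eq_by_vec[OF representsD(1)[OF assms(1)] representsD(1)[OF assms(2)]])
  fix v :: "'a vec" assume v: "v \<in> carrier_vec m"
  show "A *\<^sub>v v = B *\<^sub>v v"
  proof (rule iota_inj)
    show "A *\<^sub>v v \<in> carrier_vec m" "B *\<^sub>v v \<in> carrier_vec m"
      using representsD(1)[OF assms(1)] representsD(1)[OF assms(2)] v by (auto intro: mult_mat_vec_carrier)
    show "iota (A *\<^sub>v v) = iota (B *\<^sub>v v)"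
      using representsD(2)[OF assms(1) v] representsD(2)[OF assms(2) v] assms(3)[OF iota_V] by simp
  qed
qed

end

text \<open>As \<open>x ^ d = 1\<close>, the exponent \<open>d - s\<close> stands for
  \<open>-s\<close> and a geometric sum with ratio \<open>x ^ a / x ^ b\<close> remains. A ratio
  different from 1 is still a \<open>d\<close>-th root of unity, so that sum vanishes.\<close>

lemma root_of_unity_sum:
  fixes x :: "'a::field"
  assumes x: "x ^ d = 1" and inj: "x ^ a = x ^ b \<Longrightarrow> a = b"
  shows "(\<Sum>s<d. x ^ (a * s) * x ^ (b * (d - s))) = (if a = b then of_nat d else 0)"
proof (cases "d = 0")
  case False
  have x0: "x \<noteq> 0" using x False power_0_left[of d, where 'a = 'a] by (cases "x = 0") simp_all
  have t: "x ^ (a * s) * x ^ (b * (d - s)) = (x ^ a / x ^ b) ^ s" if "s < d" for s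
  proof -
    have "x ^ (b * (d - s)) * x ^ (b * s) = x ^ (b * ((d - s) + s))"
      by (simp only: power_add distrib_left)
    also have "\<dots> = (x ^ d) ^ b" using that by (simp add: power_mult[symmetric] mult.commute)
    finally have "x ^ (b * (d - s)) * x ^ (b * s) = 1" using x by simp
    then have "x ^ (b * (d - s)) = 1 / x ^ (b * s)" using x0 by (simp add: field_simps)
    then show ?thesis by (simp add: power_divide power_mult)
  qed
  have s: "(\<Sum>s<d. x ^ (a * s) * x ^ (b * (d - s))) = (\<Sum>s<d. (x ^ a / x ^ b) ^ s)"
    by (rule sum.cong) (simp_all add: t)
  show ?thesis
  proof (cases "a = b")
    case True
    then show ?thesis unfolding s using x0 by simp
  next
    case ne: False
    have "x ^ a / x ^ b \<noteq> 1" using inj ne x0 by (simp add: field_simps) blast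
    moreover have "(x ^ a / x ^ b) ^ d = 1"
    proof -
      have "(x ^ a) ^ d = 1" "(x ^ b) ^ d = 1" using x by (simp_all add: power_mult[symmetric] mult.commute[of _ d] power_mult)
      then show ?thesis by (simp add: power_divide)
    qed
    ultimately show ?thesis unfolding s using ne by (simp add: geometric_sum)
  qed
qed simp

lemma tchar_pow: "(tchar x j ^^ k) v = mulw (\<lambda>w. x ^ (w j * k)) v"
  by (induction k) (simp_all add: tchar_def mulw_def fun_eq_iff power_add mult.assoc)

context coltab
begin

lemma ex_Y_rep:
  assumes d: "1 \<le> d"
  shows "\<exists>m G T. is_Y_rep d n uu m G T \<and> irreducible_rep n m G T \<and> specializes_to d n lam m G T"
proof -
  obtain P x y where fin: "finite P" and xV: "\<And>p. p \<in> P \<Longrightarrow> x p \<in> V"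
    and yS: "\<And>p. p \<in> P \<Longrightarrow> y p \<in> specht n lam"
    and xy: "\<And>p t. p \<in> P \<Longrightarrow> spec (x p t) (y p t)"
    and x\<delta>: "\<And>p p'. p \<in> P \<Longrightarrow> p' \<in> P \<Longrightarrow> x p p' = (if p = p' then 1 else 0)"
    and y\<delta>: "\<And>p p'. p \<in> P \<Longrightarrow> p' \<in> P \<Longrightarrow> y p p' = (if p = p' then 1 else 0)"
    and xex: "\<And>v. v \<in> V \<Longrightarrow> v = (\<lambda>t. \<Sum>p\<in>P. v p * x p t)"
    and yex: "\<And>v. v \<in> specht n lam \<Longrightarrow> v = (\<lambda>t. \<Sum>p\<in>P. v p * y p t)"
    by (rule ex_compatible_bases) blast
  define m where "m = card P"
  obtain e where e: "bij_betw e {..<m} P"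
    using ex_bij_betw_nat_finite[OF fin] unfolding m_def atLeast0LessThan by blast
  have eP: "e a \<in> P" if "a < m" for a using bij_betwE[OF e] that by blast
  have einj: "e a = e a' \<longleftrightarrow> a = a'" if "a < m" "a' < m" for a a'
    using bij_betw_imp_inj_on[OF e] that by (simp add: inj_on_eq_iff)
  interpret K: fbasis V m "\<lambda>a. x (e a)" e
  proof
    show "v = (\<lambda>t. \<Sum>a<m. v (e a) * x (e a) t)" if "v \<in> V" for v
      using xex[OF that] unfolding sum.reindex_bij_betw[OF e, symmetric] .
  qed (use subsp_V xV x\<delta> eP einj in simp_all)
  interpret C: fbasis "specht n lam" m "\<lambda>a. y (e a)" e
  proof
    show "v = (\<lambda>t. \<Sum>a<m. v (e a) * y (e a) t)" if "v \<in> specht n lam" for v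
      using yex[OF that] unfolding sum.reindex_bij_betw[OF e, symmetric] .
  qed (use subsp_specht yS y\<delta> eP einj in simp_all)
  let ?x = "emb (xi d)"
  define G where "G i = K.mat_of (gop uu i)" for i
  define T where "T j = K.mat_of (tchar ?x j)" for j
  have rG: "K.represents (G i) (gop uu i)" if "i \<in> {1..<n}" for i
    unfolding G_def using gop_V[OF that] by (intro K.represents_mat_of lin_op_gop)
  have rT: "K.represents (T j) (tchar ?x j)" for j
    unfolding T_def using tchar_V by (intro K.represents_mat_of) (simp_all add: tchar_def lin_op_mulw)
  have x1: "?x ^ d = 1" using xi_power_d[of d] d by (simp add: emb_power[symmetric])
  have re: "K.represents (e_mat d m T i) (\<lambda>v t. (1 / of_nat d) * (\<Sum>s<d. (tchar ?x i ^^ s) ((tchar ?x (Suc i) ^^ (d - s)) v) t))" for i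
    unfolding e_mat_def by (intro K.represents_smult K.represents_matsum K.represents_mult K.represents_pow rT)
  \<comment> \<open>Outside \<open>TB\<close> both sides vanish. On \<open>TB\<close> components are
    below \<open>d\<close>, where equal powers of the root of unity mean equal components.\<close>
  have eop_eq: "(\<lambda>t. (1 / of_nat d) * (\<Sum>s<d. (tchar ?x i ^^ s) ((tchar ?x (Suc i) ^^ (d - s)) v) t)) = eop i v"
    if v: "v \<in> V" and i: "i \<in> {1..<n}" for v i
  proof
    fix t
    show "(1 / of_nat d) * (\<Sum>s<d. (tchar ?x i ^^ s) ((tchar ?x (Suc i) ^^ (d - s)) v) t) = eop i v t"
    proof (cases "t \<in> TB")
      case False
      then show ?thesis using V_support[OF v] by (simp add: tchar_pow eop_def mulw_def)
    next
      case True
      have less: "fst (t i) < d" "fst (t (Suc i)) < d" using TB_fst_less[OF True] i by auto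
      have "(\<Sum>s<d. (tchar ?x i ^^ s) ((tchar ?x (Suc i) ^^ (d - s)) v) t) =
          (\<Sum>s<d. ?x ^ (fst (t i) * s) * ?x ^ (fst (t (Suc i)) * (d - s))) * v t"
        by (simp add: tchar_pow mulw_def sum_distrib_right mult.assoc)
      also have "(\<Sum>s<d. ?x ^ (fst (t i) * s) * ?x ^ (fst (t (Suc i)) * (d - s))) = (if fst (t i) = fst (t (Suc i)) then of_nat d else 0)"
        using xi_power_inj[OF less] by (intro root_of_unity_sum x1) (simp add: emb_power[symmetric] emb_inj)
      finally show ?thesis using of_nat_Cu_neq_0[of d] d by (simp add: eop_def mulw_def)
    qed
  qed
  have re': "K.represents (e_mat d m T i) (eop i)" if i: "i \<in> {1..<n}" for i
    using K.representsD[OF re] eop_eq[OF K.iota_V i] unfolding K.represents_def by simp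
  have "is_Y_rep d n uu m G T"
    unfolding is_Y_rep_def
  proof (intro conjI ballI allI impI)
    fix i assume i: "i \<in> {1..<n}"
    show "G i \<in> carrier_mat m m" by (rule K.representsD(1)[OF rG[OF i]])
    show "G i * G i = 1\<^sub>m m + (uu - 1) \<cdot>\<^sub>m e_mat d m T i + (uu - 1) \<cdot>\<^sub>m (e_mat d m T i * G i)"
      by (rule K.represents_unique[OF K.represents_mult[OF rG[OF i] rG[OF i]]
        K.represents_add[OF K.represents_add[OF K.represents_one K.represents_smult[OF re'[OF i]]]
          K.represents_smult[OF K.represents_mult[OF re'[OF i] rG[OF i]]]]])
        (rule gop_quadratic)
    fix j assume j: "j \<in> {1..n}"
    show "T j * G i = G i * T (sgen i j)"
      by (rule K.represents_unique[OF K.represents_mult[OF rT rG[OF i]] K.represents_mult[OF rG[OF i] rT]])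
        (rule tchar_gop)
  next
    fix j show "T j \<in> carrier_mat m m" by (rule K.representsD(1)[OF rT])
    show "T j ^\<^sub>m d = 1\<^sub>m m"
      by (rule K.represents_unique[OF K.represents_pow[OF rT] K.represents_one])
        (simp add: tchar_pow mulw_def x1 mult.commute[of _ d] power_mult)
    fix i show "T i * T j = T j * T i"
      by (rule K.represents_unique[OF K.represents_mult[OF rT rT] K.represents_mult[OF rT rT]])
        (simp add: tchar_def mulw_mulw mult.commute)
  next
    fix i j assume ij: "i \<in> {1..<n}" "j \<in> {1..<n}" "j + 1 < i \<or> i + 1 < j"
    show "G i * G j = G j * G i"
      by (rule K.represents_unique[OF K.represents_mult[OF rG[OF ij(1)] rG[OF ij(2)]] K.represents_mult[OF rG[OF ij(2)] rG[OF ij(1)]]])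
        (use ij(3) in \<open>elim disjE; simp add: gop_commute[of i j] gop_commute[of j i]\<close>)
  next
    fix i assume "1 \<le> i \<and> i + 2 \<le> n"
    then have i: "i \<in> {1..<n}" "Suc i \<in> {1..<n}" by auto
    show "G i * G (Suc i) * G i = G (Suc i) * G i * G (Suc i)"
      by (rule K.represents_unique[OF K.represents_mult[OF K.represents_mult[OF rG[OF i(1)] rG[OF i(2)]] rG[OF i(1)]]
            K.represents_mult[OF K.represents_mult[OF rG[OF i(2)] rG[OF i(1)]] rG[OF i(2)]]])
        (rule gop_braid)
  qed
  moreover have "irreducible_rep n m G T"
    unfolding irreducible_rep_def
  proof (intro conjI allI impI)
    show "0 < m"
    proof (rule ccontr)
      assume "\<not> 0 < m"
      then have "z uu t0 = 0" using fun_cong[OF K.expand[OF z_V], of t0] by simp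
      then show False by (simp add: z_t0)
    qed
    fix W assume W: "invariant_subspace n m G T W"
    have Wc: "W \<subseteq> carrier_vec m" and W0: "0\<^sub>v m \<in> W"
      and Wadd: "\<And>v w. v \<in> W \<Longrightarrow> w \<in> W \<Longrightarrow> v + w \<in> W" and Wsc: "\<And>v c. v \<in> W \<Longrightarrow> c \<cdot>\<^sub>v v \<in> W"
      and WG: "\<And>i v. i \<in> {1..<n} \<Longrightarrow> v \<in> W \<Longrightarrow> G i *\<^sub>v v \<in> W"
      and WT: "\<And>j v. j \<in> {1..n} \<Longrightarrow> v \<in> W \<Longrightarrow> T j *\<^sub>v v \<in> W"
      using W unfolding invariant_subspace_def by blast+
    show "W = {0\<^sub>v m} \<or> W = carrier_vec m"
    proof (cases "W = {0\<^sub>v m}")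
      case False
      then obtain w where w: "w \<in> W" "w \<noteq> 0\<^sub>v m" using W0 by blast
      let ?U = "K.iota ` W"
      have "V \<subseteq> ?U"
      proof (rule V_irreducible)
        show "?U \<subseteq> V" using K.iota_V by blast
        show "subsp ?U" unfolding subsp_def
        proof (intro conjI ballI allI)
          show "(\<lambda>_. 0) \<in> ?U" using W0 K.iota_zero by (metis imageI)
          fix f assume "f \<in> ?U"
          then obtain v where v: "v \<in> W" "f = K.iota v" by blast
          then have vc: "v \<in> carrier_vec m" using Wc by blast
          show "(\<lambda>t. c * f t) \<in> ?U" for c
            unfolding v(2) K.iota_scale[OF vc, symmetric] using Wsc[OF v(1)] by (rule imageI)
          fix g assume "g \<in> ?U"
          then obtain v' where v': "v' \<in> W" "g = K.iota v'" by blast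
          then have vc': "v' \<in> carrier_vec m" using Wc by blast
          show "(\<lambda>t. f t + g t) \<in> ?U"
            unfolding v(2) v'(2) K.iota_add[OF vc vc', symmetric] using Wadd[OF v(1) v'(1)] by (rule imageI)
        qed
        show "gop uu i f \<in> ?U" if i: "i \<in> {1..<n}" and f: "f \<in> ?U" for i f
        proof -
          obtain v where v: "v \<in> W" "f = K.iota v" using f by blast
          then have vc: "v \<in> carrier_vec m" using Wc by blast
          show ?thesis unfolding v(2) K.representsD(2)[OF rG[OF i] vc, symmetric] using WG[OF i v(1)] by (rule imageI)
        qed
        show "tchar ?x j f \<in> ?U" if j: "j \<in> {1..n}" and f: "f \<in> ?U" for j f
        proof -
          obtain v where v: "v \<in> W" "f = K.iota v" using f by blast
          then have vc: "v \<in> carrier_vec m" using Wc by blast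
          show ?thesis unfolding v(2) K.representsD(2)[OF rT vc, symmetric] using WT[OF j v(1)] by (rule imageI)
        qed
        show "K.iota w \<in> ?U" using w(1) by (rule imageI)
        show "K.iota w \<noteq> (\<lambda>_. 0)"
        proof
          assume "K.iota w = (\<lambda>_. 0)"
          then have "K.iota w = K.iota (0\<^sub>v m)" using K.iota_zero by simp
          then have "w = 0\<^sub>v m" using w(1) Wc by (intro K.iota_inj) auto
          then show False using w(2) by simp
        qed
      qed
      have "v \<in> W" if v: "v \<in> carrier_vec m" for v
      proof -
        have "K.iota v \<in> ?U" using \<open>V \<subseteq> ?U\<close> K.iota_V by blast
        then obtain w' where w': "w' \<in> W" "K.iota v = K.iota w'" by blast
        then have "v = w'" using v Wc by (intro K.iota_inj) auto
        then show ?thesis using w'(1) by simp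
      qed
      then show ?thesis using Wc by blast
    qed simp
  qed
  moreover have "specializes_to d n lam m G T"
  proof -
    \<comment> \<open>Both matrices are read off at the same pivots, so the specialization of basis
      vectors passes directly to the entries.\<close>
    have sG: "spec (G i $$ (a, c)) (C.mat_of (gop 1 i) $$ (a, c))" if "a < m" "c < m" for i a c
      using that unfolding G_def K.mat_of_def C.mat_of_def by (simp add: spec_gop xy eP)
    have sT: "spec (T j $$ (a, c)) (C.mat_of (tchar (xi d) j) $$ (a, c))" if "a < m" "c < m" for j a c
      using that unfolding T_def K.mat_of_def C.mat_of_def
      by (simp add: tchar_def mulw_def spec_mult spec_power spec_emb xy eP)
    have mG: "map_mat eval_at_1 (G i) = C.mat_of (gop 1 i)" for i
      by (rule eq_matI) (use sG eval_at_1_eqI in \<open>auto simp: G_def K.mat_of_def C.mat_of_def\<close>)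
    have mT: "map_mat eval_at_1 (T j) = C.mat_of (tchar (xi d) j)" for j
      by (rule eq_matI) (use sT eval_at_1_eqI in \<open>auto simp: T_def K.mat_of_def C.mat_of_def\<close>)
    have "C.represents (C.mat_of (gop 1 i)) (gop 1 i)" if i: "i \<in> {1..<n}" for i
    proof (rule C.represents_mat_of[OF lin_op_gop])
      show "gop 1 i v \<in> specht n lam" if "v \<in> specht n lam" for v
        using that gop_cas[OF i, of 1 v, symmetric] unfolding specht_iff by (simp add: lin_op_scale[OF lin_op_gop])
    qed
    moreover have "C.represents (C.mat_of (tchar (xi d) j)) (tchar (xi d) j)" for j
    proof (rule C.represents_mat_of)
      show "lin_op (tchar (xi d) j)" by (simp add: tchar_def lin_op_mulw)
      show "tchar (xi d) j v \<in> specht n lam" if "v \<in> specht n lam" for v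
        using that tchar_cas[of "xi d" j 1 v, symmetric] lin_op_scale[OF lin_op_mulw]
        unfolding specht_iff by (simp add: tchar_def)
    qed
    ultimately have "iso_to_specht d n lam m (\<lambda>i. map_mat eval_at_1 (G i)) (\<lambda>j. map_mat eval_at_1 (T j))"
      unfolding iso_to_specht_def mG mT
      using C.iota_bij C.iota_add C.iota_scale C.representsD(2)
      by (intro exI[of _ C.iota]) (simp add: gop_one tchar_xi)
    then show ?thesis unfolding specializes_to_def using sG sT spec_iff by blast
  qed
  ultimately show ?thesis by blast
qed

end

section \<open>The Temperley--Lieb element\<close>

text \<open>The Temperley--Lieb element at parameter 1: the sum over all permutations of the
  positions 1, 2, 3.\<close>

definition sym3 :: "(word \<Rightarrow> complex) \<Rightarrow> word \<Rightarrow> complex" where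
  "sym3 x t = x (t \<circ> sgen 1 \<circ> sgen 2 \<circ> sgen 1) + x (t \<circ> sgen 1 \<circ> sgen 2) + x (t \<circ> sgen 2 \<circ> sgen 1)
     + x (t \<circ> sgen 1) + x (t \<circ> sgen 2) + x t"

definition columns :: "nat list list \<Rightarrow> (nat \<times> nat) set" where
  "columns lam = (SIGMA k:{..<length lam}. {..<first_part (lam ! k)})"

lemma card_columns: "card (columns lam) = (\<Sum>k<length lam. first_part (lam ! k))"
  unfolding columns_def by simp

lemma finite_columns: "finite (columns lam)"
  unfolding columns_def by (intro finite_SigmaI) auto

lemma columns_iff:
  assumes "lam \<in> dpartitions d n"
  shows "(k, c) \<in> columns lam \<longleftrightarrow> (k, 0, c) \<in> boxes lam"
  by (cases "lam ! k") (auto simp: columns_def boxes_def first_part_def)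

lemma box_column:
  assumes "lam \<in> dpartitions d n" "x \<in> boxes lam"
  shows "(fst x, snd (snd x)) \<in> columns lam"
  using boxes_up[OF assms(1), of "fst x" "fst (snd x)" "snd (snd x)" 0] assms(2) columns_iff[OF assms(1)] by simp

lemma sgen_braid_comp: "t \<circ> sgen 1 \<circ> sgen 2 \<circ> sgen 1 = t \<circ> sgen 2 \<circ> sgen 1 \<circ> sgen 2"
  using sgen_braid[of 1] by (simp add: comp_assoc numeral_2_eq_2)

text \<open>The pigeonhole principle puts a transposition of two of 1, 2, 3 into the column
  stabilizer. It negates the polytabloid and splits the six terms into cancelling pairs.\<close>

lemma sym3_polytabloid_eq_0:
  assumes lam: "lam \<in> dpartitions d n" and n: "n \<ge> 3" and T: "T \<in> dtableaux n lam"
    and small: "(\<Sum>k<length lam. first_part (lam ! k)) \<le> 2"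
  shows "sym3 (polytabloid n T) t = 0"
proof -
  let ?c = "\<lambda>j. (fst (T j), snd (snd (T j)))"
  let ?x = "polytabloid n T"
  have "\<not> inj_on ?c {1, 2, 3}"
  proof
    assume "inj_on ?c {1, 2, 3}"
    then have "card (?c ` {1, 2, 3}) = 3" by (simp add: card_image)
    moreover have "?c ` {1, 2, 3} \<subseteq> columns lam"
      using box_column[OF lam dtableauxD(3)[OF T]] n by auto
    ultimately have "3 \<le> card (columns lam)" using card_mono[OF finite_columns] by metis
    then show False using card_columns[of lam] small by simp
  qed
  then have "?c 1 = ?c 2 \<or> ?c 2 = ?c 3 \<or> ?c 1 = ?c 3" by (auto simp: inj_on_def)
  then consider "?c 1 = ?c 2" | "?c 2 = ?c 3" | "?c 1 = ?c 3" by blast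
  then show ?thesis
  proof cases
    case 1
    have "sgen 1 \<in> col_stab n T" using 1 sgen_permutes[of 1 n] n
      by (simp add: col_stab_iff) (simp add: sgen_def numeral_2_eq_2)
    from polytabloid_col_stab[OF this] have s: "?x (\<sigma> \<circ> sgen 1) = - ?x \<sigma>" for \<sigma> by (simp add: sign_sgen)
    show ?thesis unfolding sym3_def s by simp
  next
    case 2
    have "sgen 2 \<in> col_stab n T" using 2 sgen_permutes[of 2 n] n
      by (simp add: col_stab_iff) (simp add: sgen_def numeral_2_eq_2 numeral_3_eq_3)
    from polytabloid_col_stab[OF this] have s: "?x (\<sigma> \<circ> sgen 2) = - ?x \<sigma>" for \<sigma> by (simp add: sign_sgen)
    \<comment> \<open>The longest element is respelled to end in \<open>sgen 2\<close>, the letter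
      that produces the sign.\<close>
    show ?thesis unfolding sym3_def sgen_braid_comp s by simp
  next
    case 3
    \<comment> \<open>The transposition of 1 and 3.\<close>
    let ?r = "sgen 1 \<circ> sgen 2 \<circ> sgen 1"
    have p: "sgen 1 permutes {1..n}" "sgen 2 permutes {1..n}" using sgen_permutes[of 1 n] sgen_permutes[of 2 n] n by simp_all
    have pr: "?r permutes {1..n}" using p by (intro permutes_compose)
    have "fst (T (?r j)) = fst (T j) \<and> snd (snd (T (?r j))) = snd (snd (T j))" for j
      using 3 by (simp add: sgen_def numeral_2_eq_2 numeral_3_eq_3)
    then have r: "?r \<in> col_stab n T" using pr by (simp add: col_stab_iff)
    have "sign ?r = -1"
      using permutation_of_permutes[OF p(1)] permutation_of_permutes[OF p(2)]
      by (simp add: sign_compose permutation_compose sign_sgen)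
    then have s: "?x (\<sigma> \<circ> sgen 1 \<circ> sgen 2 \<circ> sgen 1) = - ?x \<sigma>" for \<sigma>
      using polytabloid_col_stab[OF r, of \<sigma>] by (simp add: comp_assoc)
    have "?x (t \<circ> sgen 1 \<circ> sgen 2) = - ?x (t \<circ> sgen 2)"
      using s[of "t \<circ> sgen 2"] unfolding sgen_braid_comp by simp
    moreover have "?x (t \<circ> sgen 2 \<circ> sgen 1) = - ?x (t \<circ> sgen 1)"
      using s[of "t \<circ> sgen 1"] by simp
    ultimately show ?thesis unfolding sym3_def s by simp
  qed
qed

lemma sym3_specht_eq_0:
  assumes lam: "lam \<in> dpartitions d n" and n: "n \<ge> 3" and x: "x \<in> specht n lam"
    and small: "(\<Sum>k<length lam. first_part (lam ! k)) \<le> 2"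
  shows "sym3 x t = 0"
proof -
  obtain c where x: "x = (\<lambda>t. \<Sum>T\<in>dtableaux n lam. c T * polytabloid n T t)"
    using x by (auto simp: specht_def)
  have "sym3 x t = (\<Sum>T\<in>dtableaux n lam. c T * sym3 (polytabloid n T) t)"
    unfolding sym3_def x by (simp add: sum.distrib distrib_left)
  then show ?thesis using sym3_polytabloid_eq_0[OF lam n _ small] by simp
qed

lemma polytabloid_in_specht:
  assumes "T \<in> dtableaux n lam" shows "polytabloid n T \<in> specht n lam"
proof -
  have "polytabloid n T t = (\<Sum>S\<in>dtableaux n lam. (if S = T then 1 else 0) * polytabloid n S t)" for t
    using assms finite_dtableaux[of n lam] by (simp add: if_distrib[of "\<lambda>x. x * _"] cong: if_cong)
  then have "polytabloid n T = (\<lambda>t. \<Sum>S\<in>dtableaux n lam. (if S = T then 1 else 0) * polytabloid n S t)"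
    by (rule ext)
  then show ?thesis unfolding specht_def
    by (intro CollectI exI[of _ "\<lambda>S. if S = T then 1 else 0"] conjI TrueI)
qed

text \<open>Permuting numbers that stand in first rows changes no row index, so by
  \<open>polytabloid_row_equal\<close> all six terms at the tabloid of \<open>T\<close> are 0 or 1.
  The identity contributes 1 and nothing cancels, whichever components the columns belong
  to.\<close>

lemma ex_sym3_specht_neq_0:
  assumes lam: "lam \<in> dpartitions d n" and n: "n \<ge> 3"
    and large: "\<not> (\<Sum>k<length lam. first_part (lam ! k)) \<le> 2"
  shows "\<exists>x\<in>specht n lam. \<exists>t. sym3 x t \<noteq> 0"
proof -
  have "3 \<le> card (columns lam)" using large card_columns[of lam] by simp
  then obtain C where C: "C \<subseteq> columns lam" "card C = 3" by (meson obtain_subset_with_card_n)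
  then have finC: "finite C" using finite_columns finite_subset by blast
  define B where "B = (\<lambda>(k, c). (k, 0::nat, c)) ` C"
  have "inj_on (\<lambda>(k, c). (k, 0::nat, c)) C" by (auto simp: inj_on_def)
  then have cB: "card B = 3" unfolding B_def using C by (simp add: card_image)
  have Bb: "B \<subseteq> boxes lam" unfolding B_def using C(1) columns_iff[OF lam] by auto
  have B0: "fst (snd b) = 0" if "b \<in> B" for b using that unfolding B_def by auto
  have finB: "finite B" unfolding B_def using finC by simp
  obtain g where g: "bij_betw g {1..3::nat} B"
    using finite_same_card_bij[of "{1..3::nat}" B] finB cB by auto
  have "card ({1..n} - {1..3}) = card (boxes lam - B)"
    using Bb finB cB n card_boxes[OF lam] by (simp add: card_Diff_subset)
  then obtain h where h: "bij_betw h ({1..n} - {1..3}) (boxes lam - B)"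
    using finite_same_card_bij[of "{1..n} - {1..3}" "boxes lam - B"] finite_boxes by auto
  define T where "T j = (if j \<in> {1..3} then g j else if j \<in> {1..n} then h j else undefined)" for j
  have "bij_betw T {1..3} B" by (rule bij_betw_cong[THEN iffD1, OF _ g]) (simp add: T_def)
  moreover have "bij_betw T ({1..n} - {1..3}) (boxes lam - B)"
    by (rule bij_betw_cong[THEN iffD1, OF _ h]) (auto simp: T_def)
  ultimately have "bij_betw T ({1..3} \<union> ({1..n} - {1..3})) (B \<union> (boxes lam - B))"
    by (rule bij_betw_combine) auto
  moreover have "{1..3} \<union> ({1..n} - {1..3}) = {1..n}" "B \<union> (boxes lam - B) = boxes lam"
    using n Bb by auto
  ultimately have bij: "bij_betw T {1..n} (boxes lam)" by simp
  have "T \<in> {1..n} \<rightarrow>\<^sub>E boxes lam"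
  proof (rule PiE_I)
    show "T j \<in> boxes lam" if "j \<in> {1..n}" for j using bij_betwE[OF bij] that by blast
    show "T j = undefined" if "j \<notin> {1..n}" for j
    proof -
      have "j \<notin> {1..3}" using that n by auto
      then show ?thesis using that unfolding T_def by (simp only: if_False)
    qed
  qed
  then have T: "T \<in> dtableaux n lam" using bij unfolding dtableaux_def by blast
  have T0: "fst (snd (T j)) = 0" if "j \<in> {1..3}" for j
    using that bij_betwE[OF g] B0 by (simp add: T_def)
  have r: "fst (snd (T 1)) = 0" "fst (snd (T 2)) = 0" "fst (snd (T 3)) = 0" using T0 by simp_all
  have s: "fst (snd (T (sgen 1 j))) = fst (snd (T j))" "fst (snd (T (sgen 2 j))) = fst (snd (T j))" for j
    using r by (auto simp: sgen_def numeral_2_eq_2 numeral_3_eq_3)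
  let ?t = "tabloid_of n T" and ?x = "polytabloid n T"
  have p: "sgen 1 permutes {1..n}" "sgen 2 permutes {1..n}" using sgen_permutes[of 1 n] sgen_permutes[of 2 n] n by simp_all
  have val: "\<exists>c::nat. ?x (?t \<circ> w) = of_nat c" if w: "w permutes {1..n}" and "\<And>j. fst (snd (T (w j))) = fst (snd (T j))" for w
    using polytabloid_row_equal[OF T w that(2)] tabloid_of_comp[OF w, of T]
    by (cases "tabloid_of n (T \<circ> w) = ?t") (auto intro: exI[of _ 0] exI[of _ 1])
  have one: "?x ?t = 1" using polytabloid_row_equal[OF T permutes_id] by simp
  obtain c1 where c1: "?x (?t \<circ> (sgen 1 \<circ> sgen 2 \<circ> sgen 1)) = of_nat c1"
    using val[OF permutes_compose[OF p(1) permutes_compose[OF p(2) p(1)]]] s by auto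
  obtain c2 where c2: "?x (?t \<circ> (sgen 1 \<circ> sgen 2)) = of_nat c2"
    using val[OF permutes_compose[OF p(2) p(1)]] s by auto
  obtain c3 where c3: "?x (?t \<circ> (sgen 2 \<circ> sgen 1)) = of_nat c3"
    using val[OF permutes_compose[OF p(1) p(2)]] s by auto
  obtain c4 where c4: "?x (?t \<circ> sgen 1) = of_nat c4" using val[OF p(1)] s by auto
  obtain c5 where c5: "?x (?t \<circ> sgen 2) = of_nat c5" using val[OF p(2)] s by auto
  have "sym3 ?x ?t = of_nat (c1 + c2 + c3 + c4 + c5 + 1)"
    unfolding sym3_def using c1 c2 c3 c4 c5 one by (simp add: comp_assoc)
  then have "sym3 ?x ?t \<noteq> 0" by (simp only: of_nat_eq_0_iff)
  then show ?thesis using polytabloid_in_specht[OF T] by blast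
qed

definition TL_mat :: "nat \<Rightarrow> 'a::field mat \<Rightarrow> 'a mat \<Rightarrow> 'a mat" where
  "TL_mat m A B = A * B * A + A * B + B * A + A + B + 1\<^sub>m m"

lemma TL_mat_vec:
  fixes A B :: "'a::field mat"
  assumes A: "A \<in> carrier_mat m m" and B: "B \<in> carrier_mat m m" and w: "w \<in> carrier_vec m"
  shows "TL_mat m A B *\<^sub>v w = A *\<^sub>v (B *\<^sub>v (A *\<^sub>v w)) + A *\<^sub>v (B *\<^sub>v w) + B *\<^sub>v (A *\<^sub>v w) + A *\<^sub>v w + B *\<^sub>v w + w"
proof -
  have c: "A * B \<in> carrier_mat m m" "B * A \<in> carrier_mat m m" "A * B * A \<in> carrier_mat m m" using A B by auto
  show ?thesis unfolding TL_mat_def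
    using A B w c by (simp add: add_mult_distrib_mat_vec[of _ m m] assoc_mult_mat_vec[of _ m m _ m])
qed

text \<open>The relation reads \<open>A * A = 1 + c e (1 + A)\<close>. Hence \<open>A\<close> fixes
  \<open>(1 + A) p\<close> up to a term with factor \<open>c\<close>, which will be
  \<open>uu - 1\<close>.\<close>

lemma quadratic_eigen:
  fixes A e :: "'a::field mat"
  assumes A: "A \<in> carrier_mat m m" and e: "e \<in> carrier_mat m m" and p: "p \<in> carrier_vec m"
    and q: "A * A = 1\<^sub>m m + c \<cdot>\<^sub>m e + c \<cdot>\<^sub>m (e * A)"
  shows "A *\<^sub>v (p + A *\<^sub>v p) = (p + A *\<^sub>v p) + c \<cdot>\<^sub>v (e *\<^sub>v (p + A *\<^sub>v p))"
proof -
  have Ap: "A *\<^sub>v p \<in> carrier_vec m" using A p by simp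
  have sm: "(c \<cdot>\<^sub>m X) *\<^sub>v v = c \<cdot>\<^sub>v (X *\<^sub>v v)" if "X \<in> carrier_mat m m" "v \<in> carrier_vec m" for X v
    using that by (intro eq_vecI) (simp_all add: scalar_prod_def sum_distrib_left mult.assoc)
  have "A *\<^sub>v (A *\<^sub>v p) = (1\<^sub>m m + c \<cdot>\<^sub>m e + c \<cdot>\<^sub>m (e * A)) *\<^sub>v p"
    using assoc_mult_mat_vec[OF A A p] q by simp
  also have "\<dots> = p + c \<cdot>\<^sub>v (e *\<^sub>v p) + c \<cdot>\<^sub>v (e *\<^sub>v (A *\<^sub>v p))"
    using A e p by (simp add: add_mult_distrib_mat_vec[of _ m m] sm[of e] sm[of "e * A"] assoc_mult_mat_vec[of _ m m _ m])
  finally have AA: "A *\<^sub>v (A *\<^sub>v p) = p + c \<cdot>\<^sub>v (e *\<^sub>v p) + c \<cdot>\<^sub>v (e *\<^sub>v (A *\<^sub>v p))" .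
  have "A *\<^sub>v (p + A *\<^sub>v p) = A *\<^sub>v p + (p + c \<cdot>\<^sub>v (e *\<^sub>v p) + c \<cdot>\<^sub>v (e *\<^sub>v (A *\<^sub>v p)))"
    using mult_add_distrib_mat_vec[OF A p Ap] AA by simp
  also have "\<dots> = (p + A *\<^sub>v p) + c \<cdot>\<^sub>v (e *\<^sub>v p + e *\<^sub>v (A *\<^sub>v p))"
    using A e p Ap by (intro eq_vecI) (simp_all add: algebra_simps)
  also have "e *\<^sub>v p + e *\<^sub>v (A *\<^sub>v p) = e *\<^sub>v (p + A *\<^sub>v p)"
    using mult_add_distrib_mat_vec[OF e p Ap] by simp
  finally show ?thesis .
qed

text \<open>The element factors as \<open>(1 + g\<^sub>1)(1 + g\<^sub>2 + g\<^sub>2 g\<^sub>1)\<close>, and symmetrically by the braid relation.\<close>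
lemma TL_mat_eigen:
  fixes A B e f :: "'a::field mat"
  assumes A: "A \<in> carrier_mat m m" and B: "B \<in> carrier_mat m m" and e: "e \<in> carrier_mat m m" and f: "f \<in> carrier_mat m m"
    and w: "w \<in> carrier_vec m" and braid: "A * B * A = B * A * B"
    and qA: "A * A = 1\<^sub>m m + c \<cdot>\<^sub>m e + c \<cdot>\<^sub>m (e * A)"
    and qB: "B * B = 1\<^sub>m m + c \<cdot>\<^sub>m f + c \<cdot>\<^sub>m (f * B)"
  defines "u \<equiv> TL_mat m A B *\<^sub>v w"
  shows "A *\<^sub>v u = u + c \<cdot>\<^sub>v (e *\<^sub>v u)" "B *\<^sub>v u = u + c \<cdot>\<^sub>v (f *\<^sub>v u)"
proof -
  note car = mult_mat_vec_carrier[OF A] mult_mat_vec_carrier[OF B] w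
  have u: "u = A *\<^sub>v (B *\<^sub>v (A *\<^sub>v w)) + A *\<^sub>v (B *\<^sub>v w) + B *\<^sub>v (A *\<^sub>v w) + A *\<^sub>v w + B *\<^sub>v w + w"
    unfolding u_def by (rule TL_mat_vec[OF A B w])
  have dims: "dim_row A = m" "dim_row B = m" "dim_vec w = m" using A B w by auto
  define p where "p = w + B *\<^sub>v w + B *\<^sub>v (A *\<^sub>v w)"
  have p: "p \<in> carrier_vec m" unfolding p_def using car by simp
  have "A *\<^sub>v p = A *\<^sub>v w + A *\<^sub>v (B *\<^sub>v w) + A *\<^sub>v (B *\<^sub>v (A *\<^sub>v w))"
    unfolding p_def using car by (simp add: mult_add_distrib_mat_vec[OF A] assoc_add_vec[of _ m])
  then have "u = p + A *\<^sub>v p"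
    unfolding u p_def using dims by (intro eq_vecI) (simp_all del: index_mult_mat_vec)
  then show "A *\<^sub>v u = u + c \<cdot>\<^sub>v (e *\<^sub>v u)" using quadratic_eigen[OF A e p qA] by simp
  define p' where "p' = w + A *\<^sub>v w + A *\<^sub>v (B *\<^sub>v w)"
  have p': "p' \<in> carrier_vec m" unfolding p'_def using car by simp
  have br: "A *\<^sub>v (B *\<^sub>v (A *\<^sub>v w)) = B *\<^sub>v (A *\<^sub>v (B *\<^sub>v w))"
    using arg_cong[OF braid, of "\<lambda>X. X *\<^sub>v w"] A B w by (simp add: assoc_mult_mat_vec[of _ m m _ m])
  have "B *\<^sub>v p' = B *\<^sub>v w + B *\<^sub>v (A *\<^sub>v w) + B *\<^sub>v (A *\<^sub>v (B *\<^sub>v w))"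
    unfolding p'_def using car by (simp add: mult_add_distrib_mat_vec[OF B] assoc_add_vec[of _ m])
  then have "u = p' + B *\<^sub>v p'"
    unfolding u p'_def br using dims by (intro eq_vecI) (simp_all del: index_mult_mat_vec)
  then show "B *\<^sub>v u = u + c \<cdot>\<^sub>v (f *\<^sub>v u)" using quadratic_eigen[OF B f p' qB] by simp
qed

section \<open>Reduction of matrices and vectors at 1\<close>

definition reg_mat :: "nat \<Rightarrow> Cu mat \<Rightarrow> bool" where
  "reg_mat m A \<longleftrightarrow> A \<in> carrier_mat m m \<and> (\<forall>a<m. \<forall>b<m. regular_at_1 (A $$ (a, b)))"

lemma regular_iff: "regular_at_1 x \<longleftrightarrow> (\<exists>c. spec x c)"
  by (simp add: spec_iff)

lemma regular_spec: "regular_at_1 x \<Longrightarrow> spec x (eval_at_1 x)"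
  by (simp add: spec_iff)

lemma regular_sum: "(\<And>i. i \<in> I \<Longrightarrow> regular_at_1 (f i)) \<Longrightarrow> regular_at_1 (sum f I)"
  unfolding regular_iff[of "sum f I"] by (rule exI, rule spec_sum, rule regular_spec)

lemma regular_mult: "regular_at_1 x \<Longrightarrow> regular_at_1 y \<Longrightarrow> regular_at_1 (x * y)"
  unfolding regular_iff by (blast intro: spec_mult)

lemma regular_add: "regular_at_1 x \<Longrightarrow> regular_at_1 y \<Longrightarrow> regular_at_1 (x + y)"
  unfolding regular_iff by (blast intro: spec_add)

lemma regular_0: "regular_at_1 0" and regular_1: "regular_at_1 1"
  unfolding regular_iff using spec_0 spec_1 by blast+

lemma reg_mat_mult: "reg_mat m A \<Longrightarrow> reg_mat m B \<Longrightarrow> reg_mat m (A * B)"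
  unfolding reg_mat_def by (auto simp: scalar_prod_def intro!: regular_sum regular_mult)

lemma reg_mat_add: "reg_mat m A \<Longrightarrow> reg_mat m B \<Longrightarrow> reg_mat m (A + B)"
  unfolding reg_mat_def by (auto intro!: regular_add)

lemma reg_mat_smult: "regular_at_1 c \<Longrightarrow> reg_mat m A \<Longrightarrow> reg_mat m (c \<cdot>\<^sub>m A)"
  unfolding reg_mat_def by (auto intro!: regular_mult)

lemma reg_mat_pow: "reg_mat m A \<Longrightarrow> reg_mat m (A ^\<^sub>m k)"
proof (induction k)
  case 0
  then have "A \<in> carrier_mat m m" by (simp add: reg_mat_def)
  then show ?case by (auto simp: reg_mat_def regular_0 regular_1)
qed (simp add: reg_mat_mult)

lemma reg_mat_matsum: "(\<And>k. k < N \<Longrightarrow> reg_mat m (f k)) \<Longrightarrow> reg_mat m (matsum m f N)"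
proof (induction N)
  case 0
  show ?case by (simp add: reg_mat_def regular_0)
qed (simp add: reg_mat_add)

text \<open>The only denominator introduced is the constant \<open>d\<close>. Regularity of
  \<open>e_i\<close> is what makes \<open>(u - 1) e_i\<close> vanish at 1.\<close>

lemma reg_mat_e_mat:
  assumes "1 \<le> d" "reg_mat m (T i)" "reg_mat m (T (Suc i))"
  shows "reg_mat m (e_mat d m T i)"
proof -
  have "spec (1 / of_nat d) (1 / of_nat d)" using assms(1) by (intro spec_divide spec_1 spec_of_nat) simp
  then have "regular_at_1 (1 / of_nat d)" unfolding regular_iff by blast
  then show ?thesis unfolding e_mat_def
    using assms by (intro reg_mat_smult reg_mat_matsum reg_mat_mult reg_mat_pow)
qed

definition vspec :: "nat \<Rightarrow> Cu vec \<Rightarrow> complex vec \<Rightarrow> bool" where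
  "vspec m w w' \<longleftrightarrow> w \<in> carrier_vec m \<and> w' \<in> carrier_vec m \<and> (\<forall>a<m. spec (w $ a) (w' $ a))"

lemma vspec_unique:
  assumes "vspec m w x" "vspec m w y" shows "x = y"
proof (rule eq_vecI)
  have c: "dim_vec x = m" "dim_vec y = m"
    using assms unfolding vspec_def by (blast intro: carrier_vecD)+
  show "dim_vec x = dim_vec y" unfolding c ..
  fix a assume "a < dim_vec y"
  then have "a < m" unfolding c .
  then have "spec (w $ a) (x $ a)" "spec (w $ a) (y $ a)" using assms unfolding vspec_def by blast+
  then show "x $ a = y $ a" by (rule spec_unique)
qed

lemma vspecD:
  assumes "vspec m w w'"
  shows "w \<in> carrier_vec m" "w' \<in> carrier_vec m" "dim_vec w = m" "dim_vec w' = m" "a < m \<Longrightarrow> spec (w $ a) (w' $ a)"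
  using assms unfolding vspec_def by (blast intro: carrier_vecD)+

lemma vspecI:
  "dim_vec w = m \<Longrightarrow> dim_vec w' = m \<Longrightarrow> (\<And>a. a < m \<Longrightarrow> spec (w $ a) (w' $ a)) \<Longrightarrow> vspec m w w'"
  unfolding vspec_def by (blast intro: carrier_vecI)

lemma vspec_add:
  assumes x: "vspec m x x'" and y: "vspec m y y'" shows "vspec m (x + y) (x' + y')"
  by (rule vspecI) (simp_all add: vspecD[OF x] vspecD[OF y] spec_add)

lemma vspec_smult:
  assumes c: "spec c c'" and x: "vspec m x x'" shows "vspec m (c \<cdot>\<^sub>v x) (c' \<cdot>\<^sub>v x')"
  by (rule vspecI) (simp_all add: vspecD[OF x] spec_mult[OF c])

lemma vspec_mult:
  assumes A: "reg_mat m A" and w: "vspec m w w'"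
  shows "vspec m (A *\<^sub>v w) (map_mat eval_at_1 A *\<^sub>v w')"
proof -
  have c: "A \<in> carrier_mat m m" using A by (simp add: reg_mat_def)
  note wc = vspecD(1,2)[OF w]
  have "spec ((A *\<^sub>v w) $ a) ((map_mat eval_at_1 A *\<^sub>v w') $ a)" if a: "a < m" for a
  proof -
    have "spec (\<Sum>b\<in>{0..<m}. A $$ (a, b) * w $ b) (\<Sum>b\<in>{0..<m}. eval_at_1 (A $$ (a, b)) * w' $ b)"
      using A a by (intro spec_sum spec_mult regular_spec vspecD(5)[OF w]) (simp_all add: reg_mat_def)
    then show ?thesis using c wc a by (simp add: scalar_prod_def)
  qed
  moreover have "A *\<^sub>v w \<in> carrier_vec m" "map_mat eval_at_1 A *\<^sub>v w' \<in> carrier_vec m"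
    using c wc by (auto intro: mult_mat_vec_carrier)
  ultimately show ?thesis by (simp add: vspec_def)
qed

text \<open>Stated for every representation with the right reduction, since \<open>rho\<close> is an
  unspecified choice among such.\<close>

lemma TL_mat_eq_0_iff:
  assumes d: "d \<ge> 1" and n: "n \<ge> 3" and lam: "lam \<in> dpartitions d n"
    and Y: "is_Y_rep d n uu m G T" and sp: "specializes_to d n lam m G T"
  shows "TL_mat m (G 1) (G 2) = 0\<^sub>m m m \<longleftrightarrow> (\<Sum>k<d. first_part (lam ! k)) \<le> 2"
proof -
  define A where "A = G 1"
  define B where "B = G 2"
  define e1 where "e1 = e_mat d m T 1"
  define e2 where "e2 = e_mat d m T 2"
  let ?SA = "map_mat eval_at_1 A" and ?SB = "map_mat eval_at_1 B"
  have len: "length lam = d" using lam by (simp add: dpartitions_def)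
  have ix: "1 \<in> {1..<n}" "2 \<in> {1..<n}" using n by auto
  have Gr: "reg_mat m (G i)" if "i \<in> {1..<n}" for i
    using Y sp that unfolding is_Y_rep_def specializes_to_def reg_mat_def by blast
  have Tr: "reg_mat m (T j)" if "j \<in> {1..n}" for j
    using Y sp that unfolding is_Y_rep_def specializes_to_def reg_mat_def by blast
  have er: "reg_mat m (e_mat d m T i)" if "i \<in> {1..<n}" for i
    using that by (intro reg_mat_e_mat[OF d] Tr) auto
  have Ar: "reg_mat m A" "reg_mat m B" "reg_mat m e1" "reg_mat m e2"
    unfolding A_def B_def e1_def e2_def using Gr ix er by blast+
  have Ac: "A \<in> carrier_mat m m" "B \<in> carrier_mat m m" and ec: "e1 \<in> carrier_mat m m" "e2 \<in> carrier_mat m m"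
    using Ar by (simp_all add: reg_mat_def)
  have Sc: "?SA \<in> carrier_mat m m" "?SB \<in> carrier_mat m m" using Ac by auto
  obtain f where fbij: "bij_betw f (carrier_vec m) (specht n lam)"
    and F1: "\<forall>v\<in>carrier_vec m. \<forall>w\<in>carrier_vec m. f (v + w) = (\<lambda>t. f v t + f w t)"
    and F2: "\<forall>v\<in>carrier_vec m. \<forall>c. f (c \<cdot>\<^sub>v v) = (\<lambda>t. c * f v t)"
    and F3: "\<forall>i\<in>{1..<n}. \<forall>v\<in>carrier_vec m. f (map_mat eval_at_1 (G i) *\<^sub>v v) = act_s i (f v)"
    using sp unfolding specializes_to_def iso_to_specht_def by blast
  have fA: "f (?SA *\<^sub>v v) = act_s 1 (f v)" and fB: "f (?SB *\<^sub>v v) = act_s 2 (f v)" if "v \<in> carrier_vec m" for v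
    unfolding A_def B_def using F3 ix that by blast+
  have "(0::complex) \<cdot>\<^sub>v 0\<^sub>v m = 0\<^sub>v m" by (intro eq_vecI) simp_all
  moreover have "f (0 \<cdot>\<^sub>v 0\<^sub>v m) = (\<lambda>t. 0 * f (0\<^sub>v m) t)" using F2 zero_carrier_vec by blast
  ultimately have f0: "f (0\<^sub>v m) = (\<lambda>t. 0)" by simp
  have fE: "f (TL_mat m ?SA ?SB *\<^sub>v v) = sym3 (f v)" if v: "v \<in> carrier_vec m" for v
  proof -
    note car = mult_mat_vec_carrier[OF Sc(1)] mult_mat_vec_carrier[OF Sc(2)] v
    show ?thesis unfolding TL_mat_vec[OF Sc v]
      using car by (simp add: F1 fA fB act_s_def sym3_def fun_eq_iff)
  qed
  have "TL_mat m A B = 0\<^sub>m m m \<longleftrightarrow> (\<Sum>k<d. first_part (lam ! k)) \<le> 2"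
  proof
    assume E0: "TL_mat m A B = 0\<^sub>m m m"
    show "(\<Sum>k<d. first_part (lam ! k)) \<le> 2"
    proof (rule ccontr)
      assume "\<not> (\<Sum>k<d. first_part (lam ! k)) \<le> 2"
      then obtain x t where x: "x \<in> specht n lam" "sym3 x t \<noteq> 0"
        using ex_sym3_specht_neq_0[OF lam n] len by blast
      obtain v where v: "v \<in> carrier_vec m" "x = f v" using fbij x(1) by (auto simp: bij_betw_def)
      \<comment> \<open>A constant lift of \<open>v\<close>: the vanishing of the element on it
        reduces to the vanishing of the symmetrizer on \<open>x\<close>.\<close>
      let ?w = "map_vec emb v"
      have w: "?w \<in> carrier_vec m" using v by simp
      have ws: "vspec m ?w v" by (rule vspecI) (use v(1) spec_emb in simp_all)
      have "vspec m (TL_mat m A B *\<^sub>v ?w) (TL_mat m ?SA ?SB *\<^sub>v v)"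
        unfolding TL_mat_vec[OF Ac w] TL_mat_vec[OF Sc v(1)]
        by (intro vspec_add vspec_mult Ar ws)
      moreover have "0\<^sub>m m m *\<^sub>v ?w = 0\<^sub>v m" using w by (intro eq_vecI) (simp_all add: scalar_prod_def)
      then have "vspec m (TL_mat m A B *\<^sub>v ?w) (0\<^sub>v m)"
        unfolding E0 by (intro vspecI) (simp_all add: spec_0)
      ultimately have "TL_mat m ?SA ?SB *\<^sub>v v = 0\<^sub>v m" by (rule vspec_unique)
      then have "sym3 x = (\<lambda>t. 0)" using fE[OF v(1)] f0 v(2) by simp
      then show False using x(2) by simp
    qed
  next
    assume small: "(\<Sum>k<d. first_part (lam ! k)) \<le> 2"
    show "TL_mat m A B = 0\<^sub>m m m"
    proof (rule ccontr)
      assume ne: "TL_mat m A B \<noteq> 0\<^sub>m m m"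
      have Ec: "TL_mat m A B \<in> carrier_mat m m" using Ac by (simp add: TL_mat_def)
      obtain w where w: "w \<in> carrier_vec m" "TL_mat m A B *\<^sub>v w \<noteq> 0\<^sub>m m m *\<^sub>v w"
        using mat_eq_by_vec[OF Ec zero_carrier_mat] ne by blast
      define u where "u = TL_mat m A B *\<^sub>v w"
      have uc: "u \<in> carrier_vec m" unfolding u_def using Ec w(1) by simp
      have "0\<^sub>m m m *\<^sub>v w = 0\<^sub>v m" using w(1) by (intro eq_vecI) (simp_all add: scalar_prod_def)
      then have u0: "u \<noteq> 0\<^sub>v m" using w(2) by (simp add: u_def)
      have "\<exists>a\<in>{..<m}. u $ a \<noteq> 0"
      proof (rule ccontr)
        assume "\<not> (\<exists>a\<in>{..<m}. u $ a \<noteq> 0)"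
        then have "u = 0\<^sub>v m" using uc by (intro eq_vecI) simp_all
        then show False using u0 by simp
      qed
      then obtain a1 where a1: "a1 \<in> {..<m}" "u $ a1 \<noteq> 0" by blast
      \<comment> \<open>The scaled vector has coordinate 1 at \<open>a0\<close>, so its reduction is
        nonzero; the contradiction comes from there.\<close>
      obtain s a0 where s: "a0 \<in> {..<m}" "s * u $ a0 = 1" "\<forall>a\<in>{..<m}. \<exists>c. spec (s * u $ a) c"
        using primitive_scaling[of "{..<m}" a1 "\<lambda>a. u $ a", OF _ a1] by blast
      have quad: "A * A = 1\<^sub>m m + (uu - 1) \<cdot>\<^sub>m e1 + (uu - 1) \<cdot>\<^sub>m (e1 * A)"
        "B * B = 1\<^sub>m m + (uu - 1) \<cdot>\<^sub>m e2 + (uu - 1) \<cdot>\<^sub>m (e2 * B)"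
        unfolding A_def B_def e1_def e2_def using Y ix unfolding is_Y_rep_def by blast+
      have braid: "A * B * A = B * A * B"
      proof -
        have "\<forall>i. 1 \<le> i \<and> i + 2 \<le> n \<longrightarrow> G i * G (Suc i) * G i = G (Suc i) * G i * G (Suc i)"
          using Y unfolding is_Y_rep_def by blast
        from this[rule_format, of 1] show ?thesis using n unfolding A_def B_def by (simp add: numeral_2_eq_2)
      qed
      note eig = TL_mat_eigen[OF Ac ec w(1) braid quad, folded u_def]
      define y where "y = s \<cdot>\<^sub>v u"
      define y' where "y' = vec m (\<lambda>a. eval_at_1 (y $ a))"
      have yc: "y \<in> carrier_vec m" "y' \<in> carrier_vec m" using uc by (simp_all add: y_def y'_def)
      have ys: "vspec m y y'" unfolding vspec_def
      proof (intro conjI yc allI impI)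
        fix a assume a: "a < m"
        then obtain c where "spec (s * u $ a) c" using s(3) by blast
        then have "spec (y $ a) c" using a uc by (simp add: y_def)
        then show "spec (y $ a) (y' $ a)" using a eval_at_1_eqI by (simp add: y'_def)
      qed
      have fixed: "map_mat eval_at_1 X *\<^sub>v y' = y'"
        if X: "reg_mat m X" and e: "reg_mat m e" and eig: "X *\<^sub>v u = u + (uu - 1) \<cdot>\<^sub>v (e *\<^sub>v u)" for X e
      proof (rule vspec_unique)
        have Xc: "X \<in> carrier_mat m m" "e \<in> carrier_mat m m" using X e by (simp_all add: reg_mat_def)
        show "vspec m (X *\<^sub>v y) (map_mat eval_at_1 X *\<^sub>v y')" by (rule vspec_mult[OF X ys])
        have "X *\<^sub>v y = s \<cdot>\<^sub>v (u + (uu - 1) \<cdot>\<^sub>v (e *\<^sub>v u))"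
          unfolding y_def mult_mat_vec[OF Xc(1) uc] eig ..
        also have "\<dots> = y + (uu - 1) \<cdot>\<^sub>v (s \<cdot>\<^sub>v (e *\<^sub>v u))"
          unfolding y_def using uc Xc(2) by (intro eq_vecI) (simp_all add: algebra_simps del: index_mult_mat_vec)
        also have "s \<cdot>\<^sub>v (e *\<^sub>v u) = e *\<^sub>v y"
          unfolding y_def mult_mat_vec[OF Xc(2) uc] ..
        finally have eq: "X *\<^sub>v y = y + (uu - 1) \<cdot>\<^sub>v (e *\<^sub>v y)" .
        \<comment> \<open>At 1 the factor becomes \<open>1 - 1\<close>, so the correction term
          disappears and the reduction of \<open>y\<close> is fixed.\<close>
        have "vspec m (y + (uu - 1) \<cdot>\<^sub>v (e *\<^sub>v y)) (y' + (1 - 1) \<cdot>\<^sub>v (map_mat eval_at_1 e *\<^sub>v y'))"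
          by (intro vspec_add vspec_smult vspec_mult spec_diff spec_uu spec_1 ys e)
        moreover have "y' + (1 - 1) \<cdot>\<^sub>v (map_mat eval_at_1 e *\<^sub>v y') = y'"
          using yc Xc(2) by (intro eq_vecI) (simp_all del: index_mult_mat_vec)
        ultimately show "vspec m (X *\<^sub>v y) y'" unfolding eq by simp
      qed
      define x where "x = f y'"
      have xS: "x \<in> specht n lam" unfolding x_def using bij_betwE[OF fbij] yc(2) by blast
      have act: "act_s 1 x = x" "act_s 2 x = x"
        using fA[OF yc(2)] fB[OF yc(2)] fixed[OF Ar(1,3) eig(1)] fixed[OF Ar(2,4) eig(2)] by (simp_all add: x_def)
      have inv: "x (t \<circ> sgen 1) = x t" "x (t \<circ> sgen 2) = x t" for t
        using fun_cong[OF act(1), of t] fun_cong[OF act(2), of t] unfolding act_s_def by simp_all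
      have "x t = 0" for t
      proof -
        have "sym3 x t = 0" using small len by (intro sym3_specht_eq_0[OF lam n xS]) simp
        \<comment> \<open>On a vector fixed by both transpositions the symmetrizer is multiplication
          by 6.\<close>
        then have "6 * x t = 0" unfolding sym3_def inv by simp
        then show ?thesis by simp
      qed
      then have "f y' = f (0\<^sub>v m)" using f0 unfolding x_def by (intro ext) simp
      then have "y' = 0\<^sub>v m" using inj_onD[OF bij_betw_imp_inj_on[OF fbij]] yc(2) zero_carrier_vec by blast
      moreover have "y' $ a0 = 1" using s(1,2) uc eval_at_1_eqI[OF spec_1] by (simp add: y'_def y_def)
      ultimately show False using s(1) by simp
    qed
  qed
  then show ?thesis unfolding A_def B_def .
qed

text \<open>The constructed model provides the existence that makes the choice in \<open>rho\<close>
  meaningful.\<close>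

lemma rho_properties:
  assumes d: "d \<ge> 1" and lam: "lam \<in> dpartitions d n" and r: "rho d n lam = (m, G, T)"
  shows "is_Y_rep d n uu m G T" "specializes_to d n lam m G T"
proof -
  obtain T0 where T0: "T0 \<in> dtableaux n lam"
    "\<And>j k. 1 \<le> j \<Longrightarrow> j < k \<Longrightarrow> k \<le> n \<Longrightarrow>
       (fst (T0 j), snd (snd (T0 j)), fst (snd (T0 j))) < (fst (T0 k), snd (snd (T0 k)), fst (snd (T0 k)))"
    by (rule ex_column_reading_tableau[OF lam]) blast
  interpret coltab d n lam T0 by unfold_locales (use lam T0 in auto)
  let ?Q = "\<lambda>(m, G, T). is_Y_rep d n uu m G T \<and> irreducible_rep n m G T \<and> specializes_to d n lam m G T"
  have "\<exists>x. ?Q x" using ex_Y_rep[OF d] by simp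
  then have "?Q (rho d n lam)" unfolding rho_def by (rule someI_ex)
  then show "is_Y_rep d n uu m G T" "specializes_to d n lam m G T" unfolding r by simp_all
qed

theorem theorem1:
  fixes d n :: nat
  assumes "d \<ge> 1" and "n \<ge> 3"
  shows "YTL_labels d n = {lam\<in>dpartitions d n. (\<Sum>i<d. first_part (lam ! i)) \<le> 2}"
proof -
  have iff: "(case rho d n lam of (m, G, T) \<Rightarrow>
        G 1 * G 2 * G 1 + G 1 * G 2 + G 2 * G 1 + G 1 + G 2 + 1\<^sub>m m = 0\<^sub>m m m)
      \<longleftrightarrow> (\<Sum>i<d. first_part (lam ! i)) \<le> 2" if lam: "lam \<in> dpartitions d n" for lam
  proof -
    obtain m G T where r: "rho d n lam = (m, G, T)" by (cases "rho d n lam")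
    show ?thesis
      using TL_mat_eq_0_iff[OF assms lam rho_properties[OF assms(1) lam r]]
      unfolding r TL_mat_def by simp
  qed
  show ?thesis unfolding YTL_labels_def
    by (rule Collect_cong, rule conj_cong[OF refl], rule iff)
qed

end
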